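(* Let $K$ be a CM-field with a CM-type $\{\varphi_1,\dots,\varphi_n\}$ and reflex field $K^*$ such that (C1) the complex torus $\mathbb{C}^g/\Psi(\mathcal{O}_{K^*})$ can be given a structure of a principally polarized abelian variety, and (C2) $(K^* )^*=K$. Fix $\xi\in K^*$ satisfying (P1)–(P3) of the context. Let $\mathfrak{f}=\mathfrak{f}_0\mathcal{O}_K$ for a proper nontrivial ideal $\mathfrak{f}_0$ of $\mathcal{O}_{K_0}$, and let $C\in\mathrm{Cl}(\mathfrak{f})$. Then the Siegel invariant $\Theta_\mathfrak{f}(C)$, computed from an integral ideal $\mathfrak{c}$ in $C$ as in the context, does not depend on the choice of the integral ideal $\mathfrak{c}$ in $C$. That is, if $\mathfrak{c},\mathfrak{c}'$ are integral ideals in $C$, then the value computed from $\mathfrak{c}$ equals the value computed from $\mathfrak{c}'$ (as values of meromorphic functions: one is finite if and only if the other is, and then they are equal).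
   Context: **CM data.** $K\subset\mathbb{C}$ is a CM-field, $[K:\mathbb{Q}]=2n$; $\{\varphi_1,\dots,\varphi_n\}$ is a CM-type of $K$: $\varphi_1,\dots,\varphi_n,\overline{\varphi}_1,\dots,\overline{\varphi}_n$ are all the embeddings $K\to\mathbb{C}$. $L\subset\mathbb{C}$ is a finite Galois extension of $\mathbb{Q}$ containing $K$. Galois elements act on the right, $(a^\sigma)^\tau=a^{\sigma\tau}$. Put $S=\{\sigma\in\mathrm{Gal}(L/\mathbb{Q}) : \sigma|_K=\varphi_i\text{ for some }i\}$, $S^*=\{\sigma^{-1}:\sigma\in S\}$, $H^*=\{\gamma\in\mathrm{Gal}(L/\mathbb{Q}):\gamma S^*=S^*\}$. The reflex field $K^*$ is the fixed field of $H^*$ in $L$; $\{\psi_1,\dots,\psi_g\}$ is the set of embeddings of $K^*$ into $\mathbb{C}$ obtained from elements of $S^*$. Then $K^*=\mathbb{Q}(\sum_i a^{\varphi_i} : a\in K)$ is a CM-field with CM-type $\{\psi_1,\dots,\psi_g\}$, $[K^*:\mathbb{Q}]=2g$. $(K^* )^*$ denotes the reflex field of $(K^*;\{\psi_j\})$. Let $\Psi:K^*\to\mathbb{C}^g$, $\Psi(a)=(a^{\psi_1},\dots,a^{\psi_g})^T$. For a purely imaginary $c\in K^*$ let $E_c(\mathbf{u},\mathbf{v})=\sum_{j=1}^g c^{\psi_j}(u_j\overline{v}_j-\overline{u}_jv_j)$ for $\mathbf{u},\mathbf{v}\in\mathbb{C}^g$. **Polarization.** (C1) is equivalent to the existence of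 $\xi\in K^*$ with: (P1) $\xi^{\psi_i}$ lies on the positive imaginary axis for all $1\le i\le g$; (P2) $E_\xi$ yields a Riemann form on $\mathbb{C}^g/\Psi(\mathcal{O}_{K^*})$; (P3) $\delta_{K^*}^{-1}=\xi\mathcal{O}_{K^*}$, where $\delta_{K^*}$ is the different ideal of $K^*$. One such $\xi$ is fixed. **Reflex norm.** $\varphi:K^\times\to(K^* )^\times$, $\varphi(a)=\prod_{i=1}^n a^{\varphi_i}$ (well defined by (C2)). For a fractional ideal $\mathfrak{a}$ of $K$, $\varphi(\mathfrak{a})$ is the fractional ideal of $K^*$ with $\varphi(\mathfrak{a})\mathcal{O}_L=\prod_{i=1}^n(\mathfrak{a}\mathcal{O}_L)^{\varphi_i}$. **Ideals.** $K_0$ is the fixed field in $L$ of the subgroup generated by $\{\sigma\in\mathrm{Gal}(L/\mathbb{Q}):\sigma|_K=\varphi_i\text{ for some }i\}$; it is either $\mathbb{Q}$ or an imaginary quadratic subfield of $K$ and $K^*$. $\mathfrak{f}_0$ is a proper nontrivial ideal of $\mathcal{O}_{K_0}$, $\mathfrak{f}=\mathfrak{f}_0\mathcal{O}_K$, $\mathfrak{f}^*=\mathfrak{f}_0\mathcal{O}_{K^*}$, and $N$ is the smallest positive integer in $\mathfrak{f}$. $\mathrm{Cl}(\mathfrak{f})$ is the ray class group of $K$ modulo $\mathfrak{f}$ (classes of fractional ideals prime to $\mathfrak{f}$ modulo principal ideals $\nu\mathcal{O}_K$ with $\nu\equiv^*1\pmod{\mathfrak{f}}$). **The function $\Theta$.**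 $\mathbb{H}_g$ is the Siegel upper half-space of degree $g$, $e(x)=e^{2\pi \mathrm{i}x}$. For $\mathbf{r},\mathbf{s}\in\mathbb{Q}^g$, $Z\in\mathbb{H}_g$, $$\theta(\left[\begin{smallmatrix}\mathbf{r}\\ \mathbf{s}\end{smallmatrix}\right],Z)=\sum_{\mathbf{n}\in\mathbb{Z}^g}e\left(\tfrac12(\mathbf{n}+\mathbf{r})^TZ(\mathbf{n}+\mathbf{r})+(\mathbf{n}+\mathbf{r})^T\mathbf{s}\right).$$ Let $S_-$ (resp. $S_+$) be the set of $\left[\begin{smallmatrix}\mathbf{a}\\ \mathbf{b}\end{smallmatrix}\right]$ with $\mathbf{a},\mathbf{b}\in\{0,1/2\}^g$ and $e(2\mathbf{a}^T\mathbf{b})=-1$ (resp. $=1$). For $\mathbf{r},\mathbf{s}\in\frac1N\mathbb{Z}^g$ put $$\Theta(\left[\begin{smallmatrix}\mathbf{r}\\ \mathbf{s}\end{smallmatrix}\right],Z)=2^{4N}e\left(-2^gN(2^g-1)(2^g+1)\mathbf{r}^T\mathbf{s}\right)\frac{\prod_{\left[\begin{smallmatrix}\mathbf{a}\\ \mathbf{b}\end{smallmatrix}\right]\in S_-}\theta(\left[\begin{smallmatrix}\mathbf{a}\\ \mathbf{b}\end{smallmatrix}\right]-\left[\begin{smallmatrix}\mathbf{r}\\ \mathbf{s}\end{smallmatrix}\right],Z)^{4N(2^g+1)}}{\prod_{\left[\begin{smallmatrix}\mathbf{c}\\ \mathbf{d}\end{smallmatrix}\right]\in S_+}\theta(\left[\begin{smallmatrix}\mathbf{c}\\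 \mathbf{d}\end{smallmatrix}\right],Z)^{4N(2^g-1)}},$$ a meromorphic function on $\mathbb{H}_g$. **Siegel invariant.** Let $C\in\mathrm{Cl}(\mathfrak{f})$ and let $\mathfrak{c}$ be an integral ideal in $C$. Put $m_\mathfrak{c}=\sqrt[g]{\mathcal{N}_{K^*}((\mathfrak{f}^* )^{-1}\varphi(\mathfrak{c}))}$ with $\mathcal{N}_{K^*}$ the absolute norm of fractional ideals. Then $\mathcal{P}_\mathfrak{c}=(\mathbb{C}^g/\Psi(\mathfrak{f}^*\varphi(\mathfrak{c})^{-1}),E_{\xi m_\mathfrak{c}})$ is a principally polarized abelian variety. A symplectic basis of $\mathcal{P}_\mathfrak{c}$ is a $\mathbb{Z}$-basis $\{\mathbf{b}_1,\dots,\mathbf{b}_{2g}\}$ of $\Psi(\mathfrak{f}^*\varphi(\mathfrak{c})^{-1})$ with $[E_{\xi m_\mathfrak{c}}(\mathbf{b}_i,\mathbf{b}_j)]_{i,j}=\left[\begin{smallmatrix} O & -I_g \\ I_g & O \end{smallmatrix}\right]$. Given one, write $\mathbf{b}_j=\Psi(y_j)$ with $y_j\in\mathfrak{f}^*\varphi(\mathfrak{c})^{-1}$, define its CM-point $Z_0^*=[\mathbf{b}_{g+1}\cdots\mathbf{b}_{2g}]^{-1}[\mathbf{b}_1\cdots\mathbf{b}_g]\in\mathbb{H}_g$, and write $N=\sum_{j=1}^{2g}r_jy_j$ with unique integers $r_j$ (possible since $N\in\mathfrak{f}^*\varphi(\mathfrak{c})^{-1}$). The value of $\Theta_\mathfrak{f}(C)$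 computed from $\mathfrak{c}$ is $$\Theta_\mathfrak{f}(C)=\Theta\left((r_1/N,\dots,r_{2g}/N)^T,\;Z_0^*\right);$$ for a given $\mathfrak{c}$ it does not depend on the choice of the symplectic basis of $\mathcal{P}_\mathfrak{c}$. *)

theory Defs
  imports
    "HOL-Analysis.Analysis"
    "HOL-Algebra.Generated_Groups"
    "HOL-Computational_Algebra.Polynomial"
begin

text \<open>All fields are subfields of the complex numbers, given by their carrier sets, and all
  (fractional) ideals are sets of complex numbers.\<close>

section \<open>Number fields, embeddings, Galois groups\<close>

global_interpretation rat_complex: vector_space "\<lambda>(q::rat) (z::complex). of_rat q * z"
  by unfold_locales (simp_all add: algebra_simps of_rat_add of_rat_mult)

global_interpretation int_complex: module "\<lambda>(k::int) (z::complex). of_int k * z"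
  by unfold_locales (simp_all add: algebra_simps)

definition complex_subfield :: "complex set \<Rightarrow> bool" where
  "complex_subfield F \<longleftrightarrow> 0 \<in> F \<and> 1 \<in> F \<and>
     (\<forall>x\<in>F. \<forall>y\<in>F. x + y \<in> F \<and> x - y \<in> F \<and> x * y \<in> F \<and> x / y \<in> F)"

definition number_field :: "complex set \<Rightarrow> bool" where
  "number_field F \<longleftrightarrow> complex_subfield F \<and> (\<exists>B. finite B \<and> F = rat_complex.span B)"

definition degree_over_Q :: "complex set \<Rightarrow> nat" where
  "degree_over_Q F = rat_complex.dim F"

text \<open>Maps defined on \<open>F\<close> are represented by functions that are \<open>undefined\<close> outside \<open>F\<close>, so that
  distinct elements of the following set are distinct as maps on \<open>F\<close>.\<close>

definition embeddings :: "complex set \<Rightarrow> (complex \<Rightarrow> complex) set" where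
  "embeddings F = {\<sigma> \<in> extensional F. \<sigma> 1 = 1 \<and>
     (\<forall>x\<in>F. \<forall>y\<in>F. \<sigma> (x + y) = \<sigma> x + \<sigma> y \<and> \<sigma> (x * y) = \<sigma> x * \<sigma> y)}"

text \<open>Galois elements act on the right, \<open>(a\<^sup>\<sigma>)\<^sup>\<tau> = a\<^sup>\<sigma>\<^sup>\<tau>\<close>: the product \<open>\<sigma>\<tau>\<close> applies \<open>\<sigma>\<close> first.\<close>

definition Gal :: "complex set \<Rightarrow> (complex \<Rightarrow> complex) monoid" where
  "Gal L = \<lparr>carrier = {\<sigma> \<in> embeddings L. \<sigma> ` L = L},
            monoid.mult = (\<lambda>\<sigma> \<tau>. compose L \<tau> \<sigma>),
            one = (\<lambda>x\<in>L. x)\<rparr>"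

definition fixed_field :: "complex set \<Rightarrow> (complex \<Rightarrow> complex) set \<Rightarrow> complex set" where
  "fixed_field L H = {x \<in> L. \<forall>\<gamma>\<in>H. \<gamma> x = x}"

definition finite_galois_over_Q :: "complex set \<Rightarrow> bool" where
  "finite_galois_over_Q L \<longleftrightarrow> number_field L \<and> fixed_field L (carrier (Gal L)) = \<rat>"


section \<open>CM-fields, CM-types and reflex fields\<close>

definition totally_real :: "complex set \<Rightarrow> bool" where
  "totally_real F \<longleftrightarrow> number_field F \<and> (\<forall>\<sigma>\<in>embeddings F. \<sigma> ` F \<subseteq> \<real>)"

definition totally_imaginary :: "complex set \<Rightarrow> bool" where
  "totally_imaginary F \<longleftrightarrow> number_field F \<and> (\<forall>\<sigma>\<in>embeddings F. \<not> \<sigma> ` F \<subseteq> \<real>)"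

definition cm_field :: "complex set \<Rightarrow> bool" where
  "cm_field K \<longleftrightarrow> totally_imaginary K \<and>
     (\<exists>F. F \<subseteq> K \<and> totally_real F \<and> degree_over_Q K = 2 * degree_over_Q F)"

definition cm_type :: "complex set \<Rightarrow> (complex \<Rightarrow> complex) set \<Rightarrow> bool" where
  "cm_type K \<Phi> \<longleftrightarrow> degree_over_Q K = 2 * card \<Phi> \<and>
     \<Phi> \<union> (\<lambda>\<phi>. \<lambda>x\<in>K. cnj (\<phi> x)) ` \<Phi> = embeddings K"

definition type_lifts ::
    "complex set \<Rightarrow> complex set \<Rightarrow> (complex \<Rightarrow> complex) set \<Rightarrow> (complex \<Rightarrow> complex) set" where
  "type_lifts L K \<Phi> = {\<sigma> \<in> carrier (Gal L). restrict \<sigma> K \<in> \<Phi>}"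

definition inv_type_lifts ::
    "complex set \<Rightarrow> complex set \<Rightarrow> (complex \<Rightarrow> complex) set \<Rightarrow> (complex \<Rightarrow> complex) set" where
  "inv_type_lifts L K \<Phi> = (\<lambda>\<sigma>. m_inv (Gal L) \<sigma>) ` type_lifts L K \<Phi>"

definition reflex_group ::
    "complex set \<Rightarrow> complex set \<Rightarrow> (complex \<Rightarrow> complex) set \<Rightarrow> (complex \<Rightarrow> complex) set" where
  "reflex_group L K \<Phi> = {\<gamma> \<in> carrier (Gal L).
     l_coset (Gal L) \<gamma> (inv_type_lifts L K \<Phi>) = inv_type_lifts L K \<Phi>}"

definition reflex_field ::
    "complex set \<Rightarrow> complex set \<Rightarrow> (complex \<Rightarrow> complex) set \<Rightarrow> complex set" where
  "reflex_field L K \<Phi> = fixed_field L (reflex_group L K \<Phi>)"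

definition reflex_type ::
    "complex set \<Rightarrow> complex set \<Rightarrow> (complex \<Rightarrow> complex) set \<Rightarrow> (complex \<Rightarrow> complex) set" where
  "reflex_type L K \<Phi> = (\<lambda>\<sigma>. restrict \<sigma> (reflex_field L K \<Phi>)) ` inv_type_lifts L K \<Phi>"

text \<open>The field \<open>K\<^sub>0\<close>.\<close>

definition type_fixed_field ::
    "complex set \<Rightarrow> complex set \<Rightarrow> (complex \<Rightarrow> complex) set \<Rightarrow> complex set" where
  "type_fixed_field L K \<Phi> = fixed_field L (generate (Gal L) (type_lifts L K \<Phi>))"


section \<open>Ideals\<close>

definition int_ring :: "complex set \<Rightarrow> complex set" where
  "int_ring F = {x \<in> F. algebraic_int x}"

definition frac_ideal :: "complex set \<Rightarrow> complex set \<Rightarrow> bool" where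
  "frac_ideal F I \<longleftrightarrow> I \<subseteq> F \<and> 0 \<in> I \<and> I \<noteq> {0} \<and>
     (\<forall>x\<in>I. \<forall>y\<in>I. x + y \<in> I) \<and> (\<forall>a\<in>int_ring F. \<forall>x\<in>I. a * x \<in> I) \<and>
     (\<exists>d\<in>int_ring F. d \<noteq> 0 \<and> (\<forall>x\<in>I. d * x \<in> int_ring F))"

text \<open>Integral ideals are nonzero.\<close>

definition integral_ideal :: "complex set \<Rightarrow> complex set \<Rightarrow> bool" where
  "integral_ideal F I \<longleftrightarrow> frac_ideal F I \<and> I \<subseteq> int_ring F"

definition ideal_mult :: "complex set \<Rightarrow> complex set \<Rightarrow> complex set" where
  "ideal_mult I J = int_complex.span {x * y | x y. x \<in> I \<and> y \<in> J}"

definition ideal_prod :: "'i set \<Rightarrow> ('i \<Rightarrow> complex set) \<Rightarrow> complex set" where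
  "ideal_prod A I = int_complex.span {\<Prod>i\<in>A. x i | x. \<forall>i\<in>A. x i \<in> I i}"

definition ideal_sum :: "complex set \<Rightarrow> complex set \<Rightarrow> complex set" where
  "ideal_sum I J = {x + y | x y. x \<in> I \<and> y \<in> J}"

definition principal :: "complex set \<Rightarrow> complex \<Rightarrow> complex set" where
  "principal F a = (\<lambda>x. a * x) ` int_ring F"

definition ideal_ext :: "complex set \<Rightarrow> complex set \<Rightarrow> complex set" where
  "ideal_ext F I = ideal_mult I (int_ring F)"

definition ideal_inv :: "complex set \<Rightarrow> complex set \<Rightarrow> complex set" where
  "ideal_inv F I = {x \<in> F. \<forall>y\<in>I. x * y \<in> int_ring F}"

definition add_index :: "complex set \<Rightarrow> complex set \<Rightarrow> nat" where
  "add_index A B = card ((\<lambda>x. (\<lambda>b. x + b) ` B) ` A)"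

text \<open>The absolute norm of a fractional ideal as a generalized index; for \<open>I\<close> contained in the ring
  of integers it is the index of \<open>I\<close>.\<close>

definition abs_norm :: "complex set \<Rightarrow> complex set \<Rightarrow> real" where
  "abs_norm F I = real (add_index (int_ring F) (I \<inter> int_ring F)) / real (add_index I (I \<inter> int_ring F))"

definition trace_Q :: "complex set \<Rightarrow> complex \<Rightarrow> complex" where
  "trace_Q F x = (\<Sum>\<sigma>\<in>embeddings F. \<sigma> x)"

definition different :: "complex set \<Rightarrow> complex set" where
  "different F = ideal_inv F {x \<in> F. \<forall>y\<in>int_ring F. trace_Q F (x * y) \<in> \<int>}"

text \<open>For an embedding \<open>\<phi>\<close> of \<open>K\<close>, the conjugate under \<open>\<phi>\<close> of the extension of \<open>\<aa>\<close> to \<open>L\<close> is the ideal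
  of the Galois extension \<open>L\<close> generated by the image of \<open>\<aa>\<close> (apply any extension of \<open>\<phi>\<close> to \<open>L\<close>).\<close>

definition reflex_norm_ideal ::
    "complex set \<Rightarrow> complex set \<Rightarrow> (complex \<Rightarrow> complex) set \<Rightarrow> complex set \<Rightarrow> complex set" where
  "reflex_norm_ideal L K \<Phi> \<aa> = (THE \<bb>. frac_ideal (reflex_field L K \<Phi>) \<bb> \<and>
     ideal_ext L \<bb> = ideal_prod \<Phi> (\<lambda>\<phi>. ideal_ext L (\<phi> ` \<aa>)))"


section \<open>Ray class groups\<close>

text \<open>A fractional ideal is prime to the integral ideal \<open>\<ff>\<close> iff it is a quotient of integral ideals
  that are comaximal with \<open>\<ff>\<close>.\<close>

definition prime_to :: "complex set \<Rightarrow> complex set \<Rightarrow> complex set \<Rightarrow> bool" where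
  "prime_to F \<ff> \<aa> \<longleftrightarrow> frac_ideal F \<aa> \<and>
     (\<exists>\<bb> \<cc>. integral_ideal F \<bb> \<and> ideal_sum \<bb> \<ff> = int_ring F \<and>
            integral_ideal F \<cc> \<and> ideal_sum \<cc> \<ff> = int_ring F \<and> ideal_mult \<aa> \<bb> = \<cc>)"

definition ideals_prime_to :: "complex set \<Rightarrow> complex set \<Rightarrow> complex set monoid" where
  "ideals_prime_to F \<ff> =
     \<lparr>carrier = {\<aa>. prime_to F \<ff> \<aa>}, monoid.mult = ideal_mult, one = int_ring F\<rparr>"

text \<open>The multiplicative congruence \<open>\<nu> \<equiv>\<^sup>* 1 (mod \<ff>)\<close>; there is no condition at infinite places,
  as it is used for totally imaginary fields only.\<close>

definition cong_one :: "complex set \<Rightarrow> complex set \<Rightarrow> complex \<Rightarrow> bool" where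
  "cong_one F \<ff> \<nu> \<longleftrightarrow> (\<exists>\<alpha>\<in>int_ring F. \<exists>\<beta>\<in>int_ring F. \<alpha> \<noteq> 0 \<and> \<beta> \<noteq> 0 \<and> \<nu> = \<alpha> / \<beta> \<and>
     ideal_sum (principal F \<alpha>) \<ff> = int_ring F \<and> ideal_sum (principal F \<beta>) \<ff> = int_ring F \<and>
     \<alpha> - \<beta> \<in> \<ff>)"

definition ray_class_group :: "complex set \<Rightarrow> complex set \<Rightarrow> complex set set monoid" where
  "ray_class_group F \<ff> = ideals_prime_to F \<ff> Mod {principal F \<nu> | \<nu>. \<nu> \<in> F \<and> cong_one F \<ff> \<nu>}"


section \<open>Riemann forms and symplectic bases\<close>

text \<open>The positive integer \<open>g\<close> is the cardinality of the index type \<open>'g\<close>; the index set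
  \<open>{1,\<dots>,2g}\<close> is \<open>'g + 'g\<close>, with \<open>Inl\<close> for \<open>1,\<dots>,g\<close> and \<open>Inr\<close> for \<open>g+1,\<dots>,2g\<close>.\<close>

definition Psi :: "('g \<Rightarrow> complex \<Rightarrow> complex) \<Rightarrow> complex \<Rightarrow> complex ^ 'g::finite" where
  "Psi \<psi> a = (\<chi> j. \<psi> j a)"

definition E_form ::
    "('g::finite \<Rightarrow> complex \<Rightarrow> complex) \<Rightarrow> complex \<Rightarrow> complex ^ 'g \<Rightarrow> complex ^ 'g \<Rightarrow> complex" where
  "E_form \<psi> c u v = (\<Sum>j\<in>UNIV. \<psi> j c * (u $ j * cnj (v $ j) - cnj (u $ j) * v $ j))"

definition riemann_form ::
    "(complex ^ 'g::finite) set \<Rightarrow> (complex ^ 'g \<Rightarrow> complex ^ 'g \<Rightarrow> complex) \<Rightarrow> bool" where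
  "riemann_form \<Lambda> E \<longleftrightarrow> bilinear E \<and> (\<forall>u v. E u v \<in> \<real>) \<and> (\<forall>u v. E u v = - E v u) \<and>
     (\<forall>u\<in>\<Lambda>. \<forall>v\<in>\<Lambda>. E u v \<in> \<int>) \<and>
     (\<forall>u v. E u (\<i> *s v) = E v (\<i> *s u)) \<and> (\<forall>u. u \<noteq> 0 \<longrightarrow> Re (E u (\<i> *s u)) > 0)"

definition Z_basis :: "(complex ^ 'g::finite) set \<Rightarrow> ('i::finite \<Rightarrow> complex ^ 'g) \<Rightarrow> bool" where
  "Z_basis \<Lambda> b \<longleftrightarrow> range b \<subseteq> \<Lambda> \<and>
     (\<forall>v\<in>\<Lambda>. \<exists>!r::'i \<Rightarrow> int. v = (\<Sum>j\<in>UNIV. of_int (r j) *s b j))"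

fun symplectic_entry :: "'g + 'g \<Rightarrow> 'g + 'g \<Rightarrow> complex" where
  "symplectic_entry (Inl i) (Inl j) = 0"
| "symplectic_entry (Inl i) (Inr j) = (if i = j then -1 else 0)"
| "symplectic_entry (Inr i) (Inl j) = (if i = j then 1 else 0)"
| "symplectic_entry (Inr i) (Inr j) = 0"

definition symplectic_basis ::
    "(complex ^ 'g::finite) set \<Rightarrow> (complex ^ 'g \<Rightarrow> complex ^ 'g \<Rightarrow> complex) \<Rightarrow>
     ('g + 'g \<Rightarrow> complex ^ 'g) \<Rightarrow> bool" where
  "symplectic_basis \<Lambda> E b \<longleftrightarrow> Z_basis \<Lambda> b \<and> (\<forall>i j. E (b i) (b j) = symplectic_entry i j)"

text \<open>The torus with lattice \<open>\<Lambda>\<close> admits a principal polarization: a Riemann form whose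
  elementary divisors are all \<open>1\<close>.\<close>

definition principally_polarizable :: "(complex ^ 'g::finite) set \<Rightarrow> bool" where
  "principally_polarizable \<Lambda> \<longleftrightarrow> (\<exists>E. riemann_form \<Lambda> E \<and> (\<exists>b. symplectic_basis \<Lambda> E b))"

definition cm_point :: "('g::finite + 'g \<Rightarrow> complex ^ 'g) \<Rightarrow> complex ^ 'g ^ 'g" where
  "cm_point b = matrix_inv (\<chi> i j. b (Inr j) $ i) ** (\<chi> i j. b (Inl j) $ i)"


section \<open>Theta constants\<close>

definition e2pi :: "complex \<Rightarrow> complex" where
  "e2pi x = exp (2 * of_real pi * \<i> * x)"

definition siegel_space :: "(complex ^ 'g::finite ^ 'g) set" where
  "siegel_space = {Z. transpose Z = Z \<and>
     (\<forall>x :: real ^ 'g. x \<noteq> 0 \<longrightarrow> (\<Sum>i\<in>UNIV. \<Sum>j\<in>UNIV. x $ i * Im (Z $ i $ j) * x $ j) > 0)}"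

definition theta :: "real ^ 'g::finite \<Rightarrow> real ^ 'g \<Rightarrow> complex ^ 'g ^ 'g \<Rightarrow> complex" where
  "theta r s Z = (\<Sum>\<^sub>\<infinity>n\<in>(UNIV :: (int ^ 'g) set).
     let x = (\<chi> i. of_int (n $ i)) + r in
       e2pi ((\<Sum>i\<in>UNIV. \<Sum>j\<in>UNIV. of_real (x $ i) * Z $ i $ j * of_real (x $ j)) / 2
             + of_real (x \<bullet> s)))"

definition half_chars :: "complex \<Rightarrow> ((real ^ 'g::finite) \<times> (real ^ 'g)) set" where
  "half_chars \<epsilon> = {(a, b). (\<forall>i. a $ i \<in> {0, 1/2} \<and> b $ i \<in> {0, 1/2}) \<and>
     e2pi (of_real (2 * (a \<bullet> b))) = \<epsilon>}"

definition Theta_num :: "nat \<Rightarrow> real ^ 'g::finite \<Rightarrow> real ^ 'g \<Rightarrow> complex ^ 'g ^ 'g \<Rightarrow> complex" where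
  "Theta_num N r s Z =
     2 ^ (4 * N) *
     e2pi (of_real (- (2 ^ CARD('g) * real N * (2 ^ CARD('g) - 1) * (2 ^ CARD('g) + 1) * (r \<bullet> s)))) *
     (\<Prod>(a, b)\<in>half_chars (-1). theta (a - r) (b - s) Z ^ (4 * N * (2 ^ CARD('g) + 1)))"

definition Theta_den :: "nat \<Rightarrow> complex ^ 'g ^ 'g::finite \<Rightarrow> complex" where
  "Theta_den N Z = (\<Prod>(c, d)\<in>half_chars 1. theta c d Z ^ (4 * N * (2 ^ CARD('g) - 1)))"

text \<open>The value at \<open>Z\<^sub>0\<close> of the meromorphic function \<open>f / h\<close> on \<open>D\<close> (\<open>f\<close>, \<open>h\<close> holomorphic, \<open>h\<close> not
  identically zero): by the Riemann extension theorem \<open>f / h\<close> is holomorphic at \<open>Z\<^sub>0\<close> iff it has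
  a limit at \<open>Z\<^sub>0\<close> along the points where \<open>h\<close> does not vanish, and the limit is then its value.
  \<open>None\<close> means that there is no finite value. The quotient itself would not do,
  since division by zero gives zero.\<close>

definition meromorphic_value ::
    "'a::topological_space set \<Rightarrow> ('a \<Rightarrow> complex) \<Rightarrow> ('a \<Rightarrow> complex) \<Rightarrow> 'a \<Rightarrow> complex option" where
  "meromorphic_value D f h Z\<^sub>0 =
     (let F = at Z\<^sub>0 within {Z \<in> D. h Z \<noteq> 0}; q = (\<lambda>Z. f Z / h Z)
      in if \<exists>w. (q \<longlongrightarrow> w) F then Some (Lim F q) else None)"

definition Theta_value ::
    "nat \<Rightarrow> real ^ 'g::finite \<Rightarrow> real ^ 'g \<Rightarrow> complex ^ 'g ^ 'g \<Rightarrow> complex option" where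
  "Theta_value N r s Z\<^sub>0 = meromorphic_value siegel_space (Theta_num N r s) (Theta_den N) Z\<^sub>0"


section \<open>Siegel invariants\<close>

definition smallest_pos_int :: "complex set \<Rightarrow> nat" where
  "smallest_pos_int \<ff> = (LEAST m. 0 < m \<and> of_nat m \<in> \<ff>)"

definition siegel_lattice ::
    "complex set \<Rightarrow> complex set \<Rightarrow> (complex \<Rightarrow> complex) set \<Rightarrow> complex set \<Rightarrow> complex set \<Rightarrow>
     complex set" where
  "siegel_lattice L K \<Phi> \<ff>\<^sub>0 \<cc> =
     ideal_mult (ideal_ext (reflex_field L K \<Phi>) \<ff>\<^sub>0)
                (ideal_inv (reflex_field L K \<Phi>) (reflex_norm_ideal L K \<Phi> \<cc>))"

text \<open>The number \<open>m\<close> of the polarization attached to \<open>\<cc>\<close>; \<open>g\<close> is the cardinality of the CM-type of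
  the reflex field.\<close>

definition siegel_mult ::
    "complex set \<Rightarrow> complex set \<Rightarrow> (complex \<Rightarrow> complex) set \<Rightarrow> complex set \<Rightarrow> complex set \<Rightarrow>
     real" where
  "siegel_mult L K \<Phi> \<ff>\<^sub>0 \<cc> = root (card (reflex_type L K \<Phi>))
     (abs_norm (reflex_field L K \<Phi>)
       (ideal_mult (ideal_inv (reflex_field L K \<Phi>) (ideal_ext (reflex_field L K \<Phi>) \<ff>\<^sub>0))
                   (reflex_norm_ideal L K \<Phi> \<cc>)))"

text \<open>The values of the Siegel invariant computed from the integral ideal \<open>\<cc>\<close>, over all symplectic
  bases \<open>b\<close> of the polarized abelian variety attached to \<open>\<cc>\<close>. As the value does not depend on
  the symplectic basis, this is the singleton of "the value computed from \<open>\<cc>\<close>" (\<open>None\<close> if it is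
  not finite). The number \<open>m\<close> is rational, so that \<open>m * E_form \<psi> \<xi>\<close> is the form attached to
  \<open>\<xi> * m\<close>.\<close>

definition siegel_values ::
    "('g::finite \<Rightarrow> complex \<Rightarrow> complex) \<Rightarrow> complex \<Rightarrow> complex set \<Rightarrow> complex set \<Rightarrow>
     (complex \<Rightarrow> complex) set \<Rightarrow> complex set \<Rightarrow> complex set \<Rightarrow> complex option set" where
  "siegel_values \<psi> \<xi> L K \<Phi> \<ff>\<^sub>0 \<cc> =
     (let \<ll> = siegel_lattice L K \<Phi> \<ff>\<^sub>0 \<cc>;
          m = siegel_mult L K \<Phi> \<ff>\<^sub>0 \<cc>;
          N = smallest_pos_int (ideal_ext K \<ff>\<^sub>0)
      in {w. \<exists>b y (r :: 'g + 'g \<Rightarrow> int).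
            symplectic_basis (Psi \<psi> ` \<ll>) (\<lambda>u v. of_real m * E_form \<psi> \<xi> u v) b \<and>
            (\<forall>j. y j \<in> \<ll> \<and> b j = Psi \<psi> (y j)) \<and>
            of_nat N = (\<Sum>j\<in>UNIV. of_int (r j) * y j) \<and>
            w = Theta_value N (\<chi> i. of_int (r (Inl i)) / of_nat N)
                              (\<chi> i. of_int (r (Inr i)) / of_nat N) (cm_point b)})"

end

theory Submission
  imports Defs "HOL-Computational_Algebra.Fundamental_Theorem_Algebra"
begin

text \<open>Two integral ideals in the same ray class satisfy \<open>\<cc>' = \<nu> \<cc>\<close> with \<open>\<nu> \<equiv>\<^sup>* 1\<close> modulo \<open>\<ff>\<close>. With \<open>\<lambda> = \<phi>(\<nu>)\<close>,
  the lattice of \<open>\<cc>'\<close> is \<open>\<lambda>\<^sup>-\<^sup>1\<close> times that of \<open>\<cc>\<close>. As \<open>\<lambda> \<cdot> cnj \<lambda>\<close> is the norm of \<open>\<nu>\<close>, a positive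
  rational number which is preserved by all \<open>\<psi>\<^sub>j\<close>, the factor \<open>m\<close> compensates for the effect of this
  scaling on the Riemann form, so that \<open>\<lambda>\<^sup>-\<^sup>1\<close> maps symplectic bases to symplectic bases with the same
  CM-point. The coordinates of \<open>N\<close> in the new basis are those of \<open>\<lambda> N\<close> in the old one, and
  \<open>\<lambda> - 1\<close> lies in the lattice of \<open>\<cc>\<close>; hence the characteristics differ by integral vectors,
  under which \<open>\<Theta>\<close> is invariant.\<close>

section \<open>Algebraic integers\<close>

text \<open>That \<lambda> - 1 lies in the lattice depends on the conductor coming from the subfield
  fixed by the lifts of the type: each member of the type then carries a congruence modulo the
  conductor of K to one in L, and these congruences can be multiplied. The obstacle is to bring the
  resulting congruence from L back to the reflex field. Extension of ideals to L loses no
  information on invertible ideals; invertibility is proved by Kronecker's polynomial method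
  together with Dedekind's Prague theorem, and it builds on finite generation of the integers of the
  reflex field. This in turn is read off from (C1), because a principal polarization of the torus
  includes a Z-basis of its lattice. The same basis, with its 2g members, governs the norm:
  \<lambda> and its conjugate change the index of a lattice by equal factors, hence each by the
  square root of (\<lambda> \<cdot> cnj \<lambda>)^(2g), and the g-th root in the definition of m
  leaves exactly \<lambda> \<cdot> cnj \<lambda>.\<close>

lemma int_mult_span: "x \<in> int_complex.span S \<Longrightarrow> of_int n * x \<in> int_complex.span S"
  using int_complex.span_scale by blast

section \<open>Subgroups of the integers and of finitely generated groups\<close>

lemma int_subgroup_principal:
  fixes J :: "int set"
  assumes "0 \<in> J" "\<And>x y. x \<in> J \<Longrightarrow> y \<in> J \<Longrightarrow> x + y \<in> J" "\<And>n x. x \<in> J \<Longrightarrow> n * x \<in> J"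
  shows "\<exists>d\<in>J. \<forall>x\<in>J. d dvd x"
proof (cases "J = {0}")
  case False
  then obtain x where x: "x \<in> J" "x \<noteq> 0" using assms(1) by blast
  have "\<bar>x\<bar> \<in> J" using x assms(3)[of x "sgn x"] by (simp add: sgn_mult_abs abs_sgn mult.commute)
  then have ex: "\<exists>n::nat. 0 < n \<and> int n \<in> J" using x by (intro exI[of _ "nat \<bar>x\<bar>"]) auto
  define d where "d = (LEAST n::nat. 0 < n \<and> int n \<in> J)"
  have d: "0 < d" "int d \<in> J" using LeastI_ex[OF ex] by (auto simp: d_def)
  have "int d dvd y" if "y \<in> J" for y
  proof (rule ccontr)
    assume "\<not> int d dvd y"
    then have pos: "y mod int d > 0" using d
      by (metis dvd_eq_mod_eq_0 mod_pos_pos_trivial of_nat_0_less_iff order_le_less pos_mod_sign)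
    have "y + (- (y div int d)) * int d \<in> J" using assms(2,3) d that by blast
    then have "y mod int d \<in> J" by (simp add: minus_div_mult_eq_mod)
    then have "(LEAST n::nat. 0 < n \<and> int n \<in> J) \<le> nat (y mod int d)"
      using pos by (intro Least_le) auto
    then have "d \<le> nat (y mod int d)" by (simp only: d_def)
    then show False using d pos_mod_bound[of "int d" y] pos by linarith
  qed
  then show ?thesis using d by blast
qed auto

text \<open>Z is Noetherian. By induction on the generators: the coefficients with which the new
  generator \<open>m\<close> occurs in \<open>A\<close>, modulo the span of the others, form a
  subgroup \<open>J\<close> of Z. An element \<open>a\<close> of \<open>A\<close> whose coefficient
  generates \<open>J\<close> makes up, together with generators of \<open>A \<inter> span S\<close>,
  a generating set.\<close>

lemma subgroup_of_fg:
  assumes "finite S" "int_complex.subspace A" "A \<subseteq> int_complex.span S"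
  shows "\<exists>T. finite T \<and> A = int_complex.span T"
  using assms
proof (induction S arbitrary: A)
  case empty
  then have "A = {0}" using int_complex.subspace_0 by auto
  then show ?case using int_complex.span_empty by (metis finite.emptyI)
next
  case (insert m S)
  note A = insert.prems(1)
  define J where "J = {n::int. \<exists>s\<in>int_complex.span S. of_int n * m + s \<in> A}"
  have "0 \<in> J" unfolding J_def using int_complex.span_zero int_complex.subspace_0[OF A] by force
  moreover have "x + y \<in> J" if xy: "x \<in> J" "y \<in> J" for x y
  proof -
    from xy obtain s t where "s \<in> int_complex.span S" "t \<in> int_complex.span S"
      "of_int x * m + s \<in> A" "of_int y * m + t \<in> A" by (auto simp: J_def)
    moreover have "of_int (x + y) * m + (s + t) = (of_int x * m + s) + (of_int y * m + t)"
      by (simp add: algebra_simps)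
    ultimately show ?thesis unfolding J_def
      using int_complex.span_add int_complex.subspace_add[OF A] by (metis (mono_tags, lifting) mem_Collect_eq)
  qed
  moreover have "n * x \<in> J" if xy: "x \<in> J" for x n
  proof -
    from xy obtain s where s: "s \<in> int_complex.span S" "of_int x * m + s \<in> A" by (auto simp: J_def)
    moreover have "of_int (n * x) * m + (of_int n * s) = of_int n * (of_int x * m + s)"
      by (simp add: algebra_simps)
    ultimately show ?thesis unfolding J_def
      using int_mult_span[OF s(1)] int_complex.subspace_scale[OF A s(2)] by (metis (mono_tags, lifting) mem_Collect_eq)
  qed
  ultimately obtain d where d: "d \<in> J" "\<forall>x\<in>J. d dvd x" using int_subgroup_principal by metis
  then obtain s0 where s0: "s0 \<in> int_complex.span S" "of_int d * m + s0 \<in> A" by (auto simp: J_def)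
  define a where "a = of_int d * m + s0"
  have "int_complex.subspace (A \<inter> int_complex.span S)"
    using A int_complex.subspace_span int_complex.subspace_inter by blast
  then obtain T where T: "finite T" "A \<inter> int_complex.span S = int_complex.span T"
    using insert.IH[of "A \<inter> int_complex.span S"] by auto
  have "A = int_complex.span (insert a T)"
  proof (rule antisym)
    show "int_complex.span (insert a T) \<subseteq> A"
      using T s0 A int_complex.span_superset[of T] by (intro int_complex.span_minimal) (auto simp: a_def)
    show "A \<subseteq> int_complex.span (insert a T)"
    proof
      fix x assume x: "x \<in> A"
      then obtain k where k: "x - of_int k * m \<in> int_complex.span S"
        using insert.prems(2) by (auto simp: int_complex.span_insert)
      then have "k \<in> J" using x by (auto simp: J_def intro!: bexI[of _ "x - of_int k * m"])
      then obtain q where q: "k = d * q" using d by (auto elim: dvdE)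
      have 1: "x - of_int q * a = (x - of_int k * m) - of_int q * s0"
        by (simp add: q a_def algebra_simps)
      have "x - of_int q * a \<in> A" using x s0 A
        by (metis a_def int_complex.subspace_diff int_complex.subspace_scale)
      moreover have "x - of_int q * a \<in> int_complex.span S"
        unfolding 1 using k s0 int_complex.span_diff int_complex.span_scale by blast
      ultimately have "x - of_int q * a \<in> int_complex.span T" using T by blast
      then show "x \<in> int_complex.span (insert a T)"
        by (auto simp: int_complex.span_insert)
    qed
  qed
  then show ?case using T by blast
qed

section \<open>Integrality through finitely generated stable subgroups\<close>

lemma mult_span_closed:
  assumes "\<And>s. s \<in> S \<Longrightarrow> x * s \<in> int_complex.span T" "y \<in> int_complex.span S"
  shows "x * y \<in> int_complex.span T"
  using assms(2)
proof (induction rule: int_complex.span_induct_alt)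
  case base then show ?case by (simp add: int_complex.span_zero)
next
  case (step c z y)
  have "x * (of_int c * z + y) = of_int c * (x * z) + x * y" by (simp add: algebra_simps)
  then show ?case using step assms(1) int_complex.span_add int_complex.span_scale by metis
qed

text \<open>A Noetherian argument takes the place of the determinant trick. The subgroup
  \<open>R\<close> generated by all powers of \<open>x\<close> lies in a finitely generated group,
  so it is finitely generated itself; its generators involve only powers below some
  \<open>n\<close>, and expressing \<open>x ^ n\<close> by these is a monic equation.\<close>

lemma algebraic_int_if_fg:
  assumes "finite S" "1 \<in> int_complex.span S" "\<And>s. s \<in> S \<Longrightarrow> x * s \<in> int_complex.span S"
  shows "algebraic_int x"
proof -
  have pow: "x ^ n \<in> int_complex.span S" for n
  proof (induction n)
    case (Suc n)
    then show ?case using mult_span_closed[of S x S "x ^ n"] assms(3) by simp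
  qed (simp add: assms(2))
  define R where "R = int_complex.span (range (\<lambda>n. x ^ n))"
  have "R \<subseteq> int_complex.span S"
    unfolding R_def using pow by (intro int_complex.span_minimal) auto
  then obtain T where T: "finite T" "R = int_complex.span T"
    using subgroup_of_fg[OF assms(1)] by (metis R_def int_complex.subspace_span)
  define I where "I = (\<lambda>n::nat. int_complex.span ((\<lambda>i. x ^ i) ` {..<n}))"
  have I_mono: "I m \<subseteq> I n" if "m \<le> n" for m n
    unfolding I_def using that by (intro int_complex.span_mono image_mono) auto
  have I_un: "\<exists>n. t \<in> I n" if "t \<in> R" for t
    using that unfolding R_def
  proof (induction rule: int_complex.span_induct_alt)
    case base then show ?case by (auto simp: I_def int_complex.span_zero)
  next
    case (step c z y)
    then obtain n k where n: "y \<in> I n" "z = x ^ k" by auto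
    then have "y \<in> I (max n (Suc k))" "z \<in> I (max n (Suc k))"
      using I_mono[of n "max n (Suc k)"]
      by (blast intro: max.cobounded1, auto simp: I_def intro!: int_complex.span_base)
    then show ?case unfolding I_def using int_complex.span_add int_complex.span_scale by blast
  qed
  have "\<exists>n. T \<subseteq> I n"
  proof -
    have "T \<subseteq> R" using T int_complex.span_superset by blast
    then obtain f where f: "\<And>t. t \<in> T \<Longrightarrow> t \<in> I (f t)" using I_un by (metis subsetD)
    have "T \<subseteq> I (\<Sum>t\<in>T. f t)"
      using f I_mono member_le_sum[of _ T f] T(1) by blast
    then show ?thesis by blast
  qed
  then obtain n where n: "T \<subseteq> I n" by blast
  have "x ^ n \<in> R" unfolding R_def by (auto intro: int_complex.span_base)
  then have "x ^ n \<in> I n" using T n int_complex.span_minimal[OF n] by (auto simp: I_def int_complex.subspace_span)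
  then have "\<exists>c::nat \<Rightarrow> int. x ^ n = (\<Sum>i<n. of_int (c i) * x ^ i)"
  proof -
    have "\<exists>c::nat \<Rightarrow> int. y = (\<Sum>i<n. of_int (c i) * x ^ i)" if "y \<in> I n" for y
      using that unfolding I_def
    proof (induction rule: int_complex.span_induct_alt)
      case base then show ?case by (intro exI[of _ "\<lambda>_. 0"]) auto
    next
      case (step k z y)
      then obtain c j where c: "y = (\<Sum>i<n. of_int (c i) * x ^ i)" "j < n" "z = x ^ j" by auto
      have "(\<Sum>i<n. of_int (c i + (if i = j then k else 0)) * x ^ i) =
        (\<Sum>i<n. of_int (c i) * x ^ i) + (\<Sum>i<n. if i = j then of_int k * x ^ i else 0)"
        by (subst sum.distrib[symmetric], rule sum.cong) (auto simp: algebra_simps)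
      then show ?case using c by (intro exI[of _ "\<lambda>i. c i + (if i = j then k else 0)"]) (auto simp: sum.delta)
    qed
    then show ?thesis using \<open>x ^ n \<in> I n\<close> by blast
  qed
  then obtain c :: "nat \<Rightarrow> int" where c: "x ^ n = (\<Sum>i<n. of_int (c i) * x ^ i)" by blast
  define p where "p = (monom 1 n - (\<Sum>i<n. monom (of_int (c i)) i) :: complex poly)"
  have co: "coeff p i = (if i = n then 1 else 0) - (if i < n then of_int (c i) else 0)" for i
    by (auto simp: p_def coeff_sum)
  have deg: "degree p = n"
    by (intro antisym degree_le le_degree) (auto simp: co)
  show ?thesis
  proof (rule algebraic_int.intros)
    show "lead_coeff p = 1" by (simp add: deg co)
    show "\<forall>i. coeff p i \<in> \<int>" by (simp add: co)
    show "poly p x = 0" by (simp add: p_def poly_sum poly_monom c)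
  qed
qed

text \<open>\<open>S'\<close> consists of the products \<open>s * x ^ i\<close> with
  \<open>i\<close> below the degree of \<open>p\<close>, so its span is the group spanned by
  \<open>S\<close> with \<open>x\<close> adjoined. The last conjunct, that all multipliers
  stabilizing the old span stabilize the new one, allows elements to be adjoined one after
  another.\<close>

lemma monic_root_fg:
  fixes p :: "complex poly"
  assumes "finite S" "1 \<in> S" "lead_coeff p = 1" "poly p x = 0"
    "\<And>i s. s \<in> S \<Longrightarrow> coeff p i * s \<in> int_complex.span S"
  shows "\<exists>S'. finite S' \<and> S \<subseteq> S' \<and> (\<forall>s\<in>S'. x * s \<in> int_complex.span S') \<and>
    (\<forall>a. (\<forall>s\<in>S. a * s \<in> int_complex.span S) \<longrightarrow> (\<forall>s\<in>S'. a * s \<in> int_complex.span S'))"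
proof -
  define n where "n = degree p"
  have n0: "n > 0"
  proof (rule ccontr)
    assume "\<not> n > 0"
    then obtain a where "p = [:a:]" by (metis degree_0_id n_def degree_eq_zeroE gr0I)
    then show False using assms(3,4) by auto
  qed
  define S' where "S' = (\<lambda>(s, i). s * x ^ i) ` (S \<times> {..<n})"
  have mem: "s * x ^ i \<in> S'" if "s \<in> S" "i < n" for s i using that by (auto simp: S'_def)
  have spn: "y * x ^ i \<in> int_complex.span S'" if "y \<in> int_complex.span S" "i < n" for y i
  proof -
    have "x ^ i * s \<in> int_complex.span S'" if "s \<in> S" for s
      by (subst mult.commute, rule int_complex.span_base, rule mem[OF that \<open>i < n\<close>])
    then have "x ^ i * y \<in> int_complex.span S'"
      using that(1) by (rule mult_span_closed)
    then show ?thesis by (subst mult.commute)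
  qed
  have 1: "finite S'" unfolding S'_def using assms(1) by auto
  have 2: "S \<subseteq> S'" using mem[OF _ n0] by auto
  have 3: "x * s \<in> int_complex.span S'" if "s \<in> S'" for s
  proof -
    from that obtain t i where t: "t \<in> S" "i < n" "s = t * x ^ i" by (auto simp: S'_def)
    show ?thesis
    proof (cases "Suc i < n")
      case True
      have "x * s = t * x ^ Suc i" by (simp add: t)
      then show ?thesis using mem[OF t(1) True] by (metis int_complex.span_base)
    next
      \<comment> \<open>Only the top power leaves the range of exponents. The monic equation
        replaces \<open>x ^ n\<close> by lower powers, and its coefficients are absorbed by the span
        of \<open>S\<close>.\<close>
      case False
      then have i: "Suc i = n" using t by auto
      have "0 = (\<Sum>i\<le>n. coeff p i * x ^ i)" using assms(4) by (simp add: poly_altdef n_def)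
      also have "\<dots> = (\<Sum>i<n. coeff p i * x ^ i) + x ^ n"
        using assms(3) by (simp add: n_def lessThan_Suc_atMost[symmetric])
      finally have "x ^ n = - (\<Sum>i<n. coeff p i * x ^ i)" by (simp add: eq_neg_iff_add_eq_0 add.commute)
      moreover have "x * s = t * x ^ n" using t by (simp flip: i)
      ultimately have "x * s = - (\<Sum>i<n. (coeff p i * t) * x ^ i)"
        by (simp add: sum_distrib_left mult_ac)
      then show ?thesis using spn assms(5)[OF t(1)]
        by (auto intro!: int_complex.span_neg int_complex.span_sum)
    qed
  qed
  have 4: "a * s \<in> int_complex.span S'" if "\<And>s. s \<in> S \<Longrightarrow> a * s \<in> int_complex.span S" "s \<in> S'" for a s
  proof -
    from that obtain t i where t: "t \<in> S" "i < n" "s = t * x ^ i" by (auto simp: S'_def)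
    have "a * s = (a * t) * x ^ i" by (simp add: t)
    then show ?thesis using spn[OF that(1)[OF t(1)] t(2)] by metis
  qed
  show ?thesis using 1 2 3 4 by (intro exI[of _ S']) blast
qed

text \<open>One common group for all of \<open>A\<close>: sums and products of its stabilizers are
  stabilizers again, which is how the ring structure of the algebraic integers is obtained.\<close>

lemma algebraic_ints_fg:
  fixes A :: "complex set"
  assumes "finite A" "\<And>a. a \<in> A \<Longrightarrow> algebraic_int a"
  shows "\<exists>S. finite S \<and> 1 \<in> S \<and> (\<forall>a\<in>A. \<forall>s\<in>S. a * s \<in> int_complex.span S)"
  using assms
proof (induction A)
  case empty then show ?case by (intro exI[of _ "{1}"]) auto
next
  case (insert x A)
  then obtain S where S: "finite S" "1 \<in> S" "\<forall>a\<in>A. \<forall>s\<in>S. a * s \<in> int_complex.span S" by auto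
  obtain p where p: "lead_coeff p = 1" "\<forall>i. coeff p i \<in> \<int>" "poly p x = 0"
    using insert.prems[of x] by (auto simp: algebraic_int.simps)
  have "coeff p i * s \<in> int_complex.span S" if "s \<in> S" for s i
  proof -
    obtain k where "coeff p i = of_int k" using p(2) by (metis Ints_cases)
    then show ?thesis using int_mult_span[OF int_complex.span_base[OF that]] by simp
  qed
  from monic_root_fg[OF S(1,2) p(1,3) this] obtain S' where
    S': "finite S'" "S \<subseteq> S'" "\<forall>s\<in>S'. x * s \<in> int_complex.span S'"
    "\<forall>a. (\<forall>s\<in>S. a * s \<in> int_complex.span S) \<longrightarrow> (\<forall>s\<in>S'. a * s \<in> int_complex.span S')"
    by blast
  have "\<forall>a\<in>insert x A. \<forall>s\<in>S'. a * s \<in> int_complex.span S'"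
    using S' S(3) by blast
  then show ?case using S' S(2) by blast
qed

lemma algebraic_int_add:
  fixes x y :: complex
  assumes "algebraic_int x" "algebraic_int y"
  shows "algebraic_int (x + y)"
proof -
  obtain S where S: "finite S" "1 \<in> S" "\<forall>a\<in>{x, y}. \<forall>s\<in>S. a * s \<in> int_complex.span S"
    using algebraic_ints_fg[of "{x, y}"] assms by auto
  then show ?thesis
    by (intro algebraic_int_if_fg[of S]) (auto intro: int_complex.span_base int_complex.span_add simp: distrib_right)
qed

lemma algebraic_int_mult:
  fixes x y :: complex
  assumes "algebraic_int x" "algebraic_int y"
  shows "algebraic_int (x * y)"
proof -
  obtain S where S: "finite S" "1 \<in> S" "\<forall>a\<in>{x, y}. \<forall>s\<in>S. a * s \<in> int_complex.span S"
    using algebraic_ints_fg[of "{x, y}"] assms by auto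
  then show ?thesis
    by (intro algebraic_int_if_fg[of S])
      (auto intro: int_complex.span_base mult_span_closed[of S x S] simp: mult.assoc)
qed

lemma algebraic_int_diff: "algebraic_int (x::complex) \<Longrightarrow> algebraic_int y \<Longrightarrow> algebraic_int (x - y)"
  using algebraic_int_add[of x "- y"] by simp

lemma algebraic_int_sum: "(\<And>i. i \<in> A \<Longrightarrow> algebraic_int (f i :: complex)) \<Longrightarrow> algebraic_int (sum f A)"
  by (induction A rule: infinite_finite_induct) (auto intro: algebraic_int_add)

lemma algebraic_int_prod: "(\<And>i. i \<in> A \<Longrightarrow> algebraic_int (f i :: complex)) \<Longrightarrow> algebraic_int (prod f A)"
  by (induction A rule: infinite_finite_induct) (auto intro: algebraic_int_mult)

lemma algebraic_int_power: "algebraic_int (x::complex) \<Longrightarrow> algebraic_int (x ^ n)"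
  by (induction n) (auto intro: algebraic_int_mult)

text \<open>Transitivity of integrality. The finitely many coefficients have a common stable group,
  and adjoining \<open>x\<close> to it keeps it finitely generated.\<close>

lemma algebraic_int_trans:
  fixes p :: "complex poly"
  assumes "lead_coeff p = 1" "\<And>i. algebraic_int (coeff p i)" "poly p x = 0"
  shows "algebraic_int x"
proof -
  obtain S where S: "finite S" "1 \<in> S"
      "\<forall>a\<in>coeff p ` {..degree p}. \<forall>s\<in>S. a * s \<in> int_complex.span S"
    using algebraic_ints_fg[of "coeff p ` {..degree p}"] assms(2) by auto
  have "coeff p i * s \<in> int_complex.span S" if "s \<in> S" for i s
    using S(3) that by (cases "i \<le> degree p") (auto simp: coeff_eq_0 int_complex.span_zero)
  from monic_root_fg[OF S(1,2) assms(1,3) this] obtain S' where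
    "finite S'" "S \<subseteq> S'" "\<And>s. s \<in> S' \<Longrightarrow> x * s \<in> int_complex.span S'" by blast
  then show ?thesis using S(2) by (intro algebraic_int_if_fg[of S']) (auto intro: int_complex.span_base)
qed

text \<open>Multiplication of \<open>poly p x = 0\<close> by \<open>a ^ (n - 1)\<close> turns it
  into a monic equation \<open>q\<close> for \<open>a * x\<close>, with the coefficients
  \<open>coeff p i * a ^ (n - 1 - i)\<close> still integral.\<close>

lemma algebraic_int_lead_coeff_mult_root:
  fixes p :: "complex poly"
  assumes "p \<noteq> 0" "\<And>i. algebraic_int (coeff p i)" "poly p x = 0"
  shows "algebraic_int (lead_coeff p * x)"
proof -
  define n where "n = degree p"
  define a where "a = lead_coeff p"
  have a0: "a \<noteq> 0" using assms(1) by (simp add: a_def)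
  have n0: "n > 0"
  proof (rule ccontr)
    assume "\<not> n > 0"
    then obtain b where "p = [:b:]" by (metis n_def degree_eq_zeroE gr0I)
    then show False using assms(1,3) by auto
  qed
  define q where "q = (\<Sum>i<n. monom (coeff p i * a ^ (n - 1 - i)) i) + monom 1 n"
  have co: "coeff q i = (if i < n then coeff p i * a ^ (n - 1 - i) else 0) + (if i = n then 1 else 0)" for i
    by (auto simp: q_def coeff_sum)
  have deg: "degree q = n" by (intro antisym degree_le le_degree) (auto simp: co)
  have "poly q (a * x) = (\<Sum>i<n. coeff p i * a ^ (n - 1 - i) * (a * x) ^ i) + (a * x) ^ n"
    by (simp add: q_def poly_sum poly_monom)
  also have "\<dots> = (\<Sum>i<n. a ^ (n - 1) * (coeff p i * x ^ i)) + a ^ (n - 1) * (coeff p n * x ^ n)"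
  proof (intro arg_cong2[where f = "(+)"] sum.cong refl)
    fix i assume "i \<in> {..<n}"
    then have "a ^ (n - 1) = a ^ (n - 1 - i) * a ^ i" by (simp flip: power_add)
    then show "coeff p i * a ^ (n - 1 - i) * (a * x) ^ i = a ^ (n - 1) * (coeff p i * x ^ i)"
      by (simp add: power_mult_distrib)
  next
    show "(a * x) ^ n = a ^ (n - 1) * (coeff p n * x ^ n)"
      using n0 by (cases n) (auto simp: power_mult_distrib a_def n_def)
  qed
  also have "\<dots> = a ^ (n - 1) * poly p x"
    by (simp add: poly_altdef n_def[symmetric] lessThan_Suc_atMost[symmetric] sum_distrib_left distrib_left)
  finally have root: "poly q (a * x) = 0" using assms(3) by simp
  have "algebraic_int (coeff q i)" for i
    unfolding co using assms(2) by (auto simp: a_def intro!: algebraic_int_mult algebraic_int_power)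
  then have "algebraic_int (a * x)"
    using algebraic_int_trans[of q "a * x"] root by (simp add: deg co)
  then show ?thesis by (simp add: a_def)
qed

section \<open>Polynomials with algebraic integer coefficients\<close>

definition int_poly :: "complex poly \<Rightarrow> bool" where
  "int_poly p \<longleftrightarrow> (\<forall>i. algebraic_int (coeff p i))"

lemma int_poly_add: "int_poly p \<Longrightarrow> int_poly q \<Longrightarrow> int_poly (p + q)"
  by (auto simp: int_poly_def intro: algebraic_int_add)

lemma int_poly_diff: "int_poly p \<Longrightarrow> int_poly q \<Longrightarrow> int_poly (p - q)"
  by (auto simp: int_poly_def intro: algebraic_int_diff)

lemma int_poly_mult: "int_poly p \<Longrightarrow> int_poly q \<Longrightarrow> int_poly (p * q)"
  by (auto simp: int_poly_def coeff_mult intro!: algebraic_int_sum algebraic_int_mult)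

lemma int_poly_prod: "(\<And>i. i \<in> A \<Longrightarrow> int_poly (f i)) \<Longrightarrow> int_poly (prod f A)"
  by (induction A rule: infinite_finite_induct)
    (auto intro: int_poly_mult simp: int_poly_def[of 1])

text \<open>For the leading coefficient \<open>a\<close> of \<open>q\<close>, both \<open>a\<close>
  and \<open>a * r\<close> are integral, the latter because \<open>r\<close> is a root of the
  product. Hence the leading term of \<open>q\<close> contributes an integral polynomial to the
  product and can be removed, which lowers the degree.\<close>

lemma int_poly_divide_root:
  "int_poly ([:- r, 1:] * q) \<Longrightarrow> int_poly q"
proof (induction "degree q" arbitrary: q rule: less_induct)
  case less
  show ?case
  proof (cases "q = 0")
    case True then show ?thesis by (simp add: int_poly_def)
  next
    case False
    define p where "p = [:- r, 1:] * q"
    have p: "p \<noteq> 0" "lead_coeff p = lead_coeff q" "poly p r = 0"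
      using False lead_coeff_mult[of "[:- r, 1:]" q] by (auto simp: p_def simp del: mult_pCons_left)
    define a where "a = lead_coeff q"
    define n where "n = degree q"
    have ip: "algebraic_int (coeff p i)" for i using less.prems by (auto simp: int_poly_def p_def)
    have a: "algebraic_int a" using ip[of "degree p"] p(2) by (simp add: a_def)
    have ar: "algebraic_int (a * r)"
      using algebraic_int_lead_coeff_mult_root[OF p(1) ip p(3)] p(2) by (simp add: a_def)
    have mono: "int_poly (monom a n)" using a by (auto simp: int_poly_def)
    define q' where "q' = q - monom a n"
    have "[:- r, 1:] * monom a n = monom a (Suc n) - monom (a * r) n"
      by (simp add: monom_Suc smult_monom mult.commute minus_monom)
    then have "[:- r, 1:] * q' = p - (monom a (Suc n) - monom (a * r) n)"
      by (simp add: q'_def p_def right_diff_distrib del: mult_pCons_left)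
    moreover have "int_poly (p - (monom a (Suc n) - monom (a * r) n))"
      using a ar ip by (intro int_poly_diff) (auto simp: int_poly_def)
    ultimately have iq': "int_poly ([:- r, 1:] * q')" by simp
    have "int_poly q'"
    proof (cases "degree q' < degree q")
      case True then show ?thesis using less.hyps iq' by blast
    next
      \<comment> \<open>This occurs only for constant \<open>q\<close>, where the zero polynomial
        left over has the same degree \<open>0\<close>.\<close>
      case False
      have "degree q' \<le> n" "coeff q' n = 0"
        by (auto simp: q'_def n_def a_def intro!: degree_diff_le degree_monom_le)
      then have "degree q' = n" "coeff q' n = 0" using False by (auto simp: n_def)
      then have "q' = 0" by (metis leading_coeff_0_iff)
      then show ?thesis by (simp add: int_poly_def)
    qed
    then have "int_poly (q' + monom a n)" using mono int_poly_add by blast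
    then show ?thesis by (simp add: q'_def)
  qed
qed

text \<open>Dedekind's Prague theorem. The induction moves one linear factor of \<open>f\<close> at a time over
  to \<open>g\<close>, which does not change the product.\<close>

theorem algebraic_int_coeff_mult_coeff:
  "int_poly (f * g) \<Longrightarrow> algebraic_int (coeff f i * coeff g j)"
proof (induction "degree f" arbitrary: f g i j)
  case 0
  then obtain a where f: "f = [:a:]" by (metis degree_eq_zeroE)
  have "algebraic_int (coeff (f * g) j)" using 0 by (simp add: int_poly_def)
  then show ?case by (cases i) (auto simp: f)
next
  case (Suc n)
  have "\<not> constant (poly f)" using Suc.hyps(2) by (simp add: constant_degree)
  then obtain r where "poly f r = 0" using fundamental_theorem_of_algebra by blast
  then obtain f1 where f1: "f = [:- r, 1:] * f1" by (auto simp: poly_eq_0_iff_dvd)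
  then have "f1 \<noteq> 0" using Suc.hyps(2) by auto
  then have deg: "n = degree f1" using Suc.hyps(2) by (simp add: f1 degree_mult_eq del: mult_pCons_left)
  have co: "coeff ([:- r, 1:] * p) i = (if i = 0 then 0 else coeff p (i - 1)) - r * coeff p i"
    for p :: "complex poly" and i
    by (cases i) auto
  have "[:- r, 1:] * (f1 * g) = f * g" "f1 * ([:- r, 1:] * g) = f * g"
    unfolding f1 by (simp_all only: mult_ac)
  then have ip: "int_poly (f1 * g)" "int_poly (f1 * ([:- r, 1:] * g))"
    using Suc.prems int_poly_divide_root[of r] by metis+
  have 1: "algebraic_int (coeff f1 i * coeff g j)" for i j
    using Suc.hyps(1)[OF deg ip(1)] .
  \<comment> \<open>The induction hypothesis is used for both splittings. In the second, a
    coefficient of \<open>[:- r, 1:] * g\<close> is the preceding coefficient of \<open>g\<close>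
    minus \<open>r\<close> times the current one, so the product with \<open>r\<close> is a
    difference of two products already known to be integral.\<close>
  have 2: "algebraic_int (r * (coeff f1 i * coeff g j))" for i
  proof -
    have "r * (coeff f1 i * coeff g j) = (if j = 0 then 0 else coeff f1 i * coeff g (j - 1))
        - coeff f1 i * coeff ([:- r, 1:] * g) j"
      unfolding co by (simp add: algebra_simps del: mult_pCons_left)
    then show ?thesis using 1 Suc.hyps(1)[OF deg ip(2)]
      by (auto intro!: algebraic_int_diff simp del: mult_pCons_left)
  qed
  have "coeff f i * coeff g j = (if i = 0 then 0 else coeff f1 (i - 1) * coeff g j)
      - r * (coeff f1 i * coeff g j)"
    unfolding f1 co by (simp add: algebra_simps del: mult_pCons_left)
  then show ?case using 1 2 by (auto intro!: algebraic_int_diff)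
qed

section \<open>Indices of lattices\<close>

abbreviation cosets :: "complex set \<Rightarrow> complex set \<Rightarrow> complex set set" where
  "cosets A B \<equiv> (\<lambda>x. (\<lambda>b. x + b) ` B) ` A"

lemma coset_eq_iff:
  assumes "int_complex.subspace B"
  shows "(\<lambda>b. x + b) ` B = (\<lambda>b. y + b) ` B \<longleftrightarrow> x - y \<in> B"
proof
  assume "(\<lambda>b. x + b) ` B = (\<lambda>b. y + b) ` B"
  then have "x + 0 \<in> (\<lambda>b. y + b) ` B" using int_complex.subspace_0[OF assms] by blast
  then show "x - y \<in> B" by auto
next
  assume xy: "x - y \<in> B"
  show "(\<lambda>b. x + b) ` B = (\<lambda>b. y + b) ` B"
  proof (intro equalityI subsetI)
    fix z assume "z \<in> (\<lambda>b. x + b) ` B"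
    then obtain b where "b \<in> B" "z = y + ((x - y) + b)" by auto
    then show "z \<in> (\<lambda>b. y + b) ` B" using int_complex.subspace_add[OF assms xy] by blast
  next
    fix z assume "z \<in> (\<lambda>b. y + b) ` B"
    then obtain b where b: "b \<in> B" "z = x + (b - (x - y))" by auto
    then show "z \<in> (\<lambda>b. x + b) ` B" using int_complex.subspace_diff[OF assms b(1) xy] by blast
  qed
qed

text \<open>A chosen representative \<open>f c\<close> of each class of \<open>A\<close> modulo
  \<open>B\<close> carries the classes of \<open>B\<close> modulo \<open>D\<close> into
  \<open>c\<close>. Infinite quotients have \<open>card\<close> zero, with which the product formula
  is consistent.\<close>

lemma add_index_tower:
  assumes "int_complex.subspace A" "int_complex.subspace B" "int_complex.subspace D" "D \<subseteq> B" "B \<subseteq> A"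
  shows "add_index A D = add_index A B * add_index B D"
proof -
  obtain f where f: "\<And>c. c \<in> cosets A B \<Longrightarrow> f c \<in> A \<and> (\<lambda>b. f c + b) ` B = c"
    by atomize_elim (rule choice, blast)
  define h where "h = (\<lambda>(c, t). (\<lambda>b. f c + b) ` t)"
  have h: "h (c, (\<lambda>b. y + b) ` D) = (\<lambda>b. (f c + y) + b) ` D" for c y
    by (simp add: h_def image_image add.assoc)
  have "bij_betw h (cosets A B \<times> cosets B D) (cosets A D)"
    unfolding bij_betw_def
  proof
    show "inj_on h (cosets A B \<times> cosets B D)"
    proof (rule inj_onI, clarify)
      fix x x' y y' assume x: "x \<in> A" "x' \<in> A" "y \<in> B" "y' \<in> B"
      let ?c = "(\<lambda>b. x + b) ` B" and ?c' = "(\<lambda>b. x' + b) ` B"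
      assume "h (?c, (\<lambda>b. y + b) ` D) = h (?c', (\<lambda>b. y' + b) ` D)"
      then have d: "(f ?c + y) - (f ?c' + y') \<in> D"
        unfolding h using coset_eq_iff assms(3) by blast
      have "f ?c - f ?c' = ((f ?c + y) - (f ?c' + y')) - (y - y')" by simp
      then have "f ?c - f ?c' \<in> B" using d x assms(4)
        int_complex.subspace_diff[OF assms(2)] by (metis subsetD)
      then have "?c = ?c'" using f x coset_eq_iff[OF assms(2)] by (metis (no_types, lifting) image_eqI)
      moreover from this have "y - y' \<in> D" using d by simp
      ultimately show "?c = ?c' \<and> (\<lambda>b. y + b) ` D = (\<lambda>b. y' + b) ` D"
        using coset_eq_iff[OF assms(3)] by blast
    qed
    show "h ` (cosets A B \<times> cosets B D) = cosets A D"
    proof (intro antisym subsetI)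
      fix z assume "z \<in> h ` (cosets A B \<times> cosets B D)"
      then obtain x y where xy: "x \<in> A" "y \<in> B" "z = h ((\<lambda>b. x + b) ` B, (\<lambda>b. y + b) ` D)" by auto
      then have "f ((\<lambda>b. x + b) ` B) + y \<in> A"
        using f assms(5) by (intro int_complex.subspace_add[OF assms(1)]) auto
      then show "z \<in> cosets A D" unfolding xy(3) h by blast
    next
      fix z assume "z \<in> cosets A D"
      then obtain x where x: "x \<in> A" "z = (\<lambda>b. x + b) ` D" by auto
      define c where "c = (\<lambda>b. x + b) ` B"
      have c: "c \<in> cosets A B" using x by (auto simp: c_def)
      then have "x - f c \<in> B" using f[OF c] coset_eq_iff[OF assms(2), of x "f c"] by (simp add: c_def)
      moreover have "z = h (c, (\<lambda>b. (x - f c) + b) ` D)" unfolding h by (simp add: x)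
      ultimately show "z \<in> h ` (cosets A B \<times> cosets B D)" using c by blast
    qed
  qed
  from bij_betw_same_card[OF this] show ?thesis
    unfolding add_index_def by (simp add: card_cartesian_product)
qed

lemma add_index_image:
  assumes "inj f" "\<And>x y. f (x + y) = f x + f y"
  shows "add_index (f ` A) (f ` B) = add_index A B"
proof -
  have "cosets (f ` A) (f ` B) = (\<lambda>S. f ` S) ` cosets A B"
    by (simp add: image_image assms(2))
  moreover have "inj_on (\<lambda>S. f ` S) (cosets A B)"
    using assms(1) by (intro inj_onI) (simp add: inj_image_eq_iff)
  ultimately show ?thesis unfolding add_index_def by (simp add: card_image)
qed

lemma add_index_scale: "c \<noteq> 0 \<Longrightarrow> add_index ((\<lambda>x. c * x) ` A) ((\<lambda>x. c * x) ` B) = add_index A B"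
  by (rule add_index_image) (auto simp: inj_on_def algebra_simps)

lemma add_index_cnj: "add_index (cnj ` A) (cnj ` B) = add_index A B"
  by (rule add_index_image) (auto simp: inj_on_def)

lemma subspace_scale_image:
  assumes "int_complex.subspace A" shows "int_complex.subspace ((\<lambda>x. c * x) ` A)"
proof (rule int_complex.subspaceI)
  show "0 \<in> (\<lambda>x. c * x) ` A" using int_complex.subspace_0[OF assms] by force
next
  fix x y assume "x \<in> (\<lambda>x. c * x) ` A" "y \<in> (\<lambda>x. c * x) ` A"
  then obtain u v where "u \<in> A" "v \<in> A" "x + y = c * (u + v)" by (auto simp: distrib_left)
  then show "x + y \<in> (\<lambda>x. c * x) ` A" using int_complex.subspace_add[OF assms] by blast
next
  fix k x assume "x \<in> (\<lambda>x. c * x) ` A"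
  then obtain u where "u \<in> A" "of_int k * x = c * (of_int k * u)" by auto
  then show "of_int k * x \<in> (\<lambda>x. c * x) ` A" using int_complex.subspace_scale[OF assms] by blast
qed

text \<open>Generalized index of two arbitrary lattices. \<open>abs_norm\<close> always compares
  with the ring of integers, but scaling moves that ring as well, so both arguments must be free to
  vary in a chain of comparisons.\<close>

definition gen_index :: "complex set \<Rightarrow> complex set \<Rightarrow> real" where
  "gen_index A B = real (add_index A (A \<inter> B)) / real (add_index B (A \<inter> B))"

lemma gen_index_scale:
  assumes "c \<noteq> 0"
  shows "gen_index ((\<lambda>x. c * x) ` A) ((\<lambda>x. c * x) ` B) = gen_index A B"
proof -
  have "(\<lambda>x. c * x) ` A \<inter> (\<lambda>x. c * x) ` B = (\<lambda>x. c * x) ` (A \<inter> B)"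
    using assms by (subst image_Int) (auto simp: inj_on_def)
  then show ?thesis using assms by (simp add: gen_index_def add_index_scale)
qed

lemma gen_index_cnj: "gen_index (cnj ` A) (cnj ` B) = gen_index A B"
proof -
  have "cnj ` A \<inter> cnj ` B = cnj ` (A \<inter> B)" by (subst image_Int) (auto simp: inj_on_def)
  then show ?thesis by (simp add: gen_index_def add_index_cnj)
qed

lemma abs_norm_eq_gen_index: "abs_norm F I = gen_index (int_ring F) I"
  by (simp add: abs_norm_def gen_index_def Int_commute)

section \<open>Lattices commensurable with a free lattice\<close>

locale free_lattice =
  fixes R :: "complex set" and y :: "'i::finite \<Rightarrow> complex"
  assumes subspace: "int_complex.subspace R"
    and basis_mem: "\<And>i. y i \<in> R"
    and basis: "\<And>x. x \<in> R \<Longrightarrow> \<exists>!r::'i \<Rightarrow> int. x = (\<Sum>i\<in>UNIV. of_int (r i) * y i)"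
begin

text \<open>Mutual inclusion up to an integer factor, instead of finite index of the intersection:
  this form passes easily to intersections and multiples, and finiteness of indices follows from it
  in \<open>add_index_pos\<close>.\<close>

definition commensurable :: "complex set \<Rightarrow> bool" where
  "commensurable A \<longleftrightarrow> int_complex.subspace A \<and>
     (\<exists>k::nat. 0 < k \<and> (\<lambda>x. of_nat k * x) ` R \<subseteq> A \<and> (\<lambda>x. of_nat k * x) ` A \<subseteq> R)"

lemma combination_mem: "(\<Sum>i\<in>UNIV. of_int (r i) * y i) \<in> R"
  using basis_mem subspace by (intro int_complex.subspace_sum int_complex.subspace_scale) auto

lemma combination_unique:
  "(\<Sum>i\<in>UNIV. of_int (r i) * y i) = (\<Sum>i\<in>UNIV. of_int (s i) * y i) \<Longrightarrow> r = s"
  using basis[OF combination_mem[of r]] by blast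

text \<open>A coset is determined by the coordinate vector modulo \<open>k\<close>, represented by
  entries in \<open>{0..<int k}\<close>. This is the only index that is counted explicitly; the
  others are derived from it.\<close>

lemma add_index_scale_nat:
  assumes "0 < k"
  shows "add_index R ((\<lambda>x. of_nat k * x) ` R) = k ^ CARD('i)"
proof -
  let ?kR = "(\<lambda>x. of_nat k * x) ` R"
  have sub: "int_complex.subspace ?kR" using subspace by (rule subspace_scale_image)
  define comb where "comb = (\<lambda>r::'i \<Rightarrow> int. \<Sum>i\<in>UNIV. of_int (r i) * y i)"
  have comb_diff: "comb r - comb s = comb (\<lambda>i. r i - s i)" for r s
    by (simp add: comb_def sum_subtractf algebra_simps)
  have comb_k: "of_nat k * comb r = comb (\<lambda>i. int k * r i)" for r
    by (simp add: comb_def sum_distrib_left algebra_simps)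
  have mem: "comb r \<in> ?kR \<longleftrightarrow> (\<forall>i. int k dvd r i)" for r
  proof
    assume "comb r \<in> ?kR"
    then obtain x where x: "x \<in> R" "comb r = of_nat k * x" by auto
    obtain s where "x = comb s" using basis[OF x(1)] by (auto simp: comb_def)
    then have "comb r = comb (\<lambda>i. int k * s i)" using x comb_k by simp
    then have "r = (\<lambda>i. int k * s i)" unfolding comb_def by (rule combination_unique)
    then show "\<forall>i. int k dvd r i" by simp
  next
    assume "\<forall>i. int k dvd r i"
    then have "comb r = of_nat k * comb (\<lambda>i. r i div int k)" by (simp add: comb_k)
    moreover have "comb (\<lambda>i. r i div int k) \<in> R" using combination_mem by (simp add: comb_def)
    ultimately show "comb r \<in> ?kR" by blast
  qed
  define h where "h = (\<lambda>r. (\<lambda>b. comb r + b) ` ?kR)"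
  have "bij_betw h (UNIV \<rightarrow>\<^sub>E {0..<int k}) (cosets R ?kR)"
    unfolding bij_betw_def
  proof
    show "inj_on h (UNIV \<rightarrow>\<^sub>E {0..<int k})"
    proof (rule inj_onI, rule ext)
      fix r s i assume rs: "r \<in> UNIV \<rightarrow>\<^sub>E {0..<int k}" "s \<in> UNIV \<rightarrow>\<^sub>E {0..<int k}" "h r = h s"
      then have "comb r - comb s \<in> ?kR" using coset_eq_iff[OF sub] by (simp add: h_def)
      then have "int k dvd r i - s i" using comb_diff mem by auto
      moreover have "0 \<le> r i" "r i < int k" "0 \<le> s i" "s i < int k" using rs(1,2) by (auto simp: PiE_iff)
      ultimately show "r i = s i"
        by (metis mod_eq_dvd_iff mod_pos_pos_trivial)
    qed
    show "h ` (UNIV \<rightarrow>\<^sub>E {0..<int k}) = cosets R ?kR"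
    proof (intro antisym subsetI)
      fix z assume "z \<in> h ` (UNIV \<rightarrow>\<^sub>E {0..<int k})"
      then show "z \<in> cosets R ?kR" using combination_mem by (auto simp: h_def comb_def)
    next
      fix z assume "z \<in> cosets R ?kR"
      then obtain x where x: "x \<in> R" "z = (\<lambda>b. x + b) ` ?kR" by auto
      obtain s where s: "x = comb s" using basis[OF x(1)] by (auto simp: comb_def)
      have "x - comb (\<lambda>i. s i mod int k) \<in> ?kR" unfolding s comb_diff mem by (simp add: minus_mod_eq_mult_div)
      then have "z = h (\<lambda>i. s i mod int k)" unfolding x(2) h_def using coset_eq_iff[OF sub] by blast
      moreover have "(\<lambda>i. s i mod int k) \<in> UNIV \<rightarrow>\<^sub>E {0..<int k}" using assms by (auto simp: PiE_iff)
      ultimately show "z \<in> h ` (UNIV \<rightarrow>\<^sub>E {0..<int k})" by blast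
    qed
  qed
  from bij_betw_same_card[OF this] show ?thesis
    unfolding add_index_def by (simp add: card_PiE)
qed

lemma commensurableI:
  assumes "int_complex.subspace A" "0 < (k::nat)"
    "\<And>x. x \<in> R \<Longrightarrow> of_nat k * x \<in> A" "\<And>x. x \<in> A \<Longrightarrow> of_nat k * x \<in> R"
  shows "commensurable A"
  unfolding commensurable_def using assms by (intro conjI exI[of _ k]) auto

lemma commensurableD:
  assumes "commensurable A"
  shows "\<exists>k::nat. int_complex.subspace A \<and> 0 < k \<and>
    (\<forall>x. x \<in> R \<longrightarrow> of_nat k * x \<in> A) \<and> (\<forall>x. x \<in> A \<longrightarrow> of_nat k * x \<in> R)"
  using assms unfolding commensurable_def by (auto simp: image_subset_iff)

lemma subspace_scale_nat: "int_complex.subspace A \<Longrightarrow> x \<in> A \<Longrightarrow> of_nat k * x \<in> A"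
  using int_complex.subspace_scale[of A x "int k"] by simp

lemma commensurable_self: "commensurable R"
  by (rule commensurableI[of R 1]) (auto simp: subspace)

lemma commensurable_Int:
  assumes "commensurable A" "commensurable B" shows "commensurable (A \<inter> B)"
proof -
  obtain k where k: "int_complex.subspace A" "0 < k"
    "\<And>x. x \<in> R \<Longrightarrow> of_nat k * x \<in> A" "\<And>x. x \<in> A \<Longrightarrow> of_nat k * x \<in> R"
    using commensurableD[OF assms(1)] by metis
  obtain l where l: "int_complex.subspace B" "0 < l"
    "\<And>x. x \<in> R \<Longrightarrow> of_nat l * x \<in> B" "\<And>x. x \<in> B \<Longrightarrow> of_nat l * x \<in> R"
    using commensurableD[OF assms(2)] by metis
  show ?thesis
  proof (rule commensurableI[of _ "k * l"])
    show "int_complex.subspace (A \<inter> B)" using k(1) l(1) by (rule int_complex.subspace_inter)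
    show "0 < k * l" using k l by simp
  next
    fix x assume x: "x \<in> R"
    have "of_nat l * (of_nat k * x) \<in> A" "of_nat k * (of_nat l * x) \<in> B"
      using k(3)[OF x] l(3)[OF x] k(1) l(1) subspace_scale_nat by simp_all
    then show "of_nat (k * l) * x \<in> A \<inter> B" by (simp add: mult_ac)
  next
    fix x assume "x \<in> A \<inter> B"
    then have "of_nat l * (of_nat k * x) \<in> R" using k(4) subspace subspace_scale_nat by simp
    then show "of_nat (k * l) * x \<in> R" by (simp add: mult_ac)
  qed
qed

lemma commensurable_scale:
  assumes "commensurable ((\<lambda>x. c * x) ` R)" "commensurable A"
  shows "commensurable ((\<lambda>x. c * x) ` A)"
proof -
  obtain k where k: "int_complex.subspace A" "0 < k"
    "\<And>x. x \<in> R \<Longrightarrow> of_nat k * x \<in> A" "\<And>x. x \<in> A \<Longrightarrow> of_nat k * x \<in> R"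
    using commensurableD[OF assms(2)] by metis
  obtain l where l: "0 < l"
    "\<And>x. x \<in> R \<Longrightarrow> of_nat l * x \<in> (\<lambda>x. c * x) ` R" "\<And>x. x \<in> (\<lambda>x. c * x) ` R \<Longrightarrow> of_nat l * x \<in> R"
    using commensurableD[OF assms(1)] by metis
  show ?thesis
  proof (rule commensurableI[of _ "k * l"])
    show "int_complex.subspace ((\<lambda>x. c * x) ` A)" using k(1) by (rule subspace_scale_image)
    show "0 < k * l" using k l by simp
  next
    fix x assume x: "x \<in> R"
    obtain z where z: "z \<in> R" "of_nat l * x = c * z" using l(2)[OF x] by auto
    have "of_nat (k * l) * x = c * (of_nat k * z)" using z(2) by (simp add: mult_ac)
    then show "of_nat (k * l) * x \<in> (\<lambda>x. c * x) ` A" by (rule image_eqI) (simp add: k(3) z(1))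
  next
    fix x assume "x \<in> (\<lambda>x. c * x) ` A"
    then obtain a where a: "a \<in> A" "x = c * a" by auto
    have "of_nat l * (c * (of_nat k * a)) \<in> R" using k(4)[OF a(1)] by (intro l(3) imageI)
    then show "of_nat (k * l) * x \<in> R" by (simp add: mult_ac a(2))
  qed
qed

text \<open>Positive means finite here. Scaling carries the index of \<open>A\<close> over
  \<open>B\<close> into the chain from \<open>R\<close> through \<open>l A\<close> and
  \<open>l B\<close> down to \<open>l k R\<close>; it is a factor of
  \<open>(l * k) ^ CARD('i)\<close>, hence nonzero.\<close>

lemma add_index_pos:
  assumes "commensurable A" "commensurable B" "B \<subseteq> A"
  shows "add_index A B > 0"
proof -
  obtain k where k: "int_complex.subspace B" "0 < k" "\<And>x. x \<in> R \<Longrightarrow> of_nat k * x \<in> B"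
    using commensurableD[OF assms(2)] by metis
  obtain l where l: "int_complex.subspace A" "0 < l" "\<And>x. x \<in> A \<Longrightarrow> of_nat l * x \<in> R"
    using commensurableD[OF assms(1)] by metis
  let ?s = "\<lambda>c S. (\<lambda>x. of_nat c * x) ` S"
  have inc1: "?s (l * k) R \<subseteq> ?s l B"
    using k(3) by (auto simp: image_iff mult.assoc)
  have inc: "?s l B \<subseteq> ?s l A" "?s l A \<subseteq> R"
    using l(3) assms(3) by auto
  note s = subspace_scale_image
  have "(l * k) ^ CARD('i) = add_index R (?s (l * k) R)"
    using k(2) l(2) by (subst add_index_scale_nat) auto
  also have "\<dots> = add_index R (?s l A) * add_index (?s l A) (?s (l * k) R)"
    using inc inc1 s[OF l(1)] s[OF subspace] subspace by (intro add_index_tower) auto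
  also have "add_index (?s l A) (?s (l * k) R) = add_index (?s l A) (?s l B) * add_index (?s l B) (?s (l * k) R)"
    using inc inc1 s[OF l(1)] s[OF subspace] s[OF k(1)] by (intro add_index_tower) auto
  also have "add_index (?s l A) (?s l B) = add_index A B" using l(2) by (intro add_index_scale) auto
  finally have eq: "(l * k) ^ CARD('i) =
    add_index R (?s l A) * (add_index A B * add_index (?s l B) (?s (l * k) R))" .
  have "(l * k) ^ CARD('i) > 0" using k(2) l(2) by simp
  then show ?thesis unfolding eq by simp
qed

text \<open>Passing from \<open>A \<inter> B\<close> to the smaller \<open>D\<close> multiplies both
  indices by that of \<open>A \<inter> B\<close> over \<open>D\<close>, which is nonzero and
  cancels. Transitivity of the generalized index is then a computation with one common
  \<open>D\<close>.\<close>

lemma gen_index_common: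
  assumes "commensurable A" "commensurable B" "commensurable D" "D \<subseteq> A" "D \<subseteq> B"
  shows "gen_index A B = real (add_index A D) / real (add_index B D)"
proof -
  have sub: "int_complex.subspace A" "int_complex.subspace B" "int_complex.subspace D"
    using assms(1-3) by (simp_all add: commensurable_def)
  have "add_index A D = add_index A (A \<inter> B) * add_index (A \<inter> B) D"
    "add_index B D = add_index B (A \<inter> B) * add_index (A \<inter> B) D"
    using assms sub int_complex.subspace_inter by (auto intro!: add_index_tower)
  moreover have "add_index (A \<inter> B) D > 0"
    using assms commensurable_Int by (intro add_index_pos) auto
  ultimately show ?thesis by (simp add: gen_index_def)
qed

lemma gen_index_trans:
  assumes "commensurable A" "commensurable B" "commensurable C"
  shows "gen_index A B * gen_index B C = gen_index A C"
proof -
  define D where "D = A \<inter> B \<inter> C"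
  have D: "commensurable D" using assms commensurable_Int by (simp add: D_def)
  have sub: "D \<subseteq> A" "D \<subseteq> B" "D \<subseteq> C" by (auto simp: D_def)
  have "add_index B D > 0" using add_index_pos assms D sub by blast
  then show ?thesis
    using gen_index_common[OF assms(1,2) D] gen_index_common[OF assms(2,3) D]
      gen_index_common[OF assms(1,3) D] sub by simp
qed

lemma commensurable_scale_nat: "0 < k \<Longrightarrow> commensurable ((\<lambda>x. of_nat k * x) ` R)"
  by (rule commensurableI[of _ k]) (auto intro: subspace_scale_nat subspace_scale_image subspace)

lemma gen_index_scale_rat:
  assumes "0 < p" "0 < q"
  shows "gen_index R ((\<lambda>x. of_nat p / of_nat q * x) ` R) = (real p / real q) ^ CARD('i)"
proof -
  let ?s = "\<lambda>c S. (\<lambda>x. of_nat c * x) ` S"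
  have sub: "?s k R \<subseteq> R" for k
    using int_complex.subspace_scale[OF subspace, of _ "int k"] by auto
  have 1: "gen_index R (?s k R) = real k ^ CARD('i)" "gen_index (?s k R) R = 1 / real k ^ CARD('i)"
    if "0 < k" for k
  proof -
    \<comment> \<open>The index of a lattice in itself is a positive integer that equals its own
      square by the tower formula, hence \<open>1\<close>.\<close>
    have "add_index (?s k R) (?s k R) > 0"
      using commensurable_scale_nat that by (intro add_index_pos) auto
    moreover have "add_index (?s k R) (?s k R) = add_index (?s k R) (?s k R) * add_index (?s k R) (?s k R)"
      using subspace_scale_image[OF subspace] by (intro add_index_tower) auto
    ultimately have "add_index (?s k R) (?s k R) = 1" by simp
    moreover have "R \<inter> ?s k R = ?s k R" "?s k R \<inter> R = ?s k R" using sub by auto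
    ultimately show "gen_index R (?s k R) = real k ^ CARD('i)" "gen_index (?s k R) R = 1 / real k ^ CARD('i)"
      using add_index_scale_nat[OF that] by (simp_all add: gen_index_def)
  qed
  \<comment> \<open>Clearing the denominator: the pair becomes \<open>q R\<close> and
    \<open>p R\<close>, compared through \<open>R\<close>.\<close>
  have "gen_index R ((\<lambda>x. of_nat p / of_nat q * x) ` R) =
    gen_index ((\<lambda>x. of_nat q * x) ` R) ((\<lambda>x. of_nat q * x) ` (\<lambda>x. of_nat p / of_nat q * x) ` R)"
    using assms by (intro gen_index_scale[symmetric]) auto
  also have "(\<lambda>x. of_nat q * x) ` (\<lambda>x. of_nat p / of_nat q * x) ` R = ?s p R"
    using assms by (auto simp: image_image)
  also have "gen_index (?s q R) (?s p R) = gen_index (?s q R) R * gen_index R (?s p R)"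
    using assms commensurable_scale_nat commensurable_self by (intro gen_index_trans[symmetric])
  finally show ?thesis using 1 assms by (simp add: power_divide)
qed

text \<open>The index of \<open>c R\<close> in \<open>R\<close> equals that of its complex conjugate; the product of the two is the
  index of \<open>c \<cdot> cnj c \<cdot> R\<close>, a rational multiple of \<open>R\<close>.\<close>

lemma gen_index_scale_conjugation:
  assumes "cnj ` R = R" "0 < p" "0 < q" "c * cnj c = of_nat p / of_nat q"
    and "commensurable ((\<lambda>x. c * x) ` R)" "commensurable A"
  shows "(gen_index R ((\<lambda>x. c * x) ` A))\<^sup>2 = (real p / real q) ^ CARD('i) * (gen_index R A)\<^sup>2"
proof -
  let ?c = "\<lambda>c S. (\<lambda>x. c * x) ` S"
  have c0: "c \<noteq> 0" using assms(2,3,4) by auto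
  have com: "commensurable (?c c A)" using commensurable_scale assms by blast
  have cn: "cnj ` ?c c R = ?c (cnj c) R"
    using assms(1) by (metis (no_types, lifting) complex_cnj_mult image_cong image_image)
  have "gen_index R (?c c R) = gen_index (cnj ` R) (cnj ` ?c c R)" by (simp only: gen_index_cnj)
  also have "\<dots> = gen_index R (?c (cnj c) R)" by (simp only: cn assms(1))
  also have "\<dots> = gen_index (?c c R) (?c c (?c (cnj c) R))" by (rule gen_index_scale[OF c0, symmetric])
  also have "?c c (?c (cnj c) R) = ?c (of_nat p / of_nat q) R"
    by (simp only: image_image mult.assoc[symmetric] assms(4))
  finally have 1: "gen_index R (?c c R) = gen_index (?c c R) (?c (of_nat p / of_nat q) R)" .
  obtain k where k: "0 < k"
    "\<And>x. x \<in> R \<Longrightarrow> of_nat k * x \<in> ?c c R" "\<And>x. x \<in> ?c c R \<Longrightarrow> of_nat k * x \<in> R"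
    using commensurableD[OF assms(5)] by metis
  have "commensurable (cnj ` ?c c R)"
  proof (rule commensurableI[of _ k])
    show "int_complex.subspace (cnj ` ?c c R)" unfolding cn by (rule subspace_scale_image[OF subspace])
  next
    fix x assume "x \<in> R"
    then have "cnj x \<in> R" using assms(1) by (metis complex_cnj_cnj imageE)
    from imageI[OF k(2)[OF this], of cnj] show "of_nat k * x \<in> cnj ` ?c c R" by simp
  next
    fix x assume "x \<in> cnj ` ?c c R"
    then have "cnj x \<in> ?c c R" by auto
    from imageI[OF k(3)[OF this], of cnj] show "of_nat k * x \<in> R" by (simp add: assms(1))
  qed (rule k(1))
  then have "commensurable (?c c (?c (cnj c) R))"
    using commensurable_scale[OF assms(5)] unfolding cn by blast
  then have "commensurable (?c (of_nat p / of_nat q) R)"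
    by (simp only: image_image mult.assoc[symmetric] assms(4))
  then have "gen_index R (?c c R) * gen_index (?c c R) (?c (of_nat p / of_nat q) R) =
      gen_index R (?c (of_nat p / of_nat q) R)"
    using assms(5) commensurable_self by (intro gen_index_trans)
  then have "(gen_index R (?c c R))\<^sup>2 = (real p / real q) ^ CARD('i)"
    using 1 gen_index_scale_rat[OF assms(2,3)] by (simp add: power2_eq_square)
  moreover have "gen_index R (?c c A) = gen_index R (?c c R) * gen_index (?c c R) (?c c A)"
    using assms com commensurable_self by (intro gen_index_trans[symmetric])
  moreover have "gen_index (?c c R) (?c c A) = gen_index R A" by (rule gen_index_scale[OF c0])
  ultimately show ?thesis by (simp add: power_mult_distrib)
qed

end

section \<open>Embeddings\<close>

lemma subfieldD:
  assumes "complex_subfield F"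
  shows "0 \<in> F" "1 \<in> F" "x \<in> F \<Longrightarrow> y \<in> F \<Longrightarrow> x + y \<in> F" "x \<in> F \<Longrightarrow> y \<in> F \<Longrightarrow> x - y \<in> F"
    "x \<in> F \<Longrightarrow> y \<in> F \<Longrightarrow> x * y \<in> F" "x \<in> F \<Longrightarrow> y \<in> F \<Longrightarrow> x / y \<in> F"
  using assms unfolding complex_subfield_def by blast+

lemma subfield_uminus: "complex_subfield F \<Longrightarrow> x \<in> F \<Longrightarrow> - x \<in> F"
  using subfieldD(1)[of F] subfieldD(4)[of F 0 x] by simp

lemma subfield_sum:
  "complex_subfield F \<Longrightarrow> (\<And>i. i \<in> A \<Longrightarrow> f i \<in> F) \<Longrightarrow> sum f A \<in> F"
  by (induction A rule: infinite_finite_induct) (auto intro: subfieldD)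

lemma subfield_prod:
  "complex_subfield F \<Longrightarrow> (\<And>i. i \<in> A \<Longrightarrow> f i \<in> F) \<Longrightarrow> prod f A \<in> F"
  by (induction A rule: infinite_finite_induct) (auto intro: subfieldD)

lemma subfield_power: "complex_subfield F \<Longrightarrow> x \<in> F \<Longrightarrow> x ^ n \<in> F"
  by (induction n) (auto intro: subfieldD)

lemma subfield_of_nat: "complex_subfield F \<Longrightarrow> of_nat n \<in> F"
  by (induction n) (auto intro: subfieldD)

lemma subfield_of_int: "complex_subfield F \<Longrightarrow> of_int n \<in> F"
  by (cases n rule: int_cases2) (auto intro: subfield_uminus subfield_of_nat)

lemma subfield_Rats:
  assumes "complex_subfield F" shows "\<rat> \<subseteq> F"
proof
  fix x :: complex assume "x \<in> \<rat>"
  then obtain a b where "x = of_int a / of_int b" by (auto elim: Rats_cases')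
  then show "x \<in> F" using subfield_of_int subfieldD(6) assms by blast
qed

lemma subfield_of_rat: "complex_subfield F \<Longrightarrow> of_rat q \<in> F"
  using subfield_Rats Rats_of_rat by blast

lemma number_field_subfield: "number_field F \<Longrightarrow> complex_subfield F"
  by (simp add: number_field_def)

section \<open>Calculus with embeddings of subfields\<close>

locale field_embedding =
  fixes F :: "complex set" and \<sigma> :: "complex \<Rightarrow> complex"
  assumes subfield: "complex_subfield F" and emb: "\<sigma> \<in> embeddings F"
begin

lemma one [simp]: "\<sigma> 1 = 1"
  and add: "x \<in> F \<Longrightarrow> y \<in> F \<Longrightarrow> \<sigma> (x + y) = \<sigma> x + \<sigma> y"
  and mult: "x \<in> F \<Longrightarrow> y \<in> F \<Longrightarrow> \<sigma> (x * y) = \<sigma> x * \<sigma> y"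
  using emb by (auto simp: embeddings_def)

lemma zero [simp]: "\<sigma> 0 = 0"
  using add[of 0 0] subfieldD(1)[OF subfield] by simp

lemma diff: "x \<in> F \<Longrightarrow> y \<in> F \<Longrightarrow> \<sigma> (x - y) = \<sigma> x - \<sigma> y"
  using add[of "x - y" y] subfieldD(4)[OF subfield] by (simp add: eq_diff_eq)

lemma uminus: "x \<in> F \<Longrightarrow> \<sigma> (- x) = - \<sigma> x"
  using diff[of 0 x] subfieldD(1)[OF subfield] by simp

lemma nonzero: "x \<in> F \<Longrightarrow> x \<noteq> 0 \<Longrightarrow> \<sigma> x \<noteq> 0"
proof
  assume x: "x \<in> F" "x \<noteq> 0" "\<sigma> x = 0"
  have "\<sigma> (x * (1 / x)) = \<sigma> x * \<sigma> (1 / x)"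
    using x subfieldD[OF subfield] by (intro mult) auto
  then show False using x by simp
qed

lemma inj: "inj_on \<sigma> F"
proof (rule inj_onI)
  fix x y assume xy: "x \<in> F" "y \<in> F" "\<sigma> x = \<sigma> y"
  then have "\<sigma> (x - y) = 0" by (simp add: diff)
  then show "x = y" using nonzero[of "x - y"] xy subfieldD(4)[OF subfield] by auto
qed

lemma divide: "x \<in> F \<Longrightarrow> y \<in> F \<Longrightarrow> \<sigma> (x / y) = \<sigma> x / \<sigma> y"
proof (cases "y = 0")
  case False
  assume xy: "x \<in> F" "y \<in> F"
  then have "\<sigma> (x / y * y) = \<sigma> (x / y) * \<sigma> y"
    using subfieldD(6)[OF subfield] by (intro mult) auto
  then show ?thesis using False nonzero[OF xy(2)] by (simp add: field_simps)
qed simp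

lemma sum: "(\<And>i. i \<in> A \<Longrightarrow> f i \<in> F) \<Longrightarrow> \<sigma> (sum f A) = (\<Sum>i\<in>A. \<sigma> (f i))"
  by (induction A rule: infinite_finite_induct) (auto simp: add subfield_sum[OF subfield])

lemma prod: "(\<And>i. i \<in> A \<Longrightarrow> f i \<in> F) \<Longrightarrow> \<sigma> (prod f A) = (\<Prod>i\<in>A. \<sigma> (f i))"
  by (induction A rule: infinite_finite_induct) (auto simp: mult subfield_prod[OF subfield])

lemma power: "x \<in> F \<Longrightarrow> \<sigma> (x ^ n) = \<sigma> x ^ n"
  by (induction n) (auto simp: mult subfield_power[OF subfield])

lemma of_nat: "\<sigma> (of_nat n) = of_nat n"
  by (induction n) (auto simp: add subfield_of_nat[OF subfield] subfieldD(2)[OF subfield])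

lemma of_int: "\<sigma> (of_int n) = of_int n"
proof (cases n rule: int_cases2)
  case (nonneg k) then show ?thesis by (simp add: of_nat)
next
  case (nonpos k)
  have "\<sigma> (- of_nat k) = - of_nat k"
    using uminus[OF subfield_of_nat[OF subfield]] by (simp add: of_nat)
  then show ?thesis using nonpos by simp
qed

lemma of_Rats: "x \<in> \<rat> \<Longrightarrow> \<sigma> x = x"
proof -
  assume "x \<in> \<rat>"
  then obtain a b where "x = of_int a / of_int b" by (auto elim: Rats_cases')
  then show ?thesis using subfield_of_int[OF subfield] by (simp add: divide of_int)
qed

lemma of_rat: "\<sigma> (of_rat q) = of_rat q"
  by (simp add: of_Rats)

lemma poly_eval:
  assumes "\<And>i. coeff p i \<in> F" "x \<in> F"
  shows "\<sigma> (poly p x) = poly (map_poly \<sigma> p) (\<sigma> x)"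
proof -
  have "\<sigma> (poly p x) = (\<Sum>i\<le>degree p. \<sigma> (coeff p i) * \<sigma> x ^ i)"
    unfolding poly_altdef using assms subfield_power[OF subfield] subfieldD(5)[OF subfield]
    by (simp add: sum mult power)
  also have "\<dots> = (\<Sum>i\<le>degree p. coeff (map_poly \<sigma> p) i * \<sigma> x ^ i)"
    by (simp add: coeff_map_poly)
  also have "\<dots> = poly (map_poly \<sigma> p) (\<sigma> x)"
  proof -
    have "degree (map_poly \<sigma> p) \<le> degree p" by (intro degree_le) (simp add: coeff_map_poly coeff_eq_0)
    then show ?thesis
      unfolding poly_altdef by (intro sum.mono_neutral_right) (auto simp: coeff_eq_0)
  qed
  finally show ?thesis .
qed

lemma map_poly_add:
  assumes "\<And>i. coeff p i \<in> F" "\<And>i. coeff q i \<in> F"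
  shows "map_poly \<sigma> (p + q) = map_poly \<sigma> p + map_poly \<sigma> q"
  by (rule poly_eqI) (simp add: coeff_map_poly assms add)

lemma map_poly_mult:
  assumes "\<And>i. coeff p i \<in> F" "\<And>i. coeff q i \<in> F"
  shows "map_poly \<sigma> (p * q) = map_poly \<sigma> p * map_poly \<sigma> q"
proof (rule poly_eqI)
  fix n
  show "coeff (map_poly \<sigma> (p * q)) n = coeff (map_poly \<sigma> p * map_poly \<sigma> q) n"
    using subfieldD(5)[OF subfield] assms
    by (simp add: coeff_map_poly coeff_mult sum mult)
qed

end

lemma embeddings_eqI:
  assumes "\<sigma> \<in> embeddings F" "\<tau> \<in> embeddings F" "\<And>x. x \<in> F \<Longrightarrow> \<sigma> x = \<tau> x"
  shows "\<sigma> = \<tau>"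
  using assms extensionalityI[of \<sigma> F \<tau>] by (auto simp: embeddings_def)

lemma restrict_embedding:
  assumes "complex_subfield F" "F \<subseteq> F'" "\<And>x y. x \<in> F' \<Longrightarrow> y \<in> F' \<Longrightarrow> \<sigma> (x + y) = \<sigma> x + \<sigma> y"
    "\<And>x y. x \<in> F' \<Longrightarrow> y \<in> F' \<Longrightarrow> \<sigma> (x * y) = \<sigma> x * \<sigma> y" "\<sigma> 1 = 1"
  shows "restrict \<sigma> F \<in> embeddings F"
proof -
  have "x \<in> F'" if "x \<in> F" for x using assms(2) that by blast
  then show ?thesis
    unfolding embeddings_def using assms(3-5) subfieldD(2,3,5)[OF assms(1)] by auto
qed

lemma poly_coeff_mult_subfield:
  assumes "complex_subfield F" "\<And>i. coeff p i \<in> F" "\<And>i. coeff q i \<in> F"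
  shows "coeff (p * q) i \<in> F"
  unfolding coeff_mult using assms by (auto intro!: subfield_sum subfieldD)

lemma poly_coeff_prod_subfield:
  assumes "complex_subfield F" "\<And>j i. j \<in> A \<Longrightarrow> coeff (f j) i \<in> F"
  shows "coeff (prod f A) i \<in> F"
  using assms(2)
proof (induction A arbitrary: i rule: infinite_finite_induct)
  case (insert x A)
  then show ?case by (auto intro!: poly_coeff_mult_subfield[OF assms(1)])
qed (auto simp: subfieldD[OF assms(1)])

lemma poly_coeff_linear_subfield:
  assumes "complex_subfield F" "x \<in> F" shows "coeff [:- x, 1:] i \<in> F"
proof -
  have "coeff [:- x, 1:] i \<in> {- x, 1, 0}" by (auto simp: coeff_pCons split: nat.splits)
  then show ?thesis using assms subfieldD[OF assms(1)] subfield_uminus by auto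
qed

lemma (in field_embedding) map_poly_prod:
  assumes "\<And>j i. j \<in> A \<Longrightarrow> coeff (f j) i \<in> F"
  shows "map_poly \<sigma> (prod f A) = (\<Prod>j\<in>A. map_poly \<sigma> (f j))"
  using assms
  by (induction A rule: infinite_finite_induct)
    (auto simp: map_poly_mult poly_coeff_prod_subfield[OF subfield])

lemma (in field_embedding) map_poly_sum:
  assumes "\<And>j i. j \<in> A \<Longrightarrow> coeff (f j) i \<in> F"
  shows "map_poly \<sigma> (sum f A) = (\<Sum>j\<in>A. map_poly \<sigma> (f j))"
  using assms
proof (induction A rule: infinite_finite_induct)
  case (insert x A)
  then have "coeff (sum f A) i \<in> F" for i by (auto simp: coeff_sum intro!: subfield_sum[OF subfield])
  then show ?case using insert by (simp add: map_poly_add)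
qed auto

lemma (in field_embedding) map_poly_linear:
  "x \<in> F \<Longrightarrow> map_poly \<sigma> [:- x, 1:] = [:- \<sigma> x, 1:]"
  by (simp add: map_poly_pCons uminus)

lemma (in field_embedding) map_poly_smult:
  "c \<in> F \<Longrightarrow> (\<And>i. coeff p i \<in> F) \<Longrightarrow> map_poly \<sigma> (smult c p) = smult (\<sigma> c) (map_poly \<sigma> p)"
  by (rule poly_eqI) (simp add: coeff_map_poly mult)

section \<open>Algebraicity and finiteness of the embeddings\<close>

lemma number_field_algebraic:
  assumes "number_field F" "x \<in> F"
  shows "\<exists>p. p \<noteq> 0 \<and> (\<forall>i. coeff p i \<in> \<rat>) \<and> poly p x = 0"
proof -
  obtain B where B: "finite B" "F = rat_complex.span B" using assms(1) by (auto simp: number_field_def)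
  define n where "n = card B"
  have pw: "x ^ i \<in> rat_complex.span B" for i
    using subfield_power[OF number_field_subfield[OF assms(1)] assms(2)] B(2) by simp
  show ?thesis
  \<comment> \<open>Linear dependence speaks of the set of powers, so coincidences among them are
    treated apart; then a difference of two monomials annihilates \<open>x\<close>. Otherwise there
    is one power more than there are generators.\<close>
  proof (cases "inj_on (\<lambda>i. x ^ i) {..n}")
    case False
    then obtain i j where ij: "i \<noteq> j" "x ^ i = x ^ j" by (auto simp: inj_on_def)
    define p :: "complex poly" where "p = monom 1 i - monom 1 j"
    have "coeff p i \<noteq> 0" using ij by (simp add: p_def)
    then have "p \<noteq> 0" by auto
    moreover have "poly p x = 0" using ij by (simp add: p_def poly_monom)
    moreover have "\<forall>i. coeff p i \<in> \<rat>" by (auto simp: p_def)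
    ultimately show ?thesis by blast
  next
    case True
    let ?S = "(\<lambda>i. x ^ i) ` {..n}"
    have "card ?S = n + 1" using True by (simp add: card_image)
    then have "rat_complex.dependent ?S"
      using rat_complex.independent_span_bound[OF B(1), of ?S] pw by (fastforce simp: n_def)
    then obtain u where u: "\<exists>v\<in>?S. u v \<noteq> 0" "(\<Sum>v\<in>?S. of_rat (u v) * v) = 0"
      using rat_complex.dependent_finite[of ?S] by auto
    define p :: "complex poly" where "p = (\<Sum>i\<le>n. monom (of_rat (u (x ^ i))) i)"
    have co: "coeff p i = (if i \<le> n then of_rat (u (x ^ i)) else 0)" for i
      by (auto simp: p_def coeff_sum)
    obtain k where k: "k \<le> n" "u (x ^ k) \<noteq> 0" using u(1) by auto
    then have "coeff p k \<noteq> 0" by (simp add: co)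
    then have "p \<noteq> 0" by auto
    moreover have "poly p x = 0"
      using u(2) by (simp add: p_def poly_sum poly_monom sum.reindex[OF True])
    moreover have "\<forall>i. coeff p i \<in> \<rat>" by (simp add: co)
    ultimately show ?thesis by blast
  qed
qed

lemma finite_embeddings:
  assumes "number_field F" shows "finite (embeddings F)"
proof -
  note sub = number_field_subfield[OF assms]
  obtain B where B: "finite B" "F = rat_complex.span B" using assms by (auto simp: number_field_def)
  have BF: "B \<subseteq> F" using B(2) rat_complex.span_superset by blast
  obtain p where p: "\<And>x. x \<in> F \<Longrightarrow> p x \<noteq> 0 \<and> (\<forall>i. coeff (p x) i \<in> \<rat>) \<and> poly (p x) x = 0"
    using number_field_algebraic[OF assms] by metis
  define roots where "roots = (\<lambda>x. {z. poly (p x) z = 0})"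
  have fin: "finite (Pi\<^sub>E B roots)"
    using B(1) p BF by (intro finite_PiE) (auto simp: roots_def poly_roots_finite)
  have "(\<lambda>\<sigma>. restrict \<sigma> B) ` embeddings F \<subseteq> Pi\<^sub>E B roots"
  proof (clarsimp simp: PiE_iff)
    fix \<sigma> x assume s: "\<sigma> \<in> embeddings F" "x \<in> B"
    interpret field_embedding F \<sigma> using sub s(1) by unfold_locales
    have x: "x \<in> F" using s BF by blast
    have rat: "coeff (p x) i \<in> \<rat>" for i using p[OF x] by blast
    have "map_poly \<sigma> (p x) = p x" by (rule poly_eqI) (simp add: coeff_map_poly of_Rats rat)
    moreover have "\<sigma> (poly (p x) x) = poly (map_poly \<sigma> (p x)) (\<sigma> x)"
      using rat subfield_Rats[OF sub] x by (intro poly_eval) auto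
    ultimately show "\<sigma> x \<in> roots x" using p[OF x] by (simp add: roots_def)
  qed
  then have "finite ((\<lambda>\<sigma>. restrict \<sigma> B) ` embeddings F)" using fin finite_subset by blast
  moreover have "inj_on (\<lambda>\<sigma>. restrict \<sigma> B) (embeddings F)"
  proof (rule inj_onI)
    fix \<sigma> \<tau> assume st: "\<sigma> \<in> embeddings F" "\<tau> \<in> embeddings F" "restrict \<sigma> B = restrict \<tau> B"
    interpret s: field_embedding F \<sigma> using sub st(1) by unfold_locales
    interpret t: field_embedding F \<tau> using sub st(2) by unfold_locales
    have eqB: "\<sigma> b = \<tau> b" if "b \<in> B" for b using st(3) that by (metis restrict_apply)
    have "x \<in> F \<and> \<sigma> x = \<tau> x" if "x \<in> rat_complex.span B" for x
      using that
    proof (induction rule: rat_complex.span_induct_alt)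
      case (step c z y)
      then have zF: "z \<in> F" "of_rat c \<in> F" "of_rat c * z \<in> F"
        using BF subfield_of_rat[OF sub] subfieldD(5)[OF sub] by blast+
      then show ?case using step eqB subfieldD(3)[OF sub]
        by (simp add: s.add t.add s.mult t.mult s.of_rat t.of_rat)
    qed (use subfieldD(1)[OF sub] in auto)
    then show "\<sigma> = \<tau>" using st B(2) by (intro embeddings_eqI) auto
  qed
  ultimately show ?thesis using finite_imageD by blast
qed

text \<open>If \<open>u\<close> lies only in \<open>W i\<close> and \<open>v\<close> outside it,
  then the infinitely many vectors \<open>v + k u\<close> avoid \<open>W i\<close>; two of them
  share some other \<open>W j\<close>, and their difference puts \<open>u\<close> there, a
  contradiction. This yields both the extension of embeddings to L and an element that separates all
  embeddings.\<close>

lemma subspace_subset_finite_Union: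
  assumes "finite I" "rat_complex.subspace V" "\<And>i. i \<in> I \<Longrightarrow> rat_complex.subspace (W i)" "V \<subseteq> (\<Union>i\<in>I. W i)"
  shows "\<exists>i\<in>I. V \<subseteq> W i"
  using assms(1,3,4)
proof (induction I rule: finite_induct)
  case empty
  then show ?case using rat_complex.subspace_0[OF assms(2)] by auto
next
  case (insert i I)
  show ?case
  proof (rule ccontr)
    assume no: "\<not> (\<exists>i\<in>insert i I. V \<subseteq> W i)"
    then have "\<not> V \<subseteq> (\<Union>i\<in>I. W i)" using insert.IH insert.prems(1) by blast
    then obtain u where u: "u \<in> V" "u \<notin> (\<Union>i\<in>I. W i)" by blast
    then have ui: "u \<in> W i" using insert.prems(2) by auto
    obtain v where v: "v \<in> V" "v \<notin> W i" using no by blast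
    note Wi = insert.prems(1)[of i, simplified]
    have out: "\<exists>j\<in>I. v + of_nat k * u \<in> W j" for k :: nat
    proof -
      have ku: "of_nat k * u \<in> V" "of_nat k * u \<in> W i"
        using rat_complex.subspace_scale[OF assms(2) u(1), of "of_nat k"]
          rat_complex.subspace_scale[OF Wi ui, of "of_nat k"] by simp_all
      have "v + of_nat k * u \<in> V" using rat_complex.subspace_add[OF assms(2) v(1) ku(1)] .
      moreover have "v + of_nat k * u \<notin> W i"
      proof
        assume "v + of_nat k * u \<in> W i"
        then have "v + of_nat k * u - of_nat k * u \<in> W i"
          using rat_complex.subspace_diff[OF Wi] ku(2) by blast
        then show False using v by simp
      qed
      ultimately show ?thesis using insert.prems(2) by auto
    qed
    then obtain f where f: "\<And>k. f k \<in> I \<and> v + of_nat k * u \<in> W (f k)" by metis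
    have "\<not> inj f" using f insert.hyps(1) finite_subset[of "range f" I] finite_imageD[of f UNIV] by auto
    then obtain k l where kl: "k < l" "f k = f l" by (metis injI linorder_neqE_nat)
    have Wk: "rat_complex.subspace (W (f k))" using f insert.prems(1) by blast
    have "(v + of_nat l * u) - (v + of_nat k * u) \<in> W (f k)"
      using f[of k] f[of l] kl rat_complex.subspace_diff[OF Wk] by metis
    moreover have "of_rat (1 / of_nat (l - k)) * ((v + of_nat l * u) - (v + of_nat k * u)) = u"
      using kl by (simp add: of_rat_divide of_rat_diff of_nat_diff field_simps)
    ultimately have "u \<in> W (f k)" using rat_complex.subspace_scale[OF Wk] by metis
    then show False using u f by blast
  qed
qed

lemma subspace_eq_set:
  assumes "number_field F" "\<sigma> \<in> embeddings F" "F \<subseteq> F'" "complex_subfield F'" "\<tau> \<in> embeddings F'"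
  shows "rat_complex.subspace {x \<in> F. \<sigma> x = \<tau> x}"
proof -
  note sub = number_field_subfield[OF assms(1)]
  interpret s: field_embedding F \<sigma> using sub assms by unfold_locales
  interpret t: field_embedding F' \<tau> using assms by unfold_locales
  show ?thesis
  proof (rule rat_complex.subspaceI)
    fix c x assume "x \<in> {x \<in> F. \<sigma> x = \<tau> x}"
    then show "of_rat c * x \<in> {x \<in> F. \<sigma> x = \<tau> x}"
      using subfield_of_rat[OF sub, of c] subfieldD[OF sub] assms(3)
      by (auto simp: s.mult t.mult s.of_rat t.of_rat subsetD)
  qed (use subfieldD[OF sub] assms(3) in \<open>auto simp: s.add t.add subsetD\<close>)
qed

lemma number_field_subspace: "number_field F \<Longrightarrow> rat_complex.subspace F"
  unfolding number_field_def using rat_complex.subspace_span by blast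

section \<open>Galois groups\<close>

locale galois_number_field =
  fixes L :: "complex set"
  assumes galois: "finite_galois_over_Q L"
begin

lemma L_number_field: "number_field L"
  using galois by (simp add: finite_galois_over_Q_def)

lemmas L_subfield = number_field_subfield[OF L_number_field]

abbreviation "G \<equiv> Gal L"

lemma Gal_embedding: "\<sigma> \<in> carrier G \<Longrightarrow> \<sigma> \<in> embeddings L"
  by (simp add: Gal_def)

lemma Gal_field_embedding: "\<sigma> \<in> carrier G \<Longrightarrow> field_embedding L \<sigma>"
  using L_subfield Gal_embedding by unfold_locales

lemma Gal_image: "\<sigma> \<in> carrier G \<Longrightarrow> \<sigma> ` L = L"
  by (simp add: Gal_def)

lemma Gal_closed: "\<sigma> \<in> carrier G \<Longrightarrow> x \<in> L \<Longrightarrow> \<sigma> x \<in> L"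
  using Gal_image by blast

lemma Gal_mult: "\<sigma> \<otimes>\<^bsub>G\<^esub> \<tau> = compose L \<tau> \<sigma>"
  by (simp add: Gal_def)

lemma Gal_mult_apply: "x \<in> L \<Longrightarrow> (\<sigma> \<otimes>\<^bsub>G\<^esub> \<tau>) x = \<tau> (\<sigma> x)"
  by (simp add: Gal_mult compose_def)

lemma Gal_one: "\<one>\<^bsub>G\<^esub> = restrict id L"
  by (simp add: Gal_def id_def)

lemma GalI:
  assumes "\<sigma> \<in> embeddings L" "\<sigma> ` L = L" shows "\<sigma> \<in> carrier G"
  using assms by (simp add: Gal_def)

lemma Gal_group: "group G"
proof (rule groupI)
  fix \<sigma> \<tau> assume st: "\<sigma> \<in> carrier G" "\<tau> \<in> carrier G"
  interpret s: field_embedding L \<sigma> using Gal_field_embedding st by blast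
  interpret t: field_embedding L \<tau> using Gal_field_embedding st by blast
  have "compose L \<tau> \<sigma> \<in> embeddings L"
    unfolding embeddings_def
    using subfieldD[OF L_subfield] Gal_closed[OF st(1)]
    by (auto simp: compose_def s.add t.add s.mult t.mult)
  moreover have "compose L \<tau> \<sigma> ` L = \<tau> ` (\<sigma> ` L)"
    by (auto simp: compose_def image_image)
  ultimately show "\<sigma> \<otimes>\<^bsub>G\<^esub> \<tau> \<in> carrier G"
    unfolding Gal_mult using st Gal_image by (intro GalI) auto
next
  have "restrict id L \<in> embeddings L"
    using L_subfield by (intro restrict_embedding[of L L]) auto
  then show "\<one>\<^bsub>G\<^esub> \<in> carrier G" unfolding Gal_one by (intro GalI) auto
next
  fix \<sigma> \<tau> \<rho> assume "\<sigma> \<in> carrier G" "\<tau> \<in> carrier G" "\<rho> \<in> carrier G"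
  then show "\<sigma> \<otimes>\<^bsub>G\<^esub> \<tau> \<otimes>\<^bsub>G\<^esub> \<rho> = \<sigma> \<otimes>\<^bsub>G\<^esub> (\<tau> \<otimes>\<^bsub>G\<^esub> \<rho>)"
    unfolding Gal_mult using Gal_closed by (auto simp: compose_def)
next
  fix \<sigma> assume s: "\<sigma> \<in> carrier G"
  have "\<sigma> \<in> extensional L" using Gal_embedding[OF s] by (simp add: embeddings_def)
  then show "\<one>\<^bsub>G\<^esub> \<otimes>\<^bsub>G\<^esub> \<sigma> = \<sigma>"
    unfolding Gal_mult Gal_one by (intro extensionalityI[of _ L]) (auto simp: compose_def)
next
  fix \<sigma> assume s: "\<sigma> \<in> carrier G"
  interpret s: field_embedding L \<sigma> using Gal_field_embedding s by blast
  define \<tau> where "\<tau> = restrict (inv_into L \<sigma>) L"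
  have ts: "\<tau> (\<sigma> x) = x" if "x \<in> L" for x
    using that Gal_closed[OF s] s.inj by (simp add: \<tau>_def)
  have st: "\<tau> x \<in> L" "\<sigma> (\<tau> x) = x" if "x \<in> L" for x
  proof -
    have "x \<in> \<sigma> ` L" using that Gal_image[OF s] by simp
    then show "\<tau> x \<in> L" "\<sigma> (\<tau> x) = x"
      using that by (simp_all add: \<tau>_def inv_into_into f_inv_into_f)
  qed
  have "\<tau> \<in> embeddings L"
    unfolding embeddings_def
  proof (clarify, intro conjI ballI)
    show "\<tau> \<in> extensional L" by (simp add: \<tau>_def)
    show "\<tau> 1 = 1" using ts[of 1] subfieldD[OF L_subfield] by simp
    fix x y assume xy: "x \<in> L" "y \<in> L"
    have "\<tau> (\<sigma> (\<tau> x + \<tau> y)) = \<tau> x + \<tau> y" "\<tau> (\<sigma> (\<tau> x * \<tau> y)) = \<tau> x * \<tau> y"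
      using xy st subfieldD[OF L_subfield] by (auto intro!: ts)
    then show "\<tau> (x + y) = \<tau> x + \<tau> y" "\<tau> (x * y) = \<tau> x * \<tau> y"
      using xy st by (simp_all add: s.add s.mult)
  qed
  moreover have "\<tau> ` L = L" using st ts Gal_closed[OF s] by force
  ultimately have "\<tau> \<in> carrier G" by (rule GalI)
  moreover have "\<tau> \<otimes>\<^bsub>G\<^esub> \<sigma> = \<one>\<^bsub>G\<^esub>"
    unfolding Gal_mult Gal_one using st by (auto simp: compose_def)
  ultimately show "\<exists>\<tau>\<in>carrier G. \<tau> \<otimes>\<^bsub>G\<^esub> \<sigma> = \<one>\<^bsub>G\<^esub>" by blast
qed

sublocale G: group G by (rule Gal_group)

lemma finite_Gal: "finite (carrier G)"
  using finite_embeddings[OF L_number_field] by (auto simp: Gal_def)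

lemma Gal_one_apply: "x \<in> L \<Longrightarrow> \<one>\<^bsub>G\<^esub> x = x"
  by (simp add: Gal_one)

lemma Gal_inv_apply: "\<sigma> \<in> carrier G \<Longrightarrow> x \<in> L \<Longrightarrow> (inv\<^bsub>G\<^esub> \<sigma>) (\<sigma> x) = x"
  by (metis G.r_inv Gal_mult_apply Gal_one_apply)

lemma fixed_Rats: "x \<in> L \<Longrightarrow> (\<And>\<sigma>. \<sigma> \<in> carrier G \<Longrightarrow> \<sigma> x = x) \<Longrightarrow> x \<in> \<rat>"
  using galois by (auto simp: finite_galois_over_Q_def fixed_field_def)

lemma Gal_mult_bij: "\<gamma> \<in> carrier G \<Longrightarrow> bij_betw (\<lambda>\<sigma>. \<sigma> \<otimes>\<^bsub>G\<^esub> \<gamma>) (carrier G) (carrier G)"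
  by (rule bij_betw_byWitness[of _ "\<lambda>\<sigma>. \<sigma> \<otimes>\<^bsub>G\<^esub> inv\<^bsub>G\<^esub> \<gamma>"]) (auto simp: G.m_assoc)

section \<open>Conjugates and extension of embeddings\<close>

lemma poly_Rats:
  assumes "\<And>i. coeff p i \<in> L" "\<And>\<gamma>. \<gamma> \<in> carrier G \<Longrightarrow> map_poly \<gamma> p = p"
  shows "coeff p i \<in> \<rat>"
proof (rule fixed_Rats[OF assms(1)])
  fix \<gamma> assume g: "\<gamma> \<in> carrier G"
  interpret field_embedding L \<gamma> using Gal_field_embedding g by blast
  show "\<gamma> (coeff p i) = coeff p i" using arg_cong[OF assms(2)[OF g], of "\<lambda>p. coeff p i"] by (simp add: coeff_map_poly)
qed

text \<open>Each \<gamma> permutes the linear factors by right translation. The product runs over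
  group elements and not over distinct conjugates; roots may repeat, as only the set of roots is
  used.\<close>

lemma conjugate_poly:
  assumes "x \<in> L"
  defines "p \<equiv> \<Prod>\<sigma>\<in>carrier G. [:- \<sigma> x, 1:]"
  shows "coeff p i \<in> \<rat>" "poly p z = 0 \<longleftrightarrow> (\<exists>\<sigma>\<in>carrier G. z = \<sigma> x)" "poly p x = 0"
proof -
  have L: "coeff [:- \<sigma> x, 1:] i \<in> L" if "\<sigma> \<in> carrier G" for \<sigma> i
    using poly_coeff_linear_subfield[OF L_subfield] Gal_closed[OF that assms(1)] by blast
  show "coeff p i \<in> \<rat>"
  proof (rule poly_Rats)
    fix \<gamma> assume g: "\<gamma> \<in> carrier G"
    interpret field_embedding L \<gamma> using Gal_field_embedding g by blast
    have "map_poly \<gamma> p = (\<Prod>\<sigma>\<in>carrier G. map_poly \<gamma> [:- \<sigma> x, 1:])"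
      unfolding p_def using L by (intro map_poly_prod) auto
    also have "\<dots> = (\<Prod>\<sigma>\<in>carrier G. [:- (\<sigma> \<otimes>\<^bsub>G\<^esub> \<gamma>) x, 1:])"
      using assms(1) by (intro prod.cong refl) (simp only: map_poly_linear Gal_closed Gal_mult_apply)
    also have "\<dots> = p" unfolding p_def by (rule prod.reindex_bij_betw[OF Gal_mult_bij[OF g]])
    finally show "map_poly \<gamma> p = p" .
  qed (use L in \<open>auto simp: p_def intro!: poly_coeff_prod_subfield[OF L_subfield]\<close>)
  show *: "poly p z = 0 \<longleftrightarrow> (\<exists>\<sigma>\<in>carrier G. z = \<sigma> x)" for z
    using finite_Gal by (auto simp: p_def poly_prod prod_zero_iff)
  show "poly p x = 0" unfolding * using Gal_one_apply[OF assms(1)] G.one_closed by metis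
qed

text \<open>Every value \<phi> x is a root of the conjugate polynomial of x, so some \<sigma>, which
  may depend on x, agrees with \<phi> at x. The agreement sets are finitely many rational subspaces
  covering K, hence one of them is K.\<close>

lemma embedding_extends:
  assumes "number_field K" "K \<subseteq> L" "\<phi> \<in> embeddings K"
  shows "\<exists>\<sigma>\<in>carrier G. \<forall>x\<in>K. \<phi> x = \<sigma> x"
proof -
  note sub = number_field_subfield[OF assms(1)]
  interpret field_embedding K \<phi> using sub assms(3) by unfold_locales
  have "\<exists>\<sigma>\<in>carrier G. \<phi> x = \<sigma> x" if x: "x \<in> K" for x
  proof -
    define p where "p = (\<Prod>\<sigma>\<in>carrier G. [:- \<sigma> x, 1:])"
    have xL: "x \<in> L" using x assms(2) by blast
    note p = conjugate_poly[OF xL, folded p_def]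
    have "map_poly \<phi> p = p" by (rule poly_eqI) (simp add: coeff_map_poly of_Rats p(1))
    moreover have "\<phi> (poly p x) = poly (map_poly \<phi> p) (\<phi> x)"
      using p(1) subfield_Rats[OF sub] x by (intro poly_eval) auto
    ultimately show ?thesis using p(2,3) by simp
  qed
  then have "K \<subseteq> (\<Union>\<sigma>\<in>carrier G. {x \<in> K. \<phi> x = \<sigma> x})" by blast
  then have "\<exists>\<sigma>\<in>carrier G. K \<subseteq> {x \<in> K. \<phi> x = \<sigma> x}"
    using finite_Gal number_field_subspace[OF assms(1)] assms L_subfield Gal_embedding
    by (intro subspace_subset_finite_Union subspace_eq_set) auto
  then show ?thesis by blast
qed

lemma embedding_range: "number_field K \<Longrightarrow> K \<subseteq> L \<Longrightarrow> \<phi> \<in> embeddings K \<Longrightarrow> x \<in> K \<Longrightarrow> \<phi> x \<in> L"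
  using embedding_extends Gal_closed by (metis subsetD)

lemma Gal_comp_embedding:
  assumes "number_field K" "K \<subseteq> L" "\<phi> \<in> embeddings K" "\<gamma> \<in> carrier G"
  shows "(\<lambda>x\<in>K. \<gamma> (\<phi> x)) \<in> embeddings K"
proof -
  note sub = number_field_subfield[OF assms(1)]
  interpret p: field_embedding K \<phi> using sub assms(3) by unfold_locales
  interpret g: field_embedding L \<gamma> using Gal_field_embedding assms(4) by blast
  note r = embedding_range[OF assms(1-3)]
  show ?thesis
    by (rule restrict_embedding[of K K]) (auto simp: sub p.add p.mult g.add g.mult r)
qed

lemma Gal_comp_bij:
  assumes "number_field K" "K \<subseteq> L" "\<gamma> \<in> carrier G"
  shows "bij_betw (\<lambda>\<phi>. \<lambda>x\<in>K. \<gamma> (\<phi> x)) (embeddings K) (embeddings K)"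
proof (rule bij_betw_byWitness[of _ "\<lambda>\<phi>. \<lambda>x\<in>K. (inv\<^bsub>G\<^esub> \<gamma>) (\<phi> x)"])
  have 1: "(\<lambda>x\<in>K. (inv\<^bsub>G\<^esub> \<gamma>') ((\<lambda>x\<in>K. \<gamma>' (\<phi> x)) x)) = \<phi>"
    if "\<phi> \<in> embeddings K" "\<gamma>' \<in> carrier G" for \<phi> \<gamma>'
    using that embedding_range[OF assms(1,2) that(1)] Gal_inv_apply[OF that(2)]
    by (intro extensionalityI[of _ K]) (auto simp: embeddings_def)
  then show "\<forall>\<phi>\<in>embeddings K. (\<lambda>x\<in>K. (inv\<^bsub>G\<^esub> \<gamma>) ((\<lambda>x\<in>K. \<gamma> (\<phi> x)) x)) = \<phi>"
    using assms(3) by blast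
  show "\<forall>\<phi>\<in>embeddings K. (\<lambda>x\<in>K. \<gamma> ((\<lambda>x\<in>K. (inv\<^bsub>G\<^esub> \<gamma>) (\<phi> x)) x)) = \<phi>"
    using 1[of _ "inv\<^bsub>G\<^esub> \<gamma>"] assms(3) by simp
qed (use Gal_comp_embedding[OF assms(1,2)] assms(3) in auto)

text \<open>Lagrange interpolation at the conjugates of an element \<open>\<theta>\<close> separating the embeddings of \<open>K\<close>
  writes every element of \<open>K\<close> as a polynomial in \<open>\<theta>\<close>, up to a common denominator.\<close>

lemma degree_le_card_embeddings:
  assumes "number_field K" "K \<subseteq> L"
  shows "degree_over_Q K \<le> card (embeddings K)"
proof -
  note sub = number_field_subfield[OF assms(1)]
  define E where "E = embeddings K"
  have finE: "finite E" using finite_embeddings[OF assms(1)] by (simp add: E_def)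
  have rng: "\<phi> x \<in> L" if "\<phi> \<in> E" "x \<in> K" for \<phi> x
    using embedding_range[OF assms] that by (auto simp: E_def)
  define P where "P = {(\<phi>, \<phi>'). \<phi> \<in> E \<and> \<phi>' \<in> E \<and> \<phi> \<noteq> \<phi>'}"
  have "finite P" using finE by (intro finite_subset[of P "E \<times> E"]) (auto simp: P_def)
  \<comment> \<open>Two distinct embeddings agree on a proper subspace only. Finitely many such
    subspaces do not cover \<open>K\<close>, so some \<theta> tells all embeddings apart.\<close>
  have "\<not> K \<subseteq> (\<Union>(\<phi>, \<phi>')\<in>P. {x \<in> K. \<phi> x = \<phi>' x})"
  proof
    assume "K \<subseteq> (\<Union>(\<phi>, \<phi>')\<in>P. {x \<in> K. \<phi> x = \<phi>' x})"
    then have "K \<subseteq> (\<Union>t\<in>P. {x \<in> K. fst t x = snd t x})" by (simp add: case_prod_beta)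
    then have "\<exists>t\<in>P. K \<subseteq> {x \<in> K. fst t x = snd t x}"
      using \<open>finite P\<close> number_field_subspace[OF assms(1)] assms(1) sub
      by (intro subspace_subset_finite_Union subspace_eq_set) (auto simp: P_def E_def)
    then show False using embeddings_eqI by (auto simp: P_def E_def)
  qed
  then obtain \<theta> where th: "\<theta> \<in> K" "\<And>\<phi> \<phi>'. \<phi> \<in> E \<Longrightarrow> \<phi>' \<in> E \<Longrightarrow> \<phi> \<noteq> \<phi>' \<Longrightarrow> \<phi> \<theta> \<noteq> \<phi>' \<theta>"
    by (fastforce simp: P_def)
  define \<iota> where "\<iota> = restrict id K"
  have io: "\<iota> \<in> E" unfolding \<iota>_def E_def using sub by (intro restrict_embedding[of K K]) auto
  \<comment> \<open>Value at \<theta> of the derivative of the product of all X - \<phi> \<theta>: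
    the denominator of Lagrange interpolation at the point \<theta>.\<close>
  define D where "D = (\<Prod>\<phi>\<in>E - {\<iota>}. \<theta> - \<phi> \<theta>)"
  have D0: "D \<noteq> 0" proof -
    have "\<theta> - \<phi> \<theta> \<noteq> 0" if "\<phi> \<in> E - {\<iota>}" for \<phi>
      using th(2)[of \<iota> \<phi>] io that th(1) by (auto simp: \<iota>_def)
    then show ?thesis unfolding D_def using finE by (subst prod_zero_iff) auto
  qed
  \<comment> \<open>Interpolation without denominators: the value at \<theta> is x D, since every
    summand with \<phi> different from the inclusion \<iota> vanishes there. Galois elements permute
    the summands, which makes the coefficients rational.\<close>
  define f where "f x = (\<Sum>\<phi>\<in>E. smult (\<phi> x) (\<Prod>\<phi>'\<in>E - {\<phi>}. [:- \<phi>' \<theta>, 1:]))" for x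
  define m where "m = card E"
  have "m > 0" using finE io by (auto simp: m_def card_gt_0_iff)
  have fL: "coeff (\<Prod>\<phi>'\<in>E - {\<phi>}. [:- \<phi>' \<theta>, 1:]) i \<in> L" for \<phi> i
    using rng th by (intro poly_coeff_prod_subfield[OF L_subfield] poly_coeff_linear_subfield[OF L_subfield]) auto
  have fL': "coeff (smult (\<phi> x) (\<Prod>\<phi>'\<in>E - {\<phi>}. [:- \<phi>' \<theta>, 1:])) i \<in> L"
    if "\<phi> \<in> E" "x \<in> K" for \<phi> x i
    using fL rng[OF that] subfieldD(5)[OF L_subfield] by simp
  have frat: "coeff (f x) i \<in> \<rat>" if x: "x \<in> K" for x i
  proof (rule poly_Rats)
    show "coeff (f x) i \<in> L" for i
      unfolding f_def coeff_sum using fL' x by (intro subfield_sum[OF L_subfield]) auto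
    fix \<gamma> assume g: "\<gamma> \<in> carrier G"
    interpret field_embedding L \<gamma> using Gal_field_embedding g by blast
    define \<pi> where "\<pi> \<phi> = (\<lambda>x\<in>K. \<gamma> (\<phi> x))" for \<phi> :: "complex \<Rightarrow> complex"
    have bij: "bij_betw \<pi> E E" unfolding E_def \<pi>_def by (rule Gal_comp_bij[OF assms g])
    have "map_poly \<gamma> (f x) = (\<Sum>\<phi>\<in>E. map_poly \<gamma> (smult (\<phi> x) (\<Prod>\<phi>'\<in>E - {\<phi>}. [:- \<phi>' \<theta>, 1:])))"
      unfolding f_def using fL' x by (intro map_poly_sum) auto
    also have "\<dots> = (\<Sum>\<phi>\<in>E. smult (\<pi> \<phi> x) (\<Prod>\<phi>'\<in>E - {\<pi> \<phi>}. [:- \<phi>' \<theta>, 1:]))"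
    proof (rule sum.cong[OF refl])
      fix \<phi> assume p: "\<phi> \<in> E"
      have "map_poly \<gamma> (smult (\<phi> x) (\<Prod>\<phi>'\<in>E - {\<phi>}. [:- \<phi>' \<theta>, 1:])) =
        smult (\<gamma> (\<phi> x)) (\<Prod>\<phi>'\<in>E - {\<phi>}. map_poly \<gamma> [:- \<phi>' \<theta>, 1:])"
        using fL rng[OF p x] rng th poly_coeff_linear_subfield[OF L_subfield]
        by (subst map_poly_smult, simp, simp, subst map_poly_prod) auto
      also have "(\<Prod>\<phi>'\<in>E - {\<phi>}. map_poly \<gamma> [:- \<phi>' \<theta>, 1:]) = (\<Prod>\<phi>'\<in>E - {\<phi>}. [:- \<pi> \<phi>' \<theta>, 1:])"
        using rng th by (intro prod.cong refl) (simp add: map_poly_linear[simplified] \<pi>_def)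
      also have "\<dots> = (\<Prod>\<phi>'\<in>E - {\<pi> \<phi>}. [:- \<phi>' \<theta>, 1:])"
      proof (rule prod.reindex_bij_betw)
        show "bij_betw \<pi> (E - {\<phi>}) (E - {\<pi> \<phi>})"
          using bij_betw_DiffI[OF bij, of "{\<phi>}" "{\<pi> \<phi>}"] p bij by (auto simp: bij_betw_def)
      qed
      finally show "map_poly \<gamma> (smult (\<phi> x) (\<Prod>\<phi>'\<in>E - {\<phi>}. [:- \<phi>' \<theta>, 1:])) =
        smult (\<pi> \<phi> x) (\<Prod>\<phi>'\<in>E - {\<pi> \<phi>}. [:- \<phi>' \<theta>, 1:])"
        using x by (simp add: \<pi>_def)
    qed
    also have "\<dots> = f x" unfolding f_def by (rule sum.reindex_bij_betw[OF bij])
    finally show "map_poly \<gamma> (f x) = f x" .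
  qed
  have feval: "poly (f x) \<theta> = x * D" if x: "x \<in> K" for x
  proof -
    have "poly (f x) \<theta> = (\<Sum>\<phi>\<in>E. \<phi> x * (\<Prod>\<phi>'\<in>E - {\<phi>}. \<theta> - \<phi>' \<theta>))"
      by (simp add: f_def poly_sum poly_prod)
    also have "\<dots> = (\<Sum>\<phi>\<in>{\<iota>}. \<phi> x * (\<Prod>\<phi>'\<in>E - {\<phi>}. \<theta> - \<phi>' \<theta>))"
    proof (rule sum.mono_neutral_right[OF finE])
      show "\<forall>\<phi>\<in>E - {\<iota>}. \<phi> x * (\<Prod>\<phi>'\<in>E - {\<phi>}. \<theta> - \<phi>' \<theta>) = 0"
      proof
        fix \<phi> assume "\<phi> \<in> E - {\<iota>}"
        then have "\<iota> \<in> E - {\<phi>}" using io by auto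
        then have "(\<Prod>\<phi>'\<in>E - {\<phi>}. \<theta> - \<phi>' \<theta>) = 0"
          using finE th(1) by (intro prod_zero) (auto simp: \<iota>_def intro!: bexI[of _ \<iota>])
        then show "\<phi> x * (\<Prod>\<phi>'\<in>E - {\<phi>}. \<theta> - \<phi>' \<theta>) = 0" by simp
      qed
    qed (use io in auto)
    finally show ?thesis using x by (simp add: D_def \<iota>_def)
  qed
  have fdeg: "degree (f x) < m" for x
  proof -
    have "degree (f x) \<le> m - 1"
      unfolding f_def
    proof (rule degree_sum_le[OF finE])
      fix \<phi> assume p: "\<phi> \<in> E"
      have "degree (smult (\<phi> x) (\<Prod>\<phi>'\<in>E - {\<phi>}. [:- \<phi>' \<theta>, 1:])) \<le> degree (\<Prod>\<phi>'\<in>E - {\<phi>}. [:- \<phi>' \<theta>, 1:])"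
        by (rule degree_smult_le)
      also have "\<dots> \<le> (\<Sum>\<phi>'\<in>E - {\<phi>}. degree [:- \<phi>' \<theta>, 1:])"
        using degree_prod_sum_le[of "E - {\<phi>}" "\<lambda>\<phi>'. [:- \<phi>' \<theta>, 1:]"] finE by (simp add: o_def)
      also have "\<dots> = m - 1" using p finE by (simp add: m_def)
      finally show "degree (smult (\<phi> x) (\<Prod>\<phi>'\<in>E - {\<phi>}. [:- \<phi>' \<theta>, 1:])) \<le> m - 1" .
    qed
    then show ?thesis using \<open>m > 0\<close> by simp
  qed
  define B where "B = (\<lambda>i. \<theta> ^ i / D) ` {..<m}"
  have "K \<subseteq> rat_complex.span B"
  proof
    fix x assume x: "x \<in> K"
    have "x = poly (f x) \<theta> / D" using feval[OF x] D0 by simp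
    also have "poly (f x) \<theta> = (\<Sum>i<m. coeff (f x) i * \<theta> ^ i)"
    proof -
      have "poly (f x) \<theta> = (\<Sum>i\<le>degree (f x). coeff (f x) i * \<theta> ^ i)" by (rule poly_altdef)
      also have "\<dots> = (\<Sum>i<m. coeff (f x) i * \<theta> ^ i)"
        using fdeg[of x] by (intro sum.mono_neutral_left) (auto simp: coeff_eq_0)
      finally show ?thesis .
    qed
    also have "\<dots> / D = (\<Sum>i<m. coeff (f x) i * (\<theta> ^ i / D))" by (simp add: sum_divide_distrib)
    also have "\<dots> \<in> rat_complex.span B"
    proof (rule rat_complex.span_sum)
      fix i assume i: "i \<in> {..<m}"
      obtain q where "coeff (f x) i = of_rat q" using frat[OF x] by (metis Rats_cases)
      then show "coeff (f x) i * (\<theta> ^ i / D) \<in> rat_complex.span B"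
        using i rat_complex.span_scale[OF rat_complex.span_base, of "\<theta> ^ i / D" B q] by (auto simp: B_def)
    qed
    finally show "x \<in> rat_complex.span B" .
  qed
  then have "rat_complex.dim K \<le> card B" by (rule rat_complex.dim_le_card) (simp add: B_def)
  also have "card B \<le> m" unfolding B_def using card_image_le[of "{..<m}"] by simp
  finally show ?thesis by (simp add: degree_over_Q_def m_def E_def)
qed

end

section \<open>CM-fields and reflex fields\<close>

lemma cm_field_number_field: "cm_field K \<Longrightarrow> number_field K"
  by (simp add: cm_field_def totally_imaginary_def)

text \<open>A basis \<open>B\<close> of \<open>F\<close> and its multiples by \<open>t\<close> are
  independent together, as a relation \<open>a + b * t = 0\<close> with nonzero \<open>b\<close>
  would place \<open>t\<close> in \<open>F\<close>. Their number is the degree of \<open>K\<close>,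
  so they span it.\<close>

lemma number_field_sum_decomposition:
  assumes "number_field F" "number_field K" "F \<subseteq> K" "degree_over_Q K = 2 * degree_over_Q F"
    and "t \<in> K" "t \<notin> F" "x \<in> K"
  shows "\<exists>a\<in>F. \<exists>b\<in>F. x = a + b * t"
proof -
  note subF = number_field_subfield[OF assms(1)] and subK = number_field_subfield[OF assms(2)]
  have dim_finite: "\<exists>C. C \<subseteq> E \<and> rat_complex.independent C \<and> E = rat_complex.span C \<and> finite C \<and>
      card C = degree_over_Q E" if nfE: "number_field E" for E
  proof -
    obtain B where B: "finite B" "E = rat_complex.span B" using nfE by (auto simp: number_field_def)
    obtain C where C: "C \<subseteq> E" "rat_complex.independent C" "E \<subseteq> rat_complex.span C"
        "card C = rat_complex.dim E"
      using rat_complex.basis_exists by blast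
    have "finite C" using rat_complex.independent_span_bound[OF B(1) C(2)] C(1) B(2) by blast
    moreover have "rat_complex.span C \<subseteq> E"
      using C(1) number_field_subspace[OF nfE] by (rule rat_complex.span_minimal)
    ultimately show ?thesis using C by (auto simp: degree_over_Q_def)
  qed
  obtain B where B: "B \<subseteq> F" "rat_complex.independent B" "F = rat_complex.span B" "finite B"
    "card B = degree_over_Q F" using dim_finite[OF assms(1)] by blast
  obtain C where C: "C \<subseteq> K" "rat_complex.independent C" "K = rat_complex.span C" "finite C"
    "card C = degree_over_Q K" using dim_finite[OF assms(2)] by blast
  have t0: "t \<noteq> 0" using assms(6) subfieldD(1)[OF subF] by blast
  have inj: "inj_on (\<lambda>b. b * t) B" using t0 by (auto simp: inj_on_def)
  have sp: "a \<in> F" if "a = (\<Sum>v\<in>B. of_rat (u v) * v)" for a u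
    unfolding that B(3) by (intro rat_complex.span_sum rat_complex.span_scale rat_complex.span_base)
  have zero: "b = 0" if "a \<in> F" "b \<in> F" "a + b * t = 0" for a b
  proof (rule ccontr)
    assume b: "b \<noteq> 0"
    then have "t = (0 - a) / b" using that(3) by (simp add: field_simps eq_neg_iff_add_eq_0 add.commute)
    moreover have "(0 - a) / b \<in> F"
      using that(1,2) by (intro subfieldD[OF subF]) auto
    ultimately show False using assms(6) by simp
  qed
  have disj: "B \<inter> (\<lambda>b. b * t) ` B = {}"
  proof (rule equals0I)
    fix v assume "v \<in> B \<inter> (\<lambda>b. b * t) ` B"
    then obtain b where b: "v \<in> B" "b \<in> B" "v = b * t" by auto
    have "b \<in> F" "v \<in> F" using b(1,2) B(1) by auto
    then have "- b = 0" using b(3) subfield_uminus[OF subF] zero[of v "- b"] by simp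
    then show False using b(2) B(2) rat_complex.dependent_zero by auto
  qed
  let ?S = "B \<union> (\<lambda>b. b * t) ` B"
  have indep: "rat_complex.independent ?S"
  proof (rule ccontr)
    assume "\<not> rat_complex.independent ?S"
    then obtain u where u: "\<exists>v\<in>?S. u v \<noteq> 0" "(\<Sum>v\<in>?S. of_rat (u v) * v) = 0"
      using rat_complex.dependent_finite[of ?S] B(4) by auto
    define a where "a = (\<Sum>v\<in>B. of_rat (u v) * v)"
    define b where "b = (\<Sum>v\<in>B. of_rat (u (v * t)) * v)"
    have "(\<Sum>v\<in>?S. of_rat (u v) * v) = a + (\<Sum>v\<in>(\<lambda>b. b * t) ` B. of_rat (u v) * v)"
      unfolding a_def using B(4) disj by (intro sum.union_disjoint) auto
    also have "(\<Sum>v\<in>(\<lambda>b. b * t) ` B. of_rat (u v) * v) = b * t"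
      unfolding b_def by (simp add: sum.reindex[OF inj] sum_distrib_right mult.assoc)
    finally have "a + b * t = 0" using u(2) by simp
    moreover have "a \<in> F" "b \<in> F" using sp[OF a_def] sp[of b "\<lambda>v. u (v * t)"] by (simp_all add: b_def)
    ultimately have "b = 0" using zero by blast
    then have "a = 0" using \<open>a + b * t = 0\<close> by simp
    have ind: "\<And>w. (\<Sum>v\<in>B. of_rat (w v) * v) = 0 \<Longrightarrow> \<forall>v\<in>B. w v = 0"
      using rat_complex.dependent_finite[OF B(4)] B(2) by blast
    have "\<forall>v\<in>B. u v = 0" "\<forall>v\<in>B. u (v * t) = 0"
      using ind[of u] ind[of "\<lambda>v. u (v * t)"] \<open>a = 0\<close> \<open>b = 0\<close> by (simp_all add: a_def b_def)
    then show False using u(1) by auto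
  qed
  have SK: "?S \<subseteq> K" using B(1) assms(3,5) subfieldD(5)[OF subK] by auto
  have card: "card ?S = degree_over_Q K"
    using B(4,5) assms(4) disj inj by (simp add: card_Un_disjoint card_image)
  have "x \<in> rat_complex.span ?S"
  proof (rule ccontr)
    assume n: "x \<notin> rat_complex.span ?S"
    then have i1: "rat_complex.independent (insert x ?S)" using indep by (simp add: rat_complex.independent_insert)
    have i2: "insert x ?S \<subseteq> rat_complex.span C"
      unfolding C(3)[symmetric] using SK assms(7) by (rule insert_subsetI[rotated])
    have "card (insert x ?S) \<le> card C"
      using rat_complex.independent_span_bound[OF C(4) i1 i2] by (rule conjunct2)
    moreover have "x \<notin> ?S" using n rat_complex.span_base[of x ?S] by (rule contrapos_nn)
    ultimately show False using card C(5) B(4) by (simp add: card_insert_if)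
  qed
  then show ?thesis
  proof (induction rule: rat_complex.span_induct_alt)
    case base
    show ?case using subfieldD(1)[OF subF] by (intro bexI[of _ 0]) auto
  next
    case (step c z y)
    then obtain a b where ab: "a \<in> F" "b \<in> F" "y = a + b * t" by blast
    note closed = subfieldD[OF subF] subfield_of_rat[OF subF, of c]
    from step(1) show ?case
    proof
      assume z: "z \<in> B"
      then have "of_rat c * z + a \<in> F" using ab B(1) by (intro closed(3,5,7)) auto
      moreover have "of_rat c * z + y = (of_rat c * z + a) + b * t" by (simp add: ab)
      ultimately show ?thesis using ab by blast
    next
      assume "z \<in> (\<lambda>b. b * t) ` B"
      then obtain v where v: "v \<in> B" "z = v * t" by auto
      then have "of_rat c * v + b \<in> F" using ab B(1) by (intro closed(3,5,7)) auto
      moreover have "of_rat c * z + y = a + (of_rat c * v + b) * t" by (simp add: ab v algebra_simps)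
      ultimately show ?thesis using ab by blast
    qed
  qed
qed

text \<open>\<open>K\<close> is obtained from its totally real subfield by adjoining an element \<open>t\<close> with \<open>t\<^sup>2\<close> in the
  subfield; its images are purely imaginary, so \<open>a + b t \<mapsto> a - b t\<close> is complex conjugation
  under every embedding.\<close>

lemma cm_field_conjugation:
  assumes "cm_field K" "x \<in> K"
  shows "\<exists>y\<in>K. \<forall>\<phi>\<in>embeddings K. \<phi> y = cnj (\<phi> x)"
proof -
  obtain F where F: "F \<subseteq> K" "totally_real F" "degree_over_Q K = 2 * degree_over_Q F"
    and ti: "\<And>\<phi>. \<phi> \<in> embeddings K \<Longrightarrow> \<not> \<phi> ` K \<subseteq> \<real>"
    using assms(1) by (auto simp: cm_field_def totally_imaginary_def)
  have nf: "number_field F" "number_field K"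
    using F(2) cm_field_number_field[OF assms(1)] by (auto simp: totally_real_def)
  note subF = number_field_subfield[OF nf(1)] and subK = number_field_subfield[OF nf(2)]
  have real: "\<phi> a \<in> \<real>" if "\<phi> \<in> embeddings K" "a \<in> F" for \<phi> a
  proof -
    interpret field_embedding K \<phi> using subK that by unfold_locales
    have "restrict \<phi> F \<in> embeddings F"
      using F(1) by (intro restrict_embedding[of F K]) (auto simp: subF add mult)
    then have "restrict \<phi> F ` F \<subseteq> \<real>" using F(2) unfolding totally_real_def by blast
    then show ?thesis using that by auto
  qed
  have "F \<noteq> K"
  proof
    assume "F = K"
    moreover have "restrict id K \<in> embeddings K" using subK by (intro restrict_embedding[of K K]) auto
    ultimately show False using ti real by (metis image_subsetI)
  qed
  then obtain s where s: "s \<in> K" "s \<notin> F" using F(1) by blast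
  note dec = number_field_sum_decomposition[OF nf F(1,3)]
  obtain p q where pq: "p \<in> F" "q \<in> F" "s * s = p + q * s"
    using dec[OF s, of "s * s"] subfieldD(5)[OF subK s(1) s(1)] by blast
  have two: "2 \<in> F" "4 \<in> F" using subfield_of_nat[OF subF, of 2] subfield_of_nat[OF subF, of 4] by simp_all
  \<comment> \<open>Completion of the square in \<open>s * s = p + q * s\<close>; thus
    \<open>t * t\<close> lies in \<open>F\<close>.\<close>
  define t where "t = s - q / 2"
  have q2: "q / 2 \<in> F" using subfieldD(6)[OF subF pq(2) two(1)] .
  have t: "t \<in> K" "t \<notin> F"
  proof -
    show "t \<in> K" using q2 F(1) s subfieldD(4)[OF subK] by (auto simp: t_def)
    show "t \<notin> F"
    proof
      assume "t \<in> F"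
      then have "t + q / 2 \<in> F" using q2 subfieldD(3)[OF subF] by blast
      then show False using s by (simp add: t_def)
    qed
  qed
  have "t * t = p + (q / 2) * (q / 2)" using pq(3) by (simp add: t_def algebra_simps)
  then have tt: "t * t \<in> F" 
    using subfieldD(3)[OF subF pq(1) subfieldD(5)[OF subF q2 q2]] by (simp only:)
  obtain a b where ab: "a \<in> F" "b \<in> F" "x = a + b * t" using dec[OF t assms(2)] by blast
  have "\<phi> (a - b * t) = cnj (\<phi> x)" if phi: "\<phi> \<in> embeddings K" for \<phi>
  proof -
    interpret field_embedding K \<phi> using subK phi by unfold_locales
    have "a \<in> K" "b \<in> K" using ab F(1) by auto
    then have 1: "\<phi> (a' + b' * t) = \<phi> a' + \<phi> b' * \<phi> t" "\<phi> (a' - b' * t) = \<phi> a' - \<phi> b' * \<phi> t"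
      if "a' \<in> F" "b' \<in> F" for a' b'
      using that F(1) t subfieldD(5)[OF subK] by (auto simp: add diff mult subsetD)
    have "\<phi> t * \<phi> t \<in> \<real>" using real[OF phi tt] mult[OF t(1) t(1)] by simp
    then have im: "Im (\<phi> t * \<phi> t) = 0" by (simp add: complex_is_Real_iff)
    \<comment> \<open>A real value would make the image of all of \<open>K\<close> real, as
      \<open>K = F + F t\<close>. A non-real number with real square has real part zero.\<close>
    have "\<phi> t \<notin> \<real>"
    proof
      assume r: "\<phi> t \<in> \<real>"
      have "\<phi> z \<in> \<real>" if z: "z \<in> K" for z
      proof -
        obtain a' b' where ab': "a' \<in> F" "b' \<in> F" "z = a' + b' * t" using dec[OF t z] by blast
        then show ?thesis using 1 r real[OF phi] by (auto intro!: Reals_add Reals_mult)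
      qed
      then show False using ti[OF phi] by blast
    qed
    then have "Re (\<phi> t) = 0" using im by (auto simp: complex_is_Real_iff)
    then have c: "cnj (\<phi> t) = - \<phi> t" by (simp add: complex_eq_iff)
    have "cnj (\<phi> a) = \<phi> a" "cnj (\<phi> b) = \<phi> b" using real[OF phi] ab Reals_cnj_iff by auto
    then show ?thesis using 1 ab c by simp
  qed
  moreover have "a - b * t \<in> K" using ab F(1) t subfieldD(4,5)[OF subK] by (auto simp: subsetD)
  ultimately show ?thesis by blast
qed

lemma (in galois_number_field) cnj_Gal:
  obtains \<rho> where "\<rho> \<in> carrier G" "\<And>x. x \<in> L \<Longrightarrow> \<rho> x = cnj x"
proof -
  have "restrict cnj L \<in> embeddings L" using L_subfield by (intro restrict_embedding[of L UNIV]) auto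
  then obtain \<rho> where "\<rho> \<in> carrier G" "\<forall>x\<in>L. restrict cnj L x = \<rho> x"
    using embedding_extends[OF L_number_field subset_refl] by blast
  then show ?thesis using that by simp
qed

lemma (in galois_number_field) cnj_closed: "x \<in> L \<Longrightarrow> cnj x \<in> L"
  using cnj_Gal Gal_closed by metis

locale cm_reflex = galois_number_field +
  fixes K :: "complex set" and \<Phi> :: "(complex \<Rightarrow> complex) set"
  assumes cm: "cm_field K" and type: "cm_type K \<Phi>" and K_L: "K \<subseteq> L"
begin

lemmas K_number_field = cm_field_number_field[OF cm]
lemmas K_subfield = number_field_subfield[OF K_number_field]

lemma type_embeddings: "\<phi> \<in> \<Phi> \<Longrightarrow> \<phi> \<in> embeddings K"
  using type by (auto simp: cm_type_def)

lemma type_field_embedding: "\<phi> \<in> \<Phi> \<Longrightarrow> field_embedding K \<phi>"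
  using type_embeddings K_subfield by unfold_locales

lemma finite_type: "finite \<Phi>"
  using type finite_embeddings[OF K_number_field] by (metis cm_type_def finite_Un)

lemma type_closed: "\<phi> \<in> \<Phi> \<Longrightarrow> x \<in> K \<Longrightarrow> \<phi> x \<in> L"
  using embedding_range[OF K_number_field K_L] type_embeddings by blast

text \<open>Conjugation need not be central in the Galois group, as L is an arbitrary Galois
  extension containing K. On conjugates of K it does commute: there is one y in K whose image under
  every embedding is the conjugate of that of x, and \<tau> after \<phi> is again an
  embedding.\<close>

lemma Gal_cnj:
  assumes "\<tau> \<in> carrier G" "\<phi> \<in> embeddings K" "x \<in> K"
  shows "\<tau> (cnj (\<phi> x)) = cnj (\<tau> (\<phi> x))"
proof -
  obtain y where y: "y \<in> K" "\<And>\<phi>. \<phi> \<in> embeddings K \<Longrightarrow> \<phi> y = cnj (\<phi> x)"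
    using cm_field_conjugation[OF cm assms(3)] by blast
  have "(\<lambda>x\<in>K. \<tau> (\<phi> x)) y = cnj ((\<lambda>x\<in>K. \<tau> (\<phi> x)) x)"
    by (rule y(2)[OF Gal_comp_embedding[OF K_number_field K_L assms(2,1)]])
  then show ?thesis using y assms by simp
qed

text \<open>\<open>cm_type\<close> prescribes the number of members and the union with the
  conjugates. An overlap would leave fewer than \<open>degree_over_Q K\<close> embeddings, against
  \<open>degree_le_card_embeddings\<close>.\<close>

lemma type_conj_disjoint: "\<Phi> \<inter> (\<lambda>\<phi>. \<lambda>x\<in>K. cnj (\<phi> x)) ` \<Phi> = {}"
proof (rule ccontr)
  let ?c = "\<lambda>\<phi>. \<lambda>x\<in>K. cnj (\<phi> x)"
  assume ne: "\<Phi> \<inter> ?c ` \<Phi> \<noteq> {}"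
  have "card (\<Phi> \<union> ?c ` \<Phi>) + card (\<Phi> \<inter> ?c ` \<Phi>) = card \<Phi> + card (?c ` \<Phi>)"
    using finite_type by (intro card_Un_Int[symmetric]) auto
  moreover have "card (\<Phi> \<inter> ?c ` \<Phi>) > 0" using ne finite_type by (simp add: card_gt_0_iff)
  moreover have "card (?c ` \<Phi>) \<le> card \<Phi>" using finite_type by (rule card_image_le)
  moreover have "2 * card \<Phi> \<le> card (\<Phi> \<union> ?c ` \<Phi>)"
    using type degree_le_card_embeddings[OF K_number_field K_L] by (simp add: cm_type_def)
  ultimately show False by linarith
qed

section \<open>The reflex norm of elements\<close>

definition reflex_norm :: "complex \<Rightarrow> complex" where
  "reflex_norm x = (\<Prod>\<phi>\<in>\<Phi>. \<phi> x)"

lemma reflex_norm_mult: "x \<in> K \<Longrightarrow> y \<in> K \<Longrightarrow> reflex_norm (x * y) = reflex_norm x * reflex_norm y"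
  unfolding reflex_norm_def using type_field_embedding
  by (subst prod.distrib[symmetric]) (auto intro!: prod.cong simp: field_embedding.mult[OF type_field_embedding])

lemma reflex_norm_divide: "x \<in> K \<Longrightarrow> y \<in> K \<Longrightarrow> reflex_norm (x / y) = reflex_norm x / reflex_norm y"
  unfolding reflex_norm_def using type_field_embedding
  by (subst prod_dividef[symmetric]) (auto intro!: prod.cong simp: field_embedding.divide[OF type_field_embedding])

lemma reflex_norm_nonzero: "x \<in> K \<Longrightarrow> x \<noteq> 0 \<Longrightarrow> reflex_norm x \<noteq> 0"
  unfolding reflex_norm_def using finite_type type_field_embedding
  by (auto simp: field_embedding.nonzero[OF type_field_embedding])

lemma reflex_norm_L: "x \<in> K \<Longrightarrow> reflex_norm x \<in> L"
  unfolding reflex_norm_def using type_closed by (intro subfield_prod[OF L_subfield])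

text \<open>The type and its conjugate partition the embeddings, so the right-hand side, the norm of
  x from K to Q, splits accordingly.\<close>

lemma reflex_norm_mult_cnj:
  assumes "x \<in> K"
  shows "reflex_norm x * cnj (reflex_norm x) = (\<Prod>\<eta>\<in>embeddings K. \<eta> x)"
proof -
  let ?c = "\<lambda>\<phi>. \<lambda>x\<in>K. cnj (\<phi> x)"
  have "inj_on ?c \<Phi>"
  proof (rule inj_onI)
    fix \<phi> \<phi>' assume p: "\<phi> \<in> \<Phi>" "\<phi>' \<in> \<Phi>" "?c \<phi> = ?c \<phi>'"
    have "\<phi> y = \<phi>' y" if "y \<in> K" for y using fun_cong[OF p(3), of y] that by simp
    then show "\<phi> = \<phi>'" using p type_embeddings by (intro embeddings_eqI) auto
  qed
  then have "(\<Prod>\<eta>\<in>?c ` \<Phi>. \<eta> x) = (\<Prod>\<phi>\<in>\<Phi>. cnj (\<phi> x))" using assms by (simp add: prod.reindex)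
  moreover have "(\<Prod>\<eta>\<in>\<Phi> \<union> ?c ` \<Phi>. \<eta> x) = (\<Prod>\<eta>\<in>\<Phi>. \<eta> x) * (\<Prod>\<eta>\<in>?c ` \<Phi>. \<eta> x)"
    using finite_type type_conj_disjoint by (intro prod.union_disjoint) auto
  moreover have "\<Phi> \<union> ?c ` \<Phi> = embeddings K" using type by (simp add: cm_type_def)
  ultimately show ?thesis by (simp add: reflex_norm_def)
qed

lemma reflex_norm_mult_cnj_Rats:
  assumes "x \<in> K"
  shows "reflex_norm x * cnj (reflex_norm x) \<in> \<rat>"
proof (rule fixed_Rats)
  show "reflex_norm x * cnj (reflex_norm x) \<in> L"
    using reflex_norm_L[OF assms] cnj_closed subfieldD(5)[OF L_subfield] by blast
  fix \<sigma> assume s: "\<sigma> \<in> carrier G"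
  interpret field_embedding L \<sigma> using Gal_field_embedding s by blast
  have "\<sigma> (\<Prod>\<eta>\<in>embeddings K. \<eta> x) = (\<Prod>\<eta>\<in>embeddings K. (\<lambda>x\<in>K. \<sigma> (\<eta> x)) x)"
    using embedding_range[OF K_number_field K_L] assms by (subst prod) auto
  also have "\<dots> = (\<Prod>\<eta>\<in>embeddings K. \<eta> x)"
    by (rule prod.reindex_bij_betw[OF Gal_comp_bij[OF K_number_field K_L s]])
  finally show "\<sigma> (reflex_norm x * cnj (reflex_norm x)) = reflex_norm x * cnj (reflex_norm x)"
    using assms by (simp add: reflex_norm_mult_cnj)
qed

text \<open>The number is the squared modulus of a nonzero element, hence positive. Natural
  numerator and denominator fit the multiples by natural numbers in the index computations.\<close>

lemma reflex_norm_mult_cnj_pos: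
  assumes "x \<in> K" "x \<noteq> 0"
  obtains p q :: nat where "0 < p" "0 < q" "reflex_norm x * cnj (reflex_norm x) = of_nat p / of_nat q"
proof -
  from reflex_norm_mult_cnj_Rats[OF assms(1)] obtain a b where
    ab: "b > 0" "reflex_norm x * cnj (reflex_norm x) = of_int a / of_int b"
    by (elim Rats_cases') blast
  have "complex_of_real ((cmod (reflex_norm x))\<^sup>2) = complex_of_real (of_int a / of_int b)"
    unfolding complex_norm_square ab(2) by simp
  then have eq: "(cmod (reflex_norm x))\<^sup>2 = of_int a / of_int b" unfolding of_real_eq_iff .
  moreover have "(cmod (reflex_norm x))\<^sup>2 > 0" using reflex_norm_nonzero[OF assms] by simp
  ultimately have pos: "real_of_int a / of_int b > 0" by simp
  then have abs: "real_of_int a / of_int b = real (nat \<bar>a\<bar>) / real (nat \<bar>b\<bar>)"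
    by (auto simp: zero_less_divide_iff)
  have "reflex_norm x * cnj (reflex_norm x) = complex_of_real (real (nat \<bar>a\<bar>) / real (nat \<bar>b\<bar>))"
    unfolding ab(2) abs[symmetric] by simp
  then have "reflex_norm x * cnj (reflex_norm x) = of_nat (nat \<bar>a\<bar>) / of_nat (nat \<bar>b\<bar>)"
    by (simp only: of_real_divide of_real_of_nat_eq)
  moreover have "0 < nat \<bar>a\<bar>" "0 < nat \<bar>b\<bar>" using pos ab(1) by auto
  ultimately show ?thesis by (intro that)
qed

section \<open>The reflex group and the reflex field\<close>

lemma type_lift:
  assumes "\<phi> \<in> \<Phi>"
  obtains \<sigma> where "\<sigma> \<in> type_lifts L K \<Phi>" "\<And>x. x \<in> K \<Longrightarrow> \<phi> x = \<sigma> x" "restrict \<sigma> K = \<phi>"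
proof -
  obtain \<sigma> where s: "\<sigma> \<in> carrier G" "\<forall>x\<in>K. \<phi> x = \<sigma> x"
    using embedding_extends[OF K_number_field K_L type_embeddings[OF assms]] by blast
  have "\<phi> \<in> extensional K" using type_embeddings[OF assms] by (simp add: embeddings_def)
  then have "restrict \<sigma> K = \<phi>" using s by (intro extensionalityI[of _ K]) auto
  then show ?thesis using that s assms by (auto simp: type_lifts_def)
qed

lemma type_lifts_Gal: "\<sigma> \<in> type_lifts L K \<Phi> \<Longrightarrow> \<sigma> \<in> carrier G"
  by (simp add: type_lifts_def)

lemma reflex_group_Gal: "\<gamma> \<in> reflex_group L K \<Phi> \<Longrightarrow> \<gamma> \<in> carrier G"
  by (simp add: reflex_group_def)

lemma restrict_mult: "restrict (\<sigma> \<otimes>\<^bsub>G\<^esub> \<gamma>) K = (\<lambda>x\<in>K. \<gamma> (restrict \<sigma> K x))"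
  using K_L by (intro restrict_ext) (simp add: Gal_mult_apply subsetD)

text \<open>The defining condition concerns left translates of the inverses of lifts. Inverting it
  shows that right multiplication by \<gamma> preserves the lifts themselves; in the right action
  this means applying \<gamma> after \<phi>.\<close>

lemma reflex_group_type:
  assumes "\<gamma> \<in> reflex_group L K \<Phi>" "\<phi> \<in> \<Phi>"
  shows "(\<lambda>x\<in>K. \<gamma> (\<phi> x)) \<in> \<Phi>"
proof -
  note g = reflex_group_Gal[OF assms(1)]
  obtain \<sigma> where s: "\<sigma> \<in> type_lifts L K \<Phi>" "restrict \<sigma> K = \<phi>"
    using type_lift[OF assms(2)] by metis
  note sG = type_lifts_Gal[OF s(1)]
  have "inv\<^bsub>G\<^esub> \<sigma> \<in> l_coset G \<gamma> (inv_type_lifts L K \<Phi>)"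
    using assms(1) s(1) by (simp add: reflex_group_def inv_type_lifts_def)
  then obtain \<sigma>' where s': "\<sigma>' \<in> type_lifts L K \<Phi>" "inv\<^bsub>G\<^esub> \<sigma> = \<gamma> \<otimes>\<^bsub>G\<^esub> inv\<^bsub>G\<^esub> \<sigma>'"
    by (auto simp: l_coset_def inv_type_lifts_def)
  note s'G = type_lifts_Gal[OF s'(1)]
  have "\<sigma> \<otimes>\<^bsub>G\<^esub> \<gamma> = \<sigma> \<otimes>\<^bsub>G\<^esub> (inv\<^bsub>G\<^esub> \<sigma> \<otimes>\<^bsub>G\<^esub> \<sigma>')"
    unfolding s'(2) using g s'G by (simp add: G.m_assoc)
  also have "\<dots> = \<sigma>'" using sG s'G by (simp flip: G.m_assoc)
  finally have "restrict (\<sigma> \<otimes>\<^bsub>G\<^esub> \<gamma>) K \<in> \<Phi>" using s'(1) by (simp add: type_lifts_def)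
  then show ?thesis unfolding restrict_mult s(2) .
qed

text \<open>An injective self-map of the finite set of lifts is surjective, so preservation in one
  direction already gives equality with the coset. This criterion recognizes conjugates of reflex
  group elements in \<open>reflex_field_cnj\<close>.\<close>

lemma reflex_groupI:
  assumes "\<gamma> \<in> carrier G" "\<And>\<phi>. \<phi> \<in> \<Phi> \<Longrightarrow> (\<lambda>x\<in>K. \<gamma> (\<phi> x)) \<in> \<Phi>"
  shows "\<gamma> \<in> reflex_group L K \<Phi>"
proof -
  define S where "S = type_lifts L K \<Phi>"
  have SG: "S \<subseteq> carrier G" by (auto simp: S_def type_lifts_Gal)
  have sub: "\<sigma> \<otimes>\<^bsub>G\<^esub> \<gamma> \<in> S" if "\<sigma> \<in> S" for \<sigma>
  proof -
    have "restrict \<sigma> K \<in> \<Phi>" "\<sigma> \<in> carrier G" using that by (auto simp: S_def type_lifts_def)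
    then have "restrict (\<sigma> \<otimes>\<^bsub>G\<^esub> \<gamma>) K \<in> \<Phi>" "\<sigma> \<otimes>\<^bsub>G\<^esub> \<gamma> \<in> carrier G"
      unfolding restrict_mult using assms by blast+
    then show ?thesis by (simp add: S_def type_lifts_def)
  qed
  have "inj_on (\<lambda>\<sigma>. \<sigma> \<otimes>\<^bsub>G\<^esub> \<gamma>) S"
    using Gal_mult_bij[OF assms(1)] SG inj_on_subset by (auto simp: bij_betw_def)
  moreover have "finite S" using SG finite_Gal finite_subset by blast
  ultimately have surj: "(\<lambda>\<sigma>. \<sigma> \<otimes>\<^bsub>G\<^esub> \<gamma>) ` S = S" using sub by (intro endo_inj_surj) auto
  have "l_coset G \<gamma> (inv_type_lifts L K \<Phi>) = inv_type_lifts L K \<Phi>"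
  proof (intro equalityI subsetI)
    fix x assume "x \<in> l_coset G \<gamma> (inv_type_lifts L K \<Phi>)"
    then obtain \<sigma> where s: "\<sigma> \<in> S" "x = \<gamma> \<otimes>\<^bsub>G\<^esub> inv\<^bsub>G\<^esub> \<sigma>"
      by (auto simp: l_coset_def inv_type_lifts_def S_def)
    obtain \<sigma>' where s': "\<sigma>' \<in> S" "\<sigma> = \<sigma>' \<otimes>\<^bsub>G\<^esub> \<gamma>" using s(1) surj by blast
    have "x = inv\<^bsub>G\<^esub> \<sigma>'"
      unfolding s(2) s'(2) using s'(1) SG assms(1) by (simp add: G.inv_mult_group subsetD flip: G.m_assoc)
    then show "x \<in> inv_type_lifts L K \<Phi>" using s' by (auto simp: inv_type_lifts_def S_def)
  next
    fix x assume "x \<in> inv_type_lifts L K \<Phi>"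
    then obtain \<sigma> where s: "\<sigma> \<in> S" "x = inv\<^bsub>G\<^esub> \<sigma>" by (auto simp: inv_type_lifts_def S_def)
    have "x = \<gamma> \<otimes>\<^bsub>G\<^esub> inv\<^bsub>G\<^esub> (\<sigma> \<otimes>\<^bsub>G\<^esub> \<gamma>)"
      unfolding s(2) using s(1) SG assms(1) by (simp add: G.inv_mult_group subsetD flip: G.m_assoc)
    then show "x \<in> l_coset G \<gamma> (inv_type_lifts L K \<Phi>)"
      using sub[OF s(1)] unfolding l_coset_def inv_type_lifts_def S_def by blast
  qed
  then show ?thesis using assms(1) by (simp add: reflex_group_def)
qed

lemma reflex_norm_reflex_field:
  assumes "x \<in> K" shows "reflex_norm x \<in> reflex_field L K \<Phi>"
  unfolding reflex_field_def fixed_field_def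
proof (clarify, intro conjI ballI)
  show "reflex_norm x \<in> L" using reflex_norm_L[OF assms] .
  fix \<gamma> assume g: "\<gamma> \<in> reflex_group L K \<Phi>"
  interpret field_embedding L \<gamma> using Gal_field_embedding reflex_group_Gal[OF g] by blast
  let ?\<pi> = "\<lambda>\<phi>. \<lambda>x\<in>K. \<gamma> (\<phi> x)"
  have inj: "inj_on ?\<pi> \<Phi>"
    using Gal_comp_bij[OF K_number_field K_L reflex_group_Gal[OF g]] type_embeddings
    by (auto simp: bij_betw_def intro: inj_on_subset)
  moreover have "?\<pi> ` \<Phi> = \<Phi>" using reflex_group_type[OF g] finite_type inj by (intro endo_inj_surj) auto
  ultimately have bij: "bij_betw ?\<pi> \<Phi> \<Phi>" by (simp add: bij_betw_def)
  have "\<gamma> (reflex_norm x) = (\<Prod>\<phi>\<in>\<Phi>. ?\<pi> \<phi> x)"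
    unfolding reflex_norm_def using type_closed assms by (subst prod) auto
  also have "\<dots> = reflex_norm x" unfolding reflex_norm_def by (rule prod.reindex_bij_betw[OF bij])
  finally show "\<gamma> (reflex_norm x) = reflex_norm x" .
qed

text \<open>Conjugating \<gamma> by complex conjugation does not change its action on the images of
  \<open>K\<close> under the type, by \<open>Gal_cnj\<close>; so \<delta> is again in the reflex
  group and fixes x. Rewritten for \<gamma>, this is invariance of \<open>cnj x\<close>.\<close>

lemma reflex_field_cnj:
  assumes "x \<in> reflex_field L K \<Phi>" shows "cnj x \<in> reflex_field L K \<Phi>"
  unfolding reflex_field_def fixed_field_def
proof (clarify, intro conjI ballI)
  have x: "x \<in> L" using assms by (simp add: reflex_field_def fixed_field_def)
  then show "cnj x \<in> L" by (rule cnj_closed)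
  fix \<gamma> assume g: "\<gamma> \<in> reflex_group L K \<Phi>"
  note gG = reflex_group_Gal[OF g]
  obtain \<rho> where r: "\<rho> \<in> carrier G" "\<And>x. x \<in> L \<Longrightarrow> \<rho> x = cnj x" using cnj_Gal by blast
  define \<delta> where "\<delta> = \<rho> \<otimes>\<^bsub>G\<^esub> \<gamma> \<otimes>\<^bsub>G\<^esub> \<rho>"
  have d: "\<delta> z = cnj (\<gamma> (cnj z))" if "z \<in> L" for z
    using that r(2) cnj_closed Gal_closed[OF gG] by (simp add: \<delta>_def Gal_mult_apply)
  have "\<delta> \<in> reflex_group L K \<Phi>"
  proof (rule reflex_groupI)
    show "\<delta> \<in> carrier G" using r gG by (simp add: \<delta>_def)
    fix \<phi> assume p: "\<phi> \<in> \<Phi>"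
    have "(\<lambda>x\<in>K. \<delta> (\<phi> x)) = (\<lambda>x\<in>K. \<gamma> (\<phi> x))"
      by (rule restrict_ext) (simp add: d type_closed p Gal_cnj[OF gG type_embeddings[OF p]])
    then show "(\<lambda>x\<in>K. \<delta> (\<phi> x)) \<in> \<Phi>" using reflex_group_type[OF g p] by simp
  qed
  then have "\<delta> x = x" using assms by (simp add: reflex_field_def fixed_field_def)
  then show "\<gamma> (cnj x) = cnj x" using d[OF x] by (metis complex_cnj_cnj)
qed

lemma reflex_type_lift:
  assumes "\<psi> \<in> reflex_type L K \<Phi>"
  obtains \<tau> where "\<tau> \<in> carrier G" "\<psi> = restrict \<tau> (reflex_field L K \<Phi>)"
  using assms type_lifts_Gal by (auto simp: reflex_type_def inv_type_lifts_def)

text \<open>A lift \<tau> of \<psi> commutes with conjugation on each factor \<phi> x, hence on the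
  product; the norm of x is rational and so fixed by \<tau>. Thus every \<psi> gives the reflex norm
  the same modulus.\<close>

lemma reflex_type_norm:
  assumes "\<psi> \<in> reflex_type L K \<Phi>" "x \<in> K"
  shows "\<psi> (reflex_norm x) * cnj (\<psi> (reflex_norm x)) = reflex_norm x * cnj (reflex_norm x)"
proof -
  obtain \<tau> where t: "\<tau> \<in> carrier G" "\<psi> = restrict \<tau> (reflex_field L K \<Phi>)"
    using reflex_type_lift[OF assms(1)] .
  interpret field_embedding L \<tau> using Gal_field_embedding t by blast
  have ps: "\<psi> (reflex_norm x) = \<tau> (reflex_norm x)" using t reflex_norm_reflex_field[OF assms(2)] by simp
  have 1: "cnj (\<tau> (reflex_norm x)) = \<tau> (cnj (reflex_norm x))"
  proof -
    have "cnj (\<tau> (reflex_norm x)) = (\<Prod>\<phi>\<in>\<Phi>. cnj (\<tau> (\<phi> x)))"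
      unfolding reflex_norm_def using type_closed assms(2) by (subst prod) auto
    also have "\<dots> = (\<Prod>\<phi>\<in>\<Phi>. \<tau> (cnj (\<phi> x)))"
      using Gal_cnj[OF t(1) type_embeddings assms(2)] by simp
    also have "\<dots> = \<tau> (cnj (reflex_norm x))"
      unfolding reflex_norm_def using type_closed assms(2) cnj_closed by (simp add: prod)
    finally show ?thesis .
  qed
  have "\<tau> (reflex_norm x) * \<tau> (cnj (reflex_norm x)) = \<tau> (reflex_norm x * cnj (reflex_norm x))"
    using reflex_norm_L[OF assms(2)] cnj_closed by (simp add: mult)
  also have "\<dots> = reflex_norm x * cnj (reflex_norm x)"
    using reflex_norm_mult_cnj_Rats[OF assms(2)] by (rule of_Rats)
  finally show ?thesis unfolding ps 1 .
qed

lemma type_fixed_field_lifts: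
  assumes "x \<in> type_fixed_field L K \<Phi>" "\<sigma> \<in> type_lifts L K \<Phi>"
  shows "\<sigma> x = x" "x \<in> L"
  using assms by (auto simp: type_fixed_field_def fixed_field_def intro: generate.incl)

lemma type_nonempty: "\<Phi> \<noteq> {}"
proof
  assume "\<Phi> = {}"
  then have "embeddings K = {}" using type by (auto simp: cm_type_def)
  moreover have "restrict id K \<in> embeddings K" using K_subfield by (intro restrict_embedding[of K K]) auto
  ultimately show False by simp
qed

text \<open>For a lift \<sigma>, an element \<gamma> of the reflex group times the inverse of
  \<sigma> is the inverse of another lift; multiplying by \<sigma> again exhibits \<gamma> in the
  group generated by the lifts. The smaller group has the larger fixed field.\<close>

lemma type_fixed_field_reflex_field: "type_fixed_field L K \<Phi> \<subseteq> reflex_field L K \<Phi>"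
proof
  fix x assume x: "x \<in> type_fixed_field L K \<Phi>"
  let ?S = "type_lifts L K \<Phi>"
  obtain \<sigma> where s: "\<sigma> \<in> ?S" using type_nonempty type_lift by (metis ex_in_conv)
  show "x \<in> reflex_field L K \<Phi>"
    unfolding reflex_field_def fixed_field_def
  proof (clarify, intro conjI ballI)
    show "x \<in> L" using x s type_fixed_field_lifts by blast
    fix \<gamma> assume g: "\<gamma> \<in> reflex_group L K \<Phi>"
    have "\<gamma> \<otimes>\<^bsub>G\<^esub> inv\<^bsub>G\<^esub> \<sigma> \<in> l_coset G \<gamma> (inv_type_lifts L K \<Phi>)"
      using s by (auto simp: l_coset_def inv_type_lifts_def)
    also have "\<dots> = inv_type_lifts L K \<Phi>" using g by (simp add: reflex_group_def)
    finally obtain \<sigma>' where s': "\<sigma>' \<in> ?S" "\<gamma> \<otimes>\<^bsub>G\<^esub> inv\<^bsub>G\<^esub> \<sigma> = inv\<^bsub>G\<^esub> \<sigma>'"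
      by (auto simp: inv_type_lifts_def)
    have "\<gamma> = (\<gamma> \<otimes>\<^bsub>G\<^esub> inv\<^bsub>G\<^esub> \<sigma>) \<otimes>\<^bsub>G\<^esub> \<sigma>"
      using reflex_group_Gal[OF g] type_lifts_Gal[OF s] by (simp add: G.m_assoc)
    then have "\<gamma> \<in> generate G ?S"
      unfolding s'(2) using s s'(1) by (metis generate.eng generate.incl generate.inv)
    then show "\<gamma> x = x" using x by (simp add: type_fixed_field_def fixed_field_def)
  qed
qed

end

section \<open>Ideals\<close>

lemma embedding_algebraic_int:
  assumes "complex_subfield F" "\<sigma> \<in> embeddings F" "x \<in> F" "algebraic_int x"
  shows "algebraic_int (\<sigma> x)"
proof -
  interpret field_embedding F \<sigma> using assms by unfold_locales
  obtain p where p: "lead_coeff p = 1" "\<forall>i. coeff p i \<in> \<int>" "poly p x = 0"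
    using assms(4) by (auto simp: algebraic_int.simps)
  have rat: "coeff p i \<in> \<rat>" for i using p(2) Ints_subset_Rats by blast
  have "map_poly \<sigma> p = p" by (rule poly_eqI) (simp add: coeff_map_poly of_Rats rat)
  moreover have "\<sigma> (poly p x) = poly (map_poly \<sigma> p) (\<sigma> x)"
    using rat subfield_Rats[OF assms(1)] assms(3) by (intro poly_eval) auto
  ultimately have "poly p (\<sigma> x) = 0" using p(3) by simp
  then show ?thesis using p(1,2) by (rule algebraic_int.intros[rotated 2])
qed

lemma span_scale_image: "int_complex.span ((\<lambda>x. c * x) ` S) = (\<lambda>x. c * x) ` int_complex.span S"
proof (rule antisym)
  show "int_complex.span ((\<lambda>x. c * x) ` S) \<subseteq> (\<lambda>x. c * x) ` int_complex.span S"
    using int_complex.span_superset subspace_scale_image[OF int_complex.subspace_span]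
    by (intro int_complex.span_minimal) blast+
  show "(\<lambda>x. c * x) ` int_complex.span S \<subseteq> int_complex.span ((\<lambda>x. c * x) ` S)"
    using mult_span_closed[of S c "(\<lambda>x. c * x) ` S"] int_complex.span_base by blast
qed

lemma ideal_multI: "x \<in> I \<Longrightarrow> y \<in> J \<Longrightarrow> x * y \<in> ideal_mult I J"
  unfolding ideal_mult_def by (rule int_complex.span_base) blast

lemma ideal_mult_subspace: "int_complex.subspace (ideal_mult I J)"
  unfolding ideal_mult_def by (rule int_complex.subspace_span)

lemma ideal_mult_subset:
  assumes "int_complex.subspace A" "\<And>x y. x \<in> I \<Longrightarrow> y \<in> J \<Longrightarrow> x * y \<in> A"
  shows "ideal_mult I J \<subseteq> A"
  unfolding ideal_mult_def using assms by (intro int_complex.span_minimal) auto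

lemma mult_ideal_mult:
  assumes "\<And>x y. x \<in> I \<Longrightarrow> y \<in> J \<Longrightarrow> c * (x * y) \<in> A" "int_complex.subspace A" "z \<in> ideal_mult I J"
  shows "c * z \<in> A"
proof -
  have "A = int_complex.span A" using assms(2) by (metis int_complex.span_eq_iff)
  then show ?thesis using mult_span_closed[of "{x * y | x y. x \<in> I \<and> y \<in> J}" c A z] assms
    unfolding ideal_mult_def by auto
qed

lemma ideal_mult_scale: "ideal_mult ((\<lambda>x. c * x) ` I) J = (\<lambda>x. c * x) ` ideal_mult I J"
proof -
  have "{x * y | x y. x \<in> (\<lambda>x. c * x) ` I \<and> y \<in> J} = (\<lambda>x. c * x) ` {x * y | x y. x \<in> I \<and> y \<in> J}"
    by (auto simp: image_def) (metis mult.assoc)+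
  then show ?thesis unfolding ideal_mult_def by (simp only: span_scale_image)
qed

lemma ideal_mult_commute: "ideal_mult I J = ideal_mult J I"
  unfolding ideal_mult_def by (rule arg_cong[of _ _ int_complex.span]) (auto, (metis mult.commute)+)

lemma ideal_mult_scale_right: "ideal_mult I ((\<lambda>x. c * x) ` J) = (\<lambda>x. c * x) ` ideal_mult I J"
  by (subst (1 2) ideal_mult_commute) (rule ideal_mult_scale)

lemma ideal_ext_scale: "ideal_ext F ((\<lambda>x. c * x) ` I) = (\<lambda>x. c * x) ` ideal_ext F I"
  unfolding ideal_ext_def by (rule ideal_mult_scale)

lemma ideal_prod_scale:
  assumes "finite A"
  shows "ideal_prod A (\<lambda>i. (\<lambda>x. c i * x) ` J i) = (\<lambda>x. (\<Prod>i\<in>A. c i) * x) ` ideal_prod A J"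
proof -
  have "{\<Prod>i\<in>A. x i | x. \<forall>i\<in>A. x i \<in> (\<lambda>x. c i * x) ` J i} =
    (\<lambda>x. (\<Prod>i\<in>A. c i) * x) ` {\<Prod>i\<in>A. x i | x. \<forall>i\<in>A. x i \<in> J i}"
  proof (intro equalityI subsetI)
    fix z assume "z \<in> {\<Prod>i\<in>A. x i | x. \<forall>i\<in>A. x i \<in> (\<lambda>x. c i * x) ` J i}"
    then obtain x where x: "z = (\<Prod>i\<in>A. x i)" "\<forall>i\<in>A. x i \<in> (\<lambda>x. c i * x) ` J i" by blast
    then have "\<forall>i\<in>A. \<exists>y. y \<in> J i \<and> x i = c i * y" by blast
    then obtain y where y: "\<forall>i\<in>A. y i \<in> J i \<and> x i = c i * y i" by metis
    then have "z = (\<Prod>i\<in>A. c i) * (\<Prod>i\<in>A. y i)" by (simp add: x(1) prod.distrib)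
    then show "z \<in> (\<lambda>x. (\<Prod>i\<in>A. c i) * x) ` {\<Prod>i\<in>A. x i | x. \<forall>i\<in>A. x i \<in> J i}" using y by blast
  next
    fix z assume "z \<in> (\<lambda>x. (\<Prod>i\<in>A. c i) * x) ` {\<Prod>i\<in>A. x i | x. \<forall>i\<in>A. x i \<in> J i}"
    then obtain y where y: "z = (\<Prod>i\<in>A. c i) * (\<Prod>i\<in>A. y i)" "\<forall>i\<in>A. y i \<in> J i" by auto
    then have "z = (\<Prod>i\<in>A. c i * y i)" by (simp add: prod.distrib)
    then show "z \<in> {\<Prod>i\<in>A. x i | x. \<forall>i\<in>A. x i \<in> (\<lambda>x. c i * x) ` J i}" using y(2) by blast
  qed
  then show ?thesis unfolding ideal_prod_def by (simp only: span_scale_image)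
qed

section \<open>Rings of integers and fractional ideals\<close>

lemma int_ring_closed:
  assumes "complex_subfield F"
  shows "0 \<in> int_ring F" "1 \<in> int_ring F" "x \<in> int_ring F \<Longrightarrow> y \<in> int_ring F \<Longrightarrow> x + y \<in> int_ring F"
    "x \<in> int_ring F \<Longrightarrow> y \<in> int_ring F \<Longrightarrow> x - y \<in> int_ring F"
    "x \<in> int_ring F \<Longrightarrow> y \<in> int_ring F \<Longrightarrow> x * y \<in> int_ring F" "of_int k \<in> int_ring F" "of_nat n \<in> int_ring F"
  using subfieldD[OF assms] subfield_of_int[OF assms] subfield_of_nat[OF assms]
  by (auto simp: int_ring_def intro: algebraic_int_add algebraic_int_diff algebraic_int_mult)

lemma int_ring_subspace: "complex_subfield F \<Longrightarrow> int_complex.subspace (int_ring F)"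
  by (auto intro!: int_complex.subspaceI simp: int_ring_closed)

lemma int_ring_subset: "int_ring F \<subseteq> F"
  by (auto simp: int_ring_def)

lemma frac_ideal_subspace:
  assumes "complex_subfield F" "frac_ideal F I"
  shows "int_complex.subspace I"
  using assms(2) int_ring_closed(6)[OF assms(1)]
  by (intro int_complex.subspaceI) (auto simp: frac_ideal_def)

lemma frac_ideal_mult: "frac_ideal F I \<Longrightarrow> a \<in> int_ring F \<Longrightarrow> x \<in> I \<Longrightarrow> a * x \<in> I"
  by (simp add: frac_ideal_def)

lemma frac_ideal_subset: "frac_ideal F I \<Longrightarrow> I \<subseteq> F"
  by (simp add: frac_ideal_def)

lemma ideal_mult_int_ring_closed:
  assumes "complex_subfield F" "\<And>a x. a \<in> int_ring F \<Longrightarrow> x \<in> I \<Longrightarrow> a * x \<in> I"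
    and "a \<in> int_ring F" "z \<in> ideal_mult I J"
  shows "a * z \<in> ideal_mult I J"
proof (rule mult_ideal_mult[OF _ ideal_mult_subspace assms(4)])
  fix x y assume "x \<in> I" "y \<in> J"
  then have "(a * x) * y \<in> ideal_mult I J" using assms(2,3) by (intro ideal_multI)
  then show "a * (x * y) \<in> ideal_mult I J" by (simp only: mult.assoc)
qed

lemma ideal_ext_closed:
  assumes "complex_subfield F" "a \<in> int_ring F" "z \<in> ideal_ext F I"
  shows "a * z \<in> ideal_ext F I"
  using ideal_mult_int_ring_closed[of F "int_ring F" a z I] int_ring_closed[OF assms(1)] assms
  unfolding ideal_ext_def by (subst ideal_mult_commute) (simp add: ideal_mult_commute)

lemma ideal_ext_superset: "complex_subfield F \<Longrightarrow> I \<subseteq> ideal_ext F I"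
  unfolding ideal_ext_def using ideal_multI[of _ I 1 "int_ring F"] int_ring_closed(2) by fastforce

lemma ideal_inv_scale:
  assumes "complex_subfield F" "c \<in> F" "c \<noteq> 0"
  shows "ideal_inv F ((\<lambda>x. c * x) ` I) = (\<lambda>x. inverse c * x) ` ideal_inv F I"
proof (intro equalityI subsetI)
  fix x assume x: "x \<in> ideal_inv F ((\<lambda>x. c * x) ` I)"
  then have "c * x \<in> ideal_inv F I"
    using assms subfieldD(5)[OF assms(1)] by (auto simp: ideal_inv_def mult_ac)
  then show "x \<in> (\<lambda>x. inverse c * x) ` ideal_inv F I"
    using assms(3) by (intro image_eqI[of _ _ "c * x"]) (auto simp: field_simps)
next
  fix x assume "x \<in> (\<lambda>x. inverse c * x) ` ideal_inv F I"
  then obtain y where y: "y \<in> F" "\<forall>z\<in>I. y * z \<in> int_ring F" "x = y / c"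
    by (auto simp: ideal_inv_def field_simps)
  then show "x \<in> ideal_inv F ((\<lambda>x. c * x) ` I)"
    using assms subfieldD(6)[OF assms(1)] by (auto simp: ideal_inv_def)
qed

lemma ideal_inv_closed:
  assumes "complex_subfield F"
  shows "int_complex.subspace (ideal_inv F I)"
    "a \<in> int_ring F \<Longrightarrow> x \<in> ideal_inv F I \<Longrightarrow> a * x \<in> ideal_inv F I"
proof -
  show *: "a * x \<in> ideal_inv F I" if "a \<in> int_ring F" "x \<in> ideal_inv F I" for a x
  proof -
    have "a * x * y \<in> int_ring F" if "y \<in> I" for y
      using \<open>a \<in> _\<close> \<open>x \<in> _\<close> that int_ring_closed(5)[OF assms, of a "x * y"]
      by (simp add: ideal_inv_def mult.assoc)
    moreover have "a * x \<in> F" using that int_ring_subset subfieldD(5)[OF assms] by (auto simp: ideal_inv_def)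
    ultimately show ?thesis by (simp add: ideal_inv_def)
  qed
  show "int_complex.subspace (ideal_inv F I)"
  proof (rule int_complex.subspaceI)
    show "of_int k * x \<in> ideal_inv F I" if "x \<in> ideal_inv F I" for k x
      using * int_ring_closed(6)[OF assms] that by blast
  qed (use subfieldD[OF assms] int_ring_closed[OF assms] in
      \<open>auto simp: ideal_inv_def distrib_right\<close>)
qed

text \<open>The multiplier comes with a denominator \<open>e\<close> of its own; for the reflex norm
  of \<open>\<alpha> / \<beta>\<close> it is the reflex norm of \<open>\<beta>\<close>.\<close>

lemma frac_ideal_scale:
  assumes "complex_subfield F" "frac_ideal F I" "c \<in> F" "c \<noteq> 0"
    and "\<exists>e\<in>int_ring F. e \<noteq> 0 \<and> e * c \<in> int_ring F"
  shows "frac_ideal F ((\<lambda>x. c * x) ` I)"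
proof -
  obtain e where e: "e \<in> int_ring F" "e \<noteq> 0" "e * c \<in> int_ring F" using assms(5) by blast
  obtain d where d: "d \<in> int_ring F" "d \<noteq> 0" "\<forall>x\<in>I. d * x \<in> int_ring F"
    using assms(2) by (auto simp: frac_ideal_def)
  have "(e * d) * (c * x) \<in> int_ring F" if "x \<in> I" for x
    using int_ring_closed(5)[OF assms(1) e(3), of "d * x"] d(3) that by (simp add: mult_ac)
  moreover have "e * d \<in> int_ring F" "e * d \<noteq> 0" using d e int_ring_closed[OF assms(1)] by auto
  moreover have "c * x + c * y \<in> (\<lambda>x. c * x) ` I" if "x \<in> I" "y \<in> I" for x y
    using that assms(2) by (metis (no_types, lifting) distrib_left frac_ideal_def image_eqI)
  moreover have "a * (c * x) \<in> (\<lambda>x. c * x) ` I" if "a \<in> int_ring F" "x \<in> I" for a x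
    using frac_ideal_mult[OF assms(2) that] by (metis (no_types, lifting) mult.left_commute image_eqI)
  moreover have "I \<noteq> {0}" "0 \<in> I" "I \<subseteq> F" using assms(2) by (auto simp: frac_ideal_def)
  moreover have "(\<lambda>x. c * x) ` I \<noteq> {0}"
  proof
    assume z: "(\<lambda>x. c * x) ` I = {0}"
    have "x = 0" if "x \<in> I" for x using imageI[OF that, of "\<lambda>x. c * x"] assms(4) unfolding z by simp
    then show False using calculation by blast
  qed
  ultimately show ?thesis
    unfolding frac_ideal_def using assms(3) subfieldD(5)[OF assms(1)]
    by (auto intro: image_eqI[of 0 _ 0] intro!: bexI[of _ "e * d"])
qed

text \<open>If \<open>x\<close> lies in the extension of \<open>I\<close>, then \<open>x\<close>
  times the inverse ideal consists of integers of \<open>L\<close> lying in \<open>F\<close>, hence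
  of integers of \<open>F\<close>. Multiplying back by \<open>I\<close>, with \<open>1\<close>
  written as an element of \<open>I\<close> times its inverse, returns \<open>x\<close> to
  \<open>I\<close>.\<close>

lemma ideal_ext_contract:
  assumes "complex_subfield F" "F \<subseteq> L" "complex_subfield L" "frac_ideal F I"
    and "1 \<in> ideal_mult I (ideal_inv F I)" "x \<in> F" "x \<in> ideal_ext L I"
  shows "x \<in> I"
proof -
  note subI = frac_ideal_subspace[OF assms(1,4)]
  have 1: "x * y \<in> int_ring F" if y: "y \<in> ideal_inv F I" for y
  proof -
    have "y * x \<in> int_ring L"
    proof (rule mult_ideal_mult[OF _ int_ring_subspace[OF assms(3)] assms(7)[unfolded ideal_ext_def]])
      fix a b assume ab: "a \<in> I" "b \<in> int_ring L"
      have "y * a \<in> int_ring L" using y ab(1) assms(2) by (auto simp: ideal_inv_def int_ring_def)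
      then have "(y * a) * b \<in> int_ring L" using ab(2) int_ring_closed(5)[OF assms(3)] by blast
      then show "y * (a * b) \<in> int_ring L" by (simp only: mult.assoc)
    qed
    moreover have "y * x \<in> F" using y assms(6) subfieldD(5)[OF assms(1)] by (simp add: ideal_inv_def)
    ultimately show ?thesis by (simp add: int_ring_def mult.commute)
  qed
  have "x * 1 \<in> I"
  proof (rule mult_ideal_mult[OF _ subI assms(5)])
    fix a y assume "a \<in> I" "y \<in> ideal_inv F I"
    then have "(x * y) * a \<in> I" using 1 frac_ideal_mult[OF assms(4)] by blast
    then show "x * (a * y) \<in> I" by (simp add: mult_ac)
  qed
  then show ?thesis by simp
qed

text \<open>Contraction recovers an invertible ideal from its extension. This is the uniqueness
  behind the definite description in \<open>reflex_norm_ideal\<close>.\<close>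

lemma ideal_ext_inject:
  assumes "complex_subfield F" "F \<subseteq> L" "complex_subfield L"
    and "\<And>I. frac_ideal F I \<Longrightarrow> 1 \<in> ideal_mult I (ideal_inv F I)"
    and "frac_ideal F I" "frac_ideal F J" "ideal_ext L I = ideal_ext L J"
  shows "I = J"
proof -
  have "I' \<subseteq> J'" if "frac_ideal F I'" "frac_ideal F J'" "ideal_ext L I' = ideal_ext L J'" for I' J'
  proof
    fix x assume "x \<in> I'"
    then have "x \<in> F" "x \<in> ideal_ext L J'"
      using frac_ideal_subset[OF that(1)] ideal_ext_superset[OF assms(3)] that(3) by blast+
    then show "x \<in> J'" using ideal_ext_contract[OF assms(1-3) that(2) assms(4)] that(2) by blast
  qed
  then show ?thesis using assms(5-7) by (metis subset_antisym)
qed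

section \<open>Invertibility of the ideals of a fixed field\<close>

locale galois_subfield = galois_number_field +
  fixes H :: "(complex \<Rightarrow> complex) set"
  assumes H_Gal: "H \<subseteq> carrier (Gal L)"
begin

abbreviation "F \<equiv> fixed_field L H"

lemma F_L: "F \<subseteq> L"
  by (auto simp: fixed_field_def)

lemma F_fixed: "x \<in> F \<Longrightarrow> \<gamma> \<in> H \<Longrightarrow> \<gamma> x = x"
  by (simp add: fixed_field_def)

lemma F_subfield: "complex_subfield F"
  unfolding complex_subfield_def
proof (intro conjI ballI)
  note g = Gal_field_embedding[OF subsetD[OF H_Gal]]
  note c = subfieldD[OF L_subfield]
  show "0 \<in> F" "1 \<in> F"
    using c by (auto simp: fixed_field_def field_embedding.zero[OF g] field_embedding.one[OF g])
  fix x y assume xy: "x \<in> F" "y \<in> F"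
  then have xyL: "x \<in> L" "y \<in> L" using F_L by auto
  show "x + y \<in> F" "x - y \<in> F" "x * y \<in> F" "x / y \<in> F"
    using xy xyL c by (auto simp: fixed_field_def field_embedding.add[OF g] field_embedding.diff[OF g]
      field_embedding.mult[OF g] field_embedding.divide[OF g])
qed

lemma Gal_algebraic_int: "\<sigma> \<in> carrier G \<Longrightarrow> x \<in> int_ring L \<Longrightarrow> \<sigma> x \<in> int_ring L"
  using embedding_algebraic_int[OF L_subfield Gal_embedding] Gal_closed by (simp add: int_ring_def)

lemma int_ring_F_L: "int_ring F \<subseteq> int_ring L"
  using F_L by (auto simp: int_ring_def)

text \<open>The product of all Galois conjugates of \<open>a\<close> is a rational integer, and the
  factors other than \<open>a\<close> form an integral cofactor, which lies in \<open>F\<close> as a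
  quotient. A sign makes the multiple positive.\<close>

lemma norm_multiple:
  assumes "a \<in> int_ring F" "a \<noteq> 0"
  obtains n :: nat and w where "0 < n" "w \<in> int_ring F" "a * w = of_nat n"
proof -
  have aL: "a \<in> L" "a \<in> F" "a \<in> int_ring L" using assms F_L int_ring_F_L by (auto simp: int_ring_def)
  define m where "m = (\<Prod>\<sigma>\<in>carrier G. \<sigma> a)"
  define v where "v = (\<Prod>\<sigma>\<in>carrier G - {\<one>\<^bsub>G\<^esub>}. \<sigma> a)"
  have mv: "m = a * v"
    unfolding m_def v_def using finite_Gal by (subst prod.remove[of _ "\<one>\<^bsub>G\<^esub>"]) (auto simp: Gal_one_apply aL)
  have alg: "algebraic_int m" "algebraic_int v"
    unfolding m_def v_def using Gal_algebraic_int[OF _ aL(3)]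
    by (auto simp: int_ring_def intro!: algebraic_int_prod)
  have "m \<in> \<rat>"
  proof (rule fixed_Rats)
    show "m \<in> L" unfolding m_def using Gal_closed aL by (intro subfield_prod[OF L_subfield]) auto
    fix \<gamma> assume g: "\<gamma> \<in> carrier G"
    interpret field_embedding L \<gamma> using Gal_field_embedding g by blast
    have "\<gamma> m = (\<Prod>\<sigma>\<in>carrier G. (\<sigma> \<otimes>\<^bsub>G\<^esub> \<gamma>) a)"
      unfolding m_def using Gal_closed aL by (simp add: prod Gal_mult_apply)
    also have "\<dots> = m" unfolding m_def by (rule prod.reindex_bij_betw[OF Gal_mult_bij[OF g]])
    finally show "\<gamma> m = m" .
  qed
  then have "m \<in> \<int>" using alg rational_algebraic_int_is_int by blast
  then obtain k where k: "m = of_int k" by (auto elim: Ints_cases)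
  have m0: "m \<noteq> 0" unfolding m_def using finite_Gal aL(1) assms(2)
    by (auto simp: field_embedding.nonzero[OF Gal_field_embedding])
  define w where "w = of_int (sgn k) * v"
  have "v = m / a" using mv assms(2) by simp
  then have "v \<in> F" using k subfield_of_int[OF F_subfield] aL(2) subfieldD(6)[OF F_subfield] by simp
  then have "v \<in> int_ring F" using alg by (simp add: int_ring_def)
  then have "w \<in> int_ring F" unfolding w_def by (intro int_ring_closed[OF F_subfield])
  moreover have "a * w = of_nat (nat \<bar>k\<bar>)"
  proof -
    have "a * w = of_int (sgn k) * m" by (simp add: w_def mv mult_ac)
    also have "\<dots> = of_int (sgn k * k)" by (simp add: k)
    also have "sgn k * k = int (nat \<bar>k\<bar>)" by (auto simp: sgn_if)
    finally show ?thesis by simp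
  qed
  moreover have "0 < nat \<bar>k\<bar>" using m0 k by auto
  ultimately show ?thesis using that by blast
qed

text \<open>Kronecker's construction of inverse ideals. The elements \<open>a\<^sub>i\<close> are the coefficients of a
  polynomial \<open>f\<close>; its norm is \<open>f * g\<close> with \<open>g\<close> over \<open>F\<close>, and has rational integers as coefficients. If
  \<open>d\<close> is the content of the norm, then the \<open>b\<^sub>j / d\<close> with \<open>b\<^sub>j\<close> the coefficients of \<open>g\<close> generate the
  inverse ideal by Dedekind's Prague theorem.\<close>

lemma kronecker_inverse:
  assumes "finite A" "A \<subseteq> int_ring F" "\<exists>a\<in>A. a \<noteq> 0"
  obtains Y where "Y \<subseteq> F" "\<And>a y. a \<in> A \<Longrightarrow> y \<in> Y \<Longrightarrow> a * y \<in> int_ring F"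
    "1 \<in> int_complex.span {a * y | a y. a \<in> A \<and> y \<in> Y}"
proof -
  obtain xs where xs: "set xs = A" using finite_list[OF assms(1)] by blast
  define f where "f = Poly xs"
  have co_f: "coeff f i \<in> insert 0 A" for i
    by (auto simp: f_def coeff_Poly_eq nth_default_def simp flip: xs)
  have f_co: "\<exists>i. coeff f i = a" if a: "a \<in> A" for a
  proof -
    obtain i where "i < length xs" "xs ! i = a" using a xs by (metis in_set_conv_nth)
    then show ?thesis by (intro exI[of _ i]) (simp add: f_def coeff_Poly_eq nth_default_def)
  qed
  have f0: "f \<noteq> 0" using f_co assms(3) by fastforce
  have fF: "coeff f i \<in> int_ring F" for i
    using co_f[of i] assms(2) int_ring_closed(1)[OF F_subfield] by (cases "coeff f i = 0") auto
  then have fL: "coeff f i \<in> L" "coeff f i \<in> int_ring L" for i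
    using int_ring_F_L int_ring_subset by blast+
  have map_L: "coeff (map_poly \<sigma> f) i \<in> L" "algebraic_int (coeff (map_poly \<sigma> f) i)" if "\<sigma> \<in> carrier G" for \<sigma> i
  proof -
    interpret field_embedding L \<sigma> using Gal_field_embedding that by blast
    show "coeff (map_poly \<sigma> f) i \<in> L" "algebraic_int (coeff (map_poly \<sigma> f) i)"
      using Gal_algebraic_int[OF that fL(2)[of i]] by (auto simp: coeff_map_poly int_ring_def)
  qed
  define h where "h = (\<Prod>\<sigma>\<in>carrier G. map_poly \<sigma> f)"
  define g where "g = (\<Prod>\<sigma>\<in>carrier G - {\<one>\<^bsub>G\<^esub>}. map_poly \<sigma> f)"
  have map_one: "map_poly \<one>\<^bsub>G\<^esub> f = f"
    by (rule poly_eqI) (simp add: coeff_map_poly Gal_one_apply fL subfieldD(1)[OF L_subfield])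
  have h: "h = f * g"
    unfolding h_def g_def using finite_Gal by (subst prod.remove[of _ "\<one>\<^bsub>G\<^esub>"]) (auto simp: map_one)
  have gL: "coeff g i \<in> L" for i
    unfolding g_def using map_L by (intro poly_coeff_prod_subfield[OF L_subfield]) auto
  have hL: "coeff h i \<in> L" for i
    unfolding h_def using map_L by (intro poly_coeff_prod_subfield[OF L_subfield]) auto
  have map_h: "map_poly \<gamma> h = h" if gam: "\<gamma> \<in> carrier G" for \<gamma>
  proof -
    interpret field_embedding L \<gamma> using Gal_field_embedding gam by blast
    have "map_poly \<gamma> (map_poly \<sigma> f) = map_poly (\<sigma> \<otimes>\<^bsub>G\<^esub> \<gamma>) f" if s: "\<sigma> \<in> carrier G" for \<sigma>
    proof (rule poly_eqI)
      fix i
      interpret s: field_embedding L \<sigma> using Gal_field_embedding s by blast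
      have "(\<sigma> \<otimes>\<^bsub>G\<^esub> \<gamma>) 0 = 0" using subfieldD(1)[OF L_subfield] by (simp add: Gal_mult_apply)
      then show "coeff (map_poly \<gamma> (map_poly \<sigma> f)) i = coeff (map_poly (\<sigma> \<otimes>\<^bsub>G\<^esub> \<gamma>) f) i"
        by (simp add: coeff_map_poly Gal_mult_apply fL)
    qed
    then have "map_poly \<gamma> h = (\<Prod>\<sigma>\<in>carrier G. map_poly (\<sigma> \<otimes>\<^bsub>G\<^esub> \<gamma>) f)"
      unfolding h_def using map_L by (subst map_poly_prod) auto
    also have "\<dots> = h" unfolding h_def by (rule prod.reindex_bij_betw[OF Gal_mult_bij[OF gam]])
    finally show ?thesis .
  qed
  have h_Rats: "coeff h i \<in> \<rat>" for i using poly_Rats[OF hL map_h] by blast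
  \<comment> \<open>The cofactor \<open>g\<close> is fixed by \<open>H\<close> because
    \<open>f\<close> and \<open>h\<close> are and the nonzero \<open>f\<close> can be cancelled; the
    individual factors of \<open>g\<close> need not be defined over \<open>F\<close>.\<close>
  have gF: "coeff g i \<in> F" for i
    unfolding fixed_field_def
  proof (clarify, intro conjI ballI gL)
    fix \<gamma> assume gam: "\<gamma> \<in> H"
    then have gG: "\<gamma> \<in> carrier G" using H_Gal by blast
    interpret field_embedding L \<gamma> using Gal_field_embedding gG by blast
    have "map_poly \<gamma> f = f"
      using fF int_ring_subset F_fixed[OF _ gam] by (intro poly_eqI) (auto simp: coeff_map_poly subsetD)
    then have "f * map_poly \<gamma> g = f * g"
      using map_poly_mult[of f g] map_h[OF gG] fL gL by (simp add: h)
    then have "map_poly \<gamma> g = g" using f0 by simp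
    then show "\<gamma> (coeff g i) = coeff g i" by (metis coeff_map_poly zero)
  qed
  have "int_poly h" unfolding h_def using map_L(2) by (intro int_poly_prod) (simp add: int_poly_def)
  then have h_Ints: "coeff h i \<in> \<int>" for i
    using h_Rats rational_algebraic_int_is_int by (auto simp: int_poly_def)
  define J where "J = {n::int. of_int n \<in> int_complex.span (range (coeff h))}"
  have "\<exists>d\<in>J. \<forall>x\<in>J. d dvd x"
  proof (rule int_subgroup_principal)
    show "n * x \<in> J" if "x \<in> J" for n x
      using int_mult_span[of "of_int x"] that by (simp add: J_def)
  qed (auto simp: J_def int_complex.span_zero int_complex.span_add)
  then obtain d where d: "d \<in> J" "\<And>x. x \<in> J \<Longrightarrow> d dvd x" by blast
  have dvd: "\<exists>k. coeff h i = of_int d * of_int k" for i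
  proof -
    obtain n where n: "coeff h i = of_int n" using h_Ints by (metis Ints_cases)
    then have "n \<in> J" by (simp add: J_def flip: n) (auto intro: int_complex.span_base)
    then show ?thesis using d(2) n by (metis dvdE of_int_mult)
  qed
  have "h \<noteq> 0"
    unfolding h_def
  proof (subst prod_zero_iff[OF finite_Gal], clarify)
    fix \<sigma> assume s: "\<sigma> \<in> carrier G" "map_poly \<sigma> f = 0"
    interpret field_embedding L \<sigma> using Gal_field_embedding s by blast
    have "\<sigma> (coeff f i) = 0" for i using s(2) by (metis coeff_map_poly zero coeff_0)
    then have "coeff f i = 0" for i using nonzero[OF fL(1)] by blast
    then show False using f0 by (simp add: poly_eq_iff)
  qed
  then have d0: "d \<noteq> 0" using dvd by (auto simp: poly_eq_iff)
  define Y where "Y = range (\<lambda>j. coeff g j / of_int d)"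
  have "int_poly (smult (1 / of_int d) f * g)"
  proof -
    have "smult (1 / of_int d) f * g = smult (1 / of_int d) h" by (simp add: h)
    moreover have "algebraic_int (1 / of_int d * coeff h i)" for i
      using dvd[of i] d0 by auto
    ultimately show ?thesis by (simp add: int_poly_def)
  qed
  from algebraic_int_coeff_mult_coeff[OF this]
  have prague: "algebraic_int (coeff f i * (coeff g j / of_int d))" for i j
    by (simp add: mult_ac)
  have YF: "Y \<subseteq> F" unfolding Y_def using gF subfield_of_int[OF F_subfield] subfieldD(6)[OF F_subfield] by blast
  moreover have "a * y \<in> int_ring F" if ay: "a \<in> A" "y \<in> Y" for a y
  proof -
    obtain i j where "a = coeff f i" "y = coeff g j / of_int d" using f_co[OF ay(1)] ay(2) by (auto simp: Y_def)
    moreover have "a * y \<in> F" using YF ay assms(2) int_ring_subset subfieldD(5)[OF F_subfield] by blast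
    ultimately show ?thesis using prague by (simp add: int_ring_def)
  qed
  moreover have "1 \<in> int_complex.span {a * y | a y. a \<in> A \<and> y \<in> Y}" (is "_ \<in> ?S")
  proof -
    \<comment> \<open>A coefficient of \<open>h = f * g\<close> divided by \<open>d\<close> is a
      convolution sum of products of coefficients of \<open>f\<close> with elements of
      \<open>Y\<close>. Applied to the combination that represents \<open>d\<close>, this yields
      \<open>1\<close>.\<close>
    have "1 / of_int d * s \<in> ?S" if s: "s \<in> range (coeff h)" for s
    proof -
      obtain k where "s = coeff h k" using s by blast
      then have "1 / of_int d * s = (\<Sum>i\<le>k. coeff f i * (coeff g (k - i) / of_int d))"
        by (simp add: h coeff_mult sum_divide_distrib)
      also have "\<dots> \<in> ?S"
      proof (rule int_complex.span_sum)
        fix i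
        show "coeff f i * (coeff g (k - i) / of_int d) \<in> ?S"
        proof (cases "coeff f i = 0")
          case False
          then have "coeff f i \<in> A" using co_f[of i] by blast
          then show ?thesis unfolding Y_def by (intro int_complex.span_base) blast
        qed (simp add: int_complex.span_zero)
      qed
      finally show ?thesis .
    qed
    moreover have "of_int d \<in> int_complex.span (range (coeff h))" using d(1) unfolding J_def by (rule CollectD)
    ultimately have "1 / of_int d * of_int d \<in> ?S" by (rule mult_span_closed)
    then show ?thesis using d0 by simp
  qed
  ultimately show ?thesis using that by blast
qed

text \<open>A denominator \<open>d\<close> makes \<open>I\<close> integral, and \<open>d I\<close>
  has finitely many generators \<open>A\<close> as a subgroup of the integers. If \<open>Y\<close>
  is Kronecker's family for \<open>A\<close>, then \<open>d Y\<close> lies in the inverse ideal, and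
  each product \<open>a * y\<close> is an element of \<open>I\<close> times one of
  \<open>d Y\<close>.\<close>

lemma ideal_invertible:
  assumes "finite T" "int_ring F = int_complex.span T" "frac_ideal F I"
  shows "1 \<in> ideal_mult I (ideal_inv F I)"
proof -
  obtain d where d: "d \<in> int_ring F" "d \<noteq> 0" "\<forall>x\<in>I. d * x \<in> int_ring F"
    using assms(3) by (auto simp: frac_ideal_def)
  note subI = frac_ideal_subspace[OF F_subfield assms(3)]
  have dI: "(\<lambda>x. d * x) ` I \<subseteq> int_complex.span T" 
  proof (rule image_subsetI)
    fix x assume "x \<in> I"
    then have "d * x \<in> int_ring F" using d(3) by blast
    then show "d * x \<in> int_complex.span T" by (simp only: assms(2))
  qed
  obtain A where A: "finite A" "(\<lambda>x. d * x) ` I = int_complex.span A"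
    using subgroup_of_fg[OF assms(1) subspace_scale_image[OF subI] dI] by (elim exE conjE) (rule that)
  have Asub: "A \<subseteq> (\<lambda>x. d * x) ` I" unfolding A(2) by (rule int_complex.span_superset)
  then have AO: "A \<subseteq> int_ring F" using d(3) by auto
  have "\<exists>a\<in>A. a \<noteq> 0"
  proof (rule ccontr)
    assume "\<not> (\<exists>a\<in>A. a \<noteq> 0)"
    then have "int_complex.span A \<subseteq> {0}" by (intro int_complex.span_minimal) auto
    then have "d * x = 0" if "x \<in> I" for x using that A(2) by blast
    then have "I \<subseteq> {0}" using d(2) by auto
    then show False using assms(3) by (auto simp: frac_ideal_def)
  qed
  then obtain Y where Y: "Y \<subseteq> F" "\<And>a y. a \<in> A \<Longrightarrow> y \<in> Y \<Longrightarrow> a * y \<in> int_ring F"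
    "1 \<in> int_complex.span {a * y | a y. a \<in> A \<and> y \<in> Y}"
    using kronecker_inverse[OF A(1) AO] by blast
  have dY: "d * y \<in> ideal_inv F I" if y: "y \<in> Y" for y
  proof -
    have "y * (d * x) \<in> int_ring F" if x: "x \<in> I" for x
    proof -
      have "d * x \<in> int_complex.span A" using x A(2) by blast
      moreover have "y * a \<in> int_complex.span (int_ring F)" if "a \<in> A" for a
        using Y(2)[OF that y] by (intro int_complex.span_base) (simp add: mult.commute)
      ultimately have "y * (d * x) \<in> int_complex.span (int_ring F)" by (rule mult_span_closed[rotated])
      then show ?thesis
        by (simp only: int_complex.span_eq_iff[THEN iffD2, OF int_ring_subspace[OF F_subfield]])
    qed
    moreover have "d * y \<in> F"
      using y Y(1) d(1) int_ring_subset by (intro subfieldD(5)[OF F_subfield]) auto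
    ultimately show ?thesis by (simp add: ideal_inv_def mult_ac)
  qed
  have sub: "{a * y | a y. a \<in> A \<and> y \<in> Y} \<subseteq> ideal_mult I (ideal_inv F I)"
  proof clarify
    fix a y assume ay: "a \<in> A" "y \<in> Y"
    then obtain x where x: "x \<in> I" "a = d * x" using Asub by blast
    have "a * y = x * (d * y)" by (simp add: x mult_ac)
    also have "\<dots> \<in> ideal_mult I (ideal_inv F I)" using x(1) dY[OF ay(2)] by (rule ideal_multI)
    finally show "a * y \<in> ideal_mult I (ideal_inv F I)" .
  qed
  show ?thesis using int_complex.span_minimal[OF sub ideal_mult_subspace] Y(3) by (rule subsetD)
qed

end

section \<open>Symplectic bases\<close>

text \<open>The real span of the second half of the basis is isotropic. A complex relation among
  these vectors reads \<open>u + \<i> *s v = 0\<close> with \<open>u\<close> and \<open>v\<close> in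
  that span, so \<open>E v (\<i> *s v)\<close> vanishes; positivity gives \<open>v = 0\<close> and
  then \<open>u = 0\<close>. Real independence comes from pairing with the first half.\<close>

lemma invertible_symplectic:
  fixes b :: "'g::finite + 'g \<Rightarrow> complex ^ 'g"
  assumes "riemann_form \<Lambda> E" "\<And>i j. of_real m * E (b i) (b j) = symplectic_entry i j"
  shows "invertible (\<chi> i j. b (Inr j) $ i)"
proof -
  have lin: "linear (\<lambda>u. E u v)" "linear (\<lambda>v. E u v)" for u v
  proof -
    have "bilinear E" using assms(1) unfolding riemann_form_def by (rule conjunct1)
    then show "linear (\<lambda>u. E u v)" "linear (\<lambda>v. E u v)" by (simp_all add: bilinear_def)
  qed
  have pos: "u \<noteq> 0 \<Longrightarrow> Re (E u (\<i> *s u)) > 0" for u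
    using assms(1) unfolding riemann_form_def by blast
  have m0: "m \<noteq> 0" using assms(2)[of "Inl undefined" "Inr undefined"] by auto
  define w where "w k = b (Inr k)" for k
  have ww: "E (w k) (w l) = 0" for k l using assms(2)[of "Inr k" "Inr l"] m0 by (simp add: w_def)
  define comb where "comb a = (\<Sum>k\<in>UNIV. a k *\<^sub>R w k)" for a :: "'g \<Rightarrow> real"
  have comb_left: "E (comb a) v = (\<Sum>k\<in>UNIV. a k *\<^sub>R E (w k) v)" for a v
    unfolding comb_def by (simp add: linear_sum[OF lin(1)] linear_scale[OF lin(1)])
  have comb_right: "E u (comb a) = (\<Sum>k\<in>UNIV. a k *\<^sub>R E u (w k))" for a u
    unfolding comb_def by (simp add: linear_sum[OF lin(2)] linear_scale[OF lin(2)])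
  have iso: "E (comb a) (comb a') = 0" for a a'
    by (simp add: comb_left comb_right ww)
  have indep: "a k = 0" if a: "comb a = 0" for a k
  proof -
    have "0 = of_real m * E (b (Inl k)) (comb a)" using linear_0[OF lin(2)] a by simp
    also have "\<dots> = (\<Sum>l\<in>UNIV. of_real (a l) * (of_real m * E (b (Inl k)) (w l)))"
      by (simp add: comb_right sum_distrib_left scaleR_conv_of_real mult_ac)
    also have "\<dots> = (\<Sum>l\<in>UNIV. if l = k then - of_real (a l) else 0)"
      by (rule sum.cong) (auto simp: w_def assms(2))
    also have "\<dots> = - of_real (a k)" by simp
    finally show ?thesis by simp
  qed
  have "x = 0" if x: "(\<chi> i j. b (Inr j) $ i) *v x = 0" for x :: "complex ^ 'g"
  proof -
    define u where "u = comb (\<lambda>k. Re (x $ k))"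
    define v where "v = comb (\<lambda>k. Im (x $ k))"
    have "u + \<i> *s v = (\<chi> i j. b (Inr j) $ i) *v x"
    proof (rule vec_eq_iff[THEN iffD2], rule allI)
      fix i
      have "(u + \<i> *s v) $ i = (\<Sum>k\<in>UNIV. (of_real (Re (x $ k)) + \<i> * of_real (Im (x $ k))) * w k $ i)"
        unfolding u_def v_def comb_def vector_add_component vector_smult_component sum_component
          vector_scaleR_component
        by (simp add: scaleR_conv_of_real sum_distrib_left sum.distrib algebra_simps)
      also have "\<dots> = ((\<chi> i j. b (Inr j) $ i) *v x) $ i"
        by (simp add: matrix_vector_mult_def w_def mult.commute flip: complex_eq)
      finally show "(u + \<i> *s v) $ i = ((\<chi> i j. b (Inr j) $ i) *v x) $ i" .
    qed
    then have uv: "u + \<i> *s v = 0" using x by simp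
    then have iv: "\<i> *s v = - u" by (simp add: eq_neg_iff_add_eq_0 add.commute)
    have "E v (\<i> *s v) = 0"
      unfolding iv using linear_neg[OF lin(2)] iso by (simp add: u_def v_def)
    then have "v = 0" using pos[of v] by auto
    then have "u = 0" using uv by simp
    have "Re (x $ k) = 0 \<and> Im (x $ k) = 0" for k
      using indep[of "\<lambda>k. Re (x $ k)" k] indep[of "\<lambda>k. Im (x $ k)" k] \<open>u = 0\<close> \<open>v = 0\<close>
      by (simp add: u_def v_def)
    then show ?thesis by (simp add: vec_eq_iff complex_eq_iff)
  qed
  then show ?thesis unfolding invertible_left_inverse matrix_left_invertible_ker by blast
qed

section \<open>Diagonal scaling of bases and forms\<close>

definition diag_scale :: "('g \<Rightarrow> complex) \<Rightarrow> complex ^ 'g \<Rightarrow> complex ^ 'g::finite" where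
  "diag_scale \<kappa> v = (\<chi> i. \<kappa> i * v $ i)"

lemma diag_scale_inject: "(\<And>i. \<kappa> i \<noteq> 0) \<Longrightarrow> diag_scale \<kappa> u = diag_scale \<kappa> v \<longleftrightarrow> u = v"
  by (simp add: diag_scale_def vec_eq_iff)

lemma diag_scale_combination:
  "diag_scale \<kappa> (\<Sum>j\<in>A. c j *s b j) = (\<Sum>j\<in>A. c j *s diag_scale \<kappa> (b j))"
  by (simp add: diag_scale_def vec_eq_iff sum_distrib_left mult_ac)

lemma Z_basis_diag_scale:
  fixes b :: "'i::finite \<Rightarrow> complex ^ 'g::finite"
  assumes "Z_basis \<Lambda> b" "\<And>i. \<kappa> i \<noteq> 0"
  shows "Z_basis (diag_scale \<kappa> ` \<Lambda>) (\<lambda>j. diag_scale \<kappa> (b j))"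
  unfolding Z_basis_def
proof (intro conjI ballI)
  show "range (\<lambda>j. diag_scale \<kappa> (b j)) \<subseteq> diag_scale \<kappa> ` \<Lambda>"
    using assms(1) by (auto simp: Z_basis_def)
  fix v assume "v \<in> diag_scale \<kappa> ` \<Lambda>"
  then obtain u where u: "u \<in> \<Lambda>" "v = diag_scale \<kappa> u" by blast
  have "\<exists>!r::'i \<Rightarrow> int. u = (\<Sum>j\<in>UNIV. of_int (r j) *s b j)"
    using assms(1) u(1) by (simp add: Z_basis_def)
  then show "\<exists>!r::'i \<Rightarrow> int. v = (\<Sum>j\<in>UNIV. of_int (r j) *s diag_scale \<kappa> (b j))"
    unfolding u(2) diag_scale_combination[symmetric] diag_scale_inject[OF assms(2)] .
qed

text \<open>The diagonal matrix multiplies both period blocks from the left and cancels.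
  Invertibility is assumed because \<open>matrix_inv\<close> is a choice whose value is unspecified
  on singular matrices.\<close>

lemma cm_point_diag_scale:
  fixes b :: "'g::finite + 'g \<Rightarrow> complex ^ 'g"
  assumes "invertible (\<chi> i j. b (Inr j) $ i)" "\<And>i. \<kappa> i \<noteq> 0"
  shows "cm_point (\<lambda>j. diag_scale \<kappa> (b j)) = cm_point b"
proof -
  define D where "D \<kappa> = (\<chi> i j. if i = j then \<kappa> i else 0)" for \<kappa> :: "'g \<Rightarrow> complex"
  define B1 where "B1 = (\<chi> i j. b (Inl j) $ i)"
  define B2 where "B2 = (\<chi> i j. b (Inr j) $ i)"
  have mat: "(\<chi> i j. diag_scale \<kappa> (c j) $ i) = D \<kappa> ** (\<chi> i j. c j $ i)" for c :: "'g \<Rightarrow> complex ^ 'g"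
    by (simp add: vec_eq_iff matrix_matrix_mult_def D_def diag_scale_def if_distrib[of "\<lambda>x. x * _"] cong: if_cong)
  have "D (\<lambda>i. inverse (\<kappa> i)) ** D \<kappa> = mat 1"
    using assms(2) by (simp add: vec_eq_iff matrix_matrix_mult_def D_def mat_def if_distrib[of "\<lambda>x. x * _"] cong: if_cong)
  then have "invertible (D \<kappa>)" unfolding invertible_left_inverse by blast
  then have inv: "invertible (D \<kappa> ** B2)" using assms(1) by (simp add: invertible_mult B2_def)
  have matrix_inv: "X ** matrix_inv X = mat 1 \<and> matrix_inv X ** X = mat 1"
    if "invertible X" for X :: "complex ^ 'g ^ 'g"
    using that unfolding invertible_def matrix_inv_def by (rule someI_ex)
  have inv_B2: "B2 ** matrix_inv B2 = mat 1" using matrix_inv assms(1) by (simp add: B2_def)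
  have inv_DB2: "matrix_inv (D \<kappa> ** B2) ** (D \<kappa> ** B2) = mat 1" using matrix_inv[OF inv] by simp
  have "D \<kappa> ** B1 = (D \<kappa> ** B2) ** (matrix_inv B2 ** B1)"
    by (metis inv_B2 matrix_mul_assoc matrix_mul_lid)
  then have "matrix_inv (D \<kappa> ** B2) ** (D \<kappa> ** B1) = matrix_inv B2 ** B1"
    by (metis inv_DB2 matrix_mul_assoc matrix_mul_lid)
  then show ?thesis unfolding cm_point_def mat B1_def B2_def .
qed

text \<open>Each coordinate contributes the squared modulus of its factor; the form is rescaled as a
  whole because these moduli agree.\<close>

lemma E_form_diag_scale:
  assumes "\<And>i. \<kappa> i * cnj (\<kappa> i) = of_real t"
  shows "E_form \<psi> c (diag_scale \<kappa> u) (diag_scale \<kappa> v) = of_real t * E_form \<psi> c u v"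
proof -
  have "\<psi> j c * (\<kappa> j * u $ j * cnj (\<kappa> j * v $ j) - cnj (\<kappa> j * u $ j) * (\<kappa> j * v $ j)) =
     \<kappa> j * cnj (\<kappa> j) * (\<psi> j c * (u $ j * cnj (v $ j) - cnj (u $ j) * v $ j))" for j
    by (simp add: algebra_simps)
  then show ?thesis unfolding E_form_def diag_scale_def by (simp only: vec_lambda_beta assms sum_distrib_left)
qed

section \<open>Fractional ideals\<close>

lemma subfield_subspace: "complex_subfield F \<Longrightarrow> int_complex.subspace F"
  using subfieldD[of F] subfield_of_int[of F] by (intro int_complex.subspaceI) auto

lemma frac_ideal_int_ring:
  assumes "complex_subfield F" shows "frac_ideal F (int_ring F)"
proof -
  have "int_ring F \<noteq> {0}" using int_ring_closed(2)[OF assms] by force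
  then show ?thesis
    unfolding frac_ideal_def using int_ring_closed[OF assms] int_ring_subset
    by (auto intro!: bexI[of _ 1])
qed

lemma frac_ideal_nonzero:
  assumes "frac_ideal F I" obtains a where "a \<in> I" "a \<noteq> 0"
proof -
  have "I \<noteq> {0}" "0 \<in> I" using assms by (auto simp: frac_ideal_def)
  then show ?thesis using that by blast
qed

lemma frac_ideal_ideal_inv:
  assumes "complex_subfield F" "frac_ideal F I"
  shows "frac_ideal F (ideal_inv F I)"
proof -
  obtain d where d: "d \<in> int_ring F" "d \<noteq> 0" "\<forall>x\<in>I. d * x \<in> int_ring F"
    using assms(2) by (auto simp: frac_ideal_def)
  obtain a where a: "a \<in> I" "a \<noteq> 0" using assms(2) by (rule frac_ideal_nonzero)
  have "d \<in> ideal_inv F I" using d int_ring_subset by (auto simp: ideal_inv_def)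
  then have "ideal_inv F I \<noteq> {0}" using d(2) by blast
  moreover have "d * a * y \<in> int_ring F" if "y \<in> ideal_inv F I" for y
  proof -
    have "y * a \<in> int_ring F" using a(1) that by (simp add: ideal_inv_def)
    then have "d * (y * a) \<in> int_ring F" using d(1) int_ring_closed(5)[OF assms(1)] by blast
    then show ?thesis by (simp add: mult_ac)
  qed
  moreover have "d * a \<in> int_ring F" "d * a \<noteq> 0" using a d by auto
  ultimately show ?thesis
    unfolding frac_ideal_def
    using ideal_inv_closed(2)[OF assms(1)] int_complex.subspace_add[OF ideal_inv_closed(1)[OF assms(1)]]
      int_complex.subspace_0[OF ideal_inv_closed(1)[OF assms(1)]]
    by (intro conjI ballI bexI[of _ "d * a"]) (auto simp: ideal_inv_def)
qed

lemma frac_ideal_ideal_mult: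
  assumes "complex_subfield F" "frac_ideal F I" "frac_ideal F J"
  shows "frac_ideal F (ideal_mult I J)"
proof -
  obtain d where d: "d \<in> int_ring F" "d \<noteq> 0" "\<forall>x\<in>I. d * x \<in> int_ring F"
    using assms(2) by (auto simp: frac_ideal_def)
  obtain e where e: "e \<in> int_ring F" "e \<noteq> 0" "\<forall>x\<in>J. e * x \<in> int_ring F"
    using assms(3) by (auto simp: frac_ideal_def)
  obtain a where a: "a \<in> I" "a \<noteq> 0" using assms(2) by (rule frac_ideal_nonzero)
  obtain b where b: "b \<in> J" "b \<noteq> 0" using assms(3) by (rule frac_ideal_nonzero)
  have 1: "ideal_mult I J \<subseteq> F"
    using frac_ideal_subset[OF assms(2)] frac_ideal_subset[OF assms(3)] subfieldD(5)[OF assms(1)]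
    by (intro ideal_mult_subset subfield_subspace assms(1)) auto
  have 2: "d * e * z \<in> int_ring F" if "z \<in> ideal_mult I J" for z
  proof (rule mult_ideal_mult[OF _ int_ring_subspace[OF assms(1)] that])
    fix x y assume "x \<in> I" "y \<in> J"
    then have "(d * x) * (e * y) \<in> int_ring F" using d(3) e(3) int_ring_closed(5)[OF assms(1)] by blast
    then show "d * e * (x * y) \<in> int_ring F" by (simp add: mult_ac)
  qed
  have 3: "ideal_mult I J \<noteq> {0}"
  proof
    assume "ideal_mult I J = {0}"
    then have "a * b = 0" using ideal_multI[OF a(1) b(1)] by (simp only: singleton_iff)
    then show False using a(2) b(2) by simp
  qed
  have 4: "a * z \<in> ideal_mult I J" if "a \<in> int_ring F" "z \<in> ideal_mult I J" for a z
    using ideal_mult_int_ring_closed[OF assms(1) frac_ideal_mult[OF assms(2)] that] .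
  have 5: "d * e \<in> int_ring F" "d * e \<noteq> 0" using d e int_ring_closed(5)[OF assms(1)] by auto
  show ?thesis
    unfolding frac_ideal_def
    using 1 2 3 4 5 int_complex.subspace_add[OF ideal_mult_subspace] int_complex.subspace_0[OF ideal_mult_subspace]
    by (intro conjI ballI bexI[of _ "d * e"]) simp_all
qed

text \<open>Two field elements compare \<open>I\<close> with the ring of integers, a denominator
  \<open>d\<close> and a nonzero member \<open>a\<close>; \<open>norm_multiple\<close> turns them
  into natural numbers.\<close>

lemma (in galois_subfield) frac_ideal_commensurable:
  assumes "free_lattice (int_ring F) y" "frac_ideal F I"
  shows "free_lattice.commensurable (int_ring F) I"
proof -
  obtain d where d: "d \<in> int_ring F" "d \<noteq> 0" "\<forall>x\<in>I. d * x \<in> int_ring F"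
    using assms(2) by (auto simp: frac_ideal_def)
  obtain a where a: "a \<in> I" "a \<noteq> 0" using assms(2) by (rule frac_ideal_nonzero)
  have da: "d * a \<in> int_ring F" "d * a \<noteq> 0" using a d by auto
  obtain n w where n: "0 < n" "w \<in> int_ring F" "d * a * w = of_nat n"
    using norm_multiple[OF da] by blast
  obtain m v where m: "0 < m" "v \<in> int_ring F" "d * v = of_nat m"
    using norm_multiple[OF d(1,2)] by blast
  note closed = int_ring_closed[OF F_subfield]
  show ?thesis
  proof (rule free_lattice.commensurableI[OF assms(1), of _ "n * m"])
    show "int_complex.subspace I" by (rule frac_ideal_subspace[OF F_subfield assms(2)])
    show "0 < n * m" using n m by simp
  next
    fix x assume x: "x \<in> int_ring F"
    have "(d * w * of_nat m * x) * a \<in> I"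
      using x n(2) d(1) by (intro frac_ideal_mult[OF assms(2)] closed a(1))
    also have "(d * w * of_nat m * x) * a = (d * a * w) * of_nat m * x" by (simp only: mult_ac)
    finally show "of_nat (n * m) * x \<in> I" by (simp add: n(3))
  next
    fix x assume "x \<in> I"
    then have "of_nat n * v * (d * x) \<in> int_ring F"
      using d(3) closed(5)[OF closed(5)[OF closed(7) m(2)]] by blast
    also have "of_nat n * v * (d * x) = of_nat n * (d * v) * x" by (simp only: mult_ac)
    finally show "of_nat (n * m) * x \<in> int_ring F" by (simp add: m(3))
  qed
qed

section \<open>Theta constants\<close>

lemma e2pi_add: "e2pi (x + y) = e2pi x * e2pi y"
  by (simp add: e2pi_def exp_add algebra_simps)

lemma e2pi_Ints: "x \<in> \<int> \<Longrightarrow> e2pi (of_real x) = 1"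
proof (elim Ints_cases)
  fix k assume "x = of_int k"
  then show ?thesis using exp_integer_2pi[of "of_int k"] by (simp add: e2pi_def mult_ac)
qed

lemma e2pi_power: "e2pi x ^ n = e2pi (of_nat n * x)"
  by (simp add: e2pi_def mult_ac flip: exp_of_nat_mult)

lemma inner_Ints:
  fixes u v :: "real ^ 'n"
  assumes "\<And>i. u $ i \<in> \<int>" "\<And>i. v $ i \<in> \<int>"
  shows "u \<bullet> v \<in> \<int>"
  unfolding inner_vec_def using assms by (auto intro!: Ints_sum)

lemma theta_shift_left:
  fixes \<alpha> :: "real ^ 'g::finite"
  assumes "\<And>i. \<alpha> $ i \<in> \<int>"
  shows "theta (r + \<alpha>) s Z = theta r s Z"
proof -
  define k where "k = (\<chi> i. \<lfloor>\<alpha> $ i\<rfloor>)"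
  have k: "of_int (k $ i) = \<alpha> $ i" for i using assms by (simp add: k_def)
  have bij: "bij_betw (\<lambda>n. n + k) UNIV UNIV"
    by (rule bij_betw_byWitness[of _ "\<lambda>n. n - k"]) auto
  have eq: "(\<chi> i. of_int ((n + k) $ i)) + r = (\<chi> i. of_int (n $ i)) + (r + \<alpha>)" for n :: "int ^ 'g"
    by (vector k[symmetric])
  show ?thesis
    unfolding theta_def by (subst infsum_reindex_bij_betw[OF bij, symmetric]) (simp only: eq)
qed

text \<open>In n + r the integral part pairs with \<beta> to an integer, so every term of the series
  picks up the same factor.\<close>

lemma theta_shift_right:
  fixes \<beta> :: "real ^ 'g::finite"
  assumes "\<And>i. \<beta> $ i \<in> \<int>"
  shows "theta r (s + \<beta>) Z = e2pi (of_real (r \<bullet> \<beta>)) * theta r s Z"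
proof -
  have "e2pi (w + of_real (x n \<bullet> (s + \<beta>))) = e2pi (of_real (r \<bullet> \<beta>)) * e2pi (w + of_real (x n \<bullet> s))"
    if "x = (\<lambda>n. (\<chi> i. of_int (n $ i)) + r)" for x w and n :: "int ^ 'g"
  proof -
    have "e2pi (of_real ((\<chi> i. of_int (n $ i)) \<bullet> \<beta>)) = 1"
      using assms by (intro e2pi_Ints inner_Ints) auto
    moreover have "w + of_real (x n \<bullet> (s + \<beta>)) =
        of_real (r \<bullet> \<beta>) + (w + of_real (x n \<bullet> s)) + of_real ((\<chi> i. of_int (n $ i)) \<bullet> \<beta>)"
      by (simp add: that inner_simps)
    ultimately show ?thesis by (simp only: e2pi_add) simp
  qed
  then show ?thesis
    unfolding theta_def Let_def by (simp flip: infsum_cmult_right')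
qed

text \<open>Every factor picked up by a shift is \<open>e2pi\<close> of an integer, as \<open>4N\<close> is a multiple of all
  denominators involved.\<close>

lemma Theta_num_shift:
  fixes \<alpha> \<beta> r s :: "real ^ 'g::finite"
  assumes "\<And>i. \<alpha> $ i \<in> \<int>" "\<And>i. \<beta> $ i \<in> \<int>"
    and "\<And>i. real N * r $ i \<in> \<int>" "\<And>i. real N * s $ i \<in> \<int>"
  shows "Theta_num N (r + \<alpha>) (s + \<beta>) Z = Theta_num N r s Z"
proof -
  have theta: "theta (a - (r + \<alpha>)) (b - (s + \<beta>)) Z ^ (4 * N * (2 ^ CARD('g) + 1)) =
      theta (a - r) (b - s) Z ^ (4 * N * (2 ^ CARD('g) + 1))"
    if "(a, b) \<in> half_chars (-1)" for a b
  proof -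
    define M :: nat where "M = 2 ^ CARD('g) + 1"
    have a: "2 * a $ i \<in> \<int>" for i
    proof -
      have "a $ i = 0 \<or> a $ i = 1 / 2" using that by (auto simp: half_chars_def)
      then have "2 * a $ i = 0 \<or> 2 * a $ i = 1" by auto
      then show ?thesis by (metis Ints_0 Ints_1)
    qed
    have "theta (a - (r + \<alpha>)) (b - (s + \<beta>)) Z = theta (a - r + - \<alpha>) (b - s + - \<beta>) Z"
      by (simp add: algebra_simps)
    also have "\<dots> = theta (a - r) (b - s + - \<beta>) Z"
      using assms(1) by (intro theta_shift_left) auto
    also have "\<dots> = e2pi (of_real ((a - r) \<bullet> - \<beta>)) * theta (a - r) (b - s) Z"
      using assms(2) by (intro theta_shift_right) auto
    finally have 1: "theta (a - (r + \<alpha>)) (b - (s + \<beta>)) Z =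
        e2pi (of_real ((a - r) \<bullet> - \<beta>)) * theta (a - r) (b - s) Z" .
    have "(real (4 * N * M) *\<^sub>R (a - r)) \<bullet> - \<beta> \<in> \<int>"
    proof (rule inner_Ints)
      fix i
      have "(real (4 * N * M) *\<^sub>R (a - r)) $ i =
          real (2 * N * M) * (2 * a $ i) - real (4 * M) * (real N * r $ i)"
        by (simp add: algebra_simps)
      also have "\<dots> \<in> \<int>" using a[of i] assms(3)[of i]
        by (intro Ints_diff) (auto simp del: of_nat_mult intro!: Ints_mult[OF Ints_of_nat])
      finally show "(real (4 * N * M) *\<^sub>R (a - r)) $ i \<in> \<int>" .
    qed (use assms(2) in auto)
    then have "e2pi (of_real ((a - r) \<bullet> - \<beta>)) ^ (4 * N * M) = 1"
      unfolding e2pi_power using e2pi_Ints by fastforce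
    then show ?thesis unfolding 1 power_mult_distrib M_def[symmetric] by simp
  qed
  \<comment> \<open>The exponent of the prefactor is bilinear in the two halves of the
    characteristic. In its increment the factor \<open>N\<close> makes the mixed terms integral, and
    \<open>c\<close> collects the integer factors that remain.\<close>
  define c :: real where "c = 2 ^ CARD('g) * (2 ^ CARD('g) - 1) * (2 ^ CARD('g) + 1)"
  have c: "c \<in> \<int>" by (auto simp: c_def intro!: Ints_mult Ints_diff Ints_add)
  have "(real N *\<^sub>R r) \<bullet> \<beta> \<in> \<int>" "\<alpha> \<bullet> (real N *\<^sub>R s) \<in> \<int>" "\<alpha> \<bullet> \<beta> \<in> \<int>"
    using assms by (auto simp del: inner_scaleR_left inner_scaleR_right intro!: inner_Ints)
  then have d: "- (c * ((real N *\<^sub>R r) \<bullet> \<beta> + \<alpha> \<bullet> (real N *\<^sub>R s) + real N * (\<alpha> \<bullet> \<beta>))) \<in> \<int>"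
    using c by (intro Ints_minus Ints_mult Ints_add) auto
  have "- (2 ^ CARD('g) * real N * (2 ^ CARD('g) - 1) * (2 ^ CARD('g) + 1) * ((r + \<alpha>) \<bullet> (s + \<beta>))) =
      - (2 ^ CARD('g) * real N * (2 ^ CARD('g) - 1) * (2 ^ CARD('g) + 1) * (r \<bullet> s)) +
      - (c * ((real N *\<^sub>R r) \<bullet> \<beta> + \<alpha> \<bullet> (real N *\<^sub>R s) + real N * (\<alpha> \<bullet> \<beta>)))"
    by (simp add: c_def inner_simps algebra_simps)
  then have pre: "e2pi (of_real (- (2 ^ CARD('g) * real N * (2 ^ CARD('g) - 1) * (2 ^ CARD('g) + 1) * ((r + \<alpha>) \<bullet> (s + \<beta>))))) =
     e2pi (of_real (- (2 ^ CARD('g) * real N * (2 ^ CARD('g) - 1) * (2 ^ CARD('g) + 1) * (r \<bullet> s))))"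
    using e2pi_Ints[OF d] by (simp only: of_real_add e2pi_add) simp
  have "(\<Prod>(a, b)\<in>half_chars (-1). theta (a - (r + \<alpha>)) (b - (s + \<beta>)) Z ^ (4 * N * (2 ^ CARD('g) + 1))) =
     (\<Prod>(a, b)\<in>half_chars (-1). theta (a - r) (b - s) Z ^ (4 * N * (2 ^ CARD('g) + 1)))"
    by (intro prod.cong refl) (use theta in auto)
  then show ?thesis unfolding Theta_num_def pre by (simp only:)
qed

section \<open>The reflex norm of an ideal\<close>

context cm_reflex
begin

abbreviation "K' \<equiv> reflex_field L K \<Phi>"

sublocale R: galois_subfield L "reflex_group L K \<Phi>"
  by unfold_locales (use reflex_group_Gal in blast)

lemma reflex_field_fixed: "K' = fixed_field L (reflex_group L K \<Phi>)"
  by (simp add: reflex_field_def)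

lemma reflex_subfield: "complex_subfield K'"
  unfolding reflex_field_fixed by (rule R.F_subfield)

lemma reflex_field_L: "K' \<subseteq> L"
  unfolding reflex_field_fixed by (rule R.F_L)

lemma type_algebraic_int: "\<phi> \<in> \<Phi> \<Longrightarrow> x \<in> int_ring K \<Longrightarrow> \<phi> x \<in> int_ring L"
  using embedding_algebraic_int[OF K_subfield type_embeddings] type_closed by (simp add: int_ring_def)

lemma reflex_norm_algebraic_int:
  assumes "x \<in> int_ring K" shows "reflex_norm x \<in> int_ring K'"
proof -
  have "algebraic_int (reflex_norm x)"
    unfolding reflex_norm_def using type_algebraic_int assms
    by (intro algebraic_int_prod) (auto simp: int_ring_def)
  then show ?thesis using reflex_norm_reflex_field assms by (simp add: int_ring_def)
qed

lemma reflex_norm_one: "reflex_norm 1 = 1"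
  unfolding reflex_norm_def using field_embedding.one[OF type_field_embedding] by (intro prod.neutral) blast

text \<open>The predicate under the definite description. Lemmas stated for any ideal satisfying it
  stay separate from the question of existence.\<close>

definition is_reflex_norm_ideal :: "complex set \<Rightarrow> complex set \<Rightarrow> bool" where
  "is_reflex_norm_ideal \<aa> \<bb> \<longleftrightarrow>
     frac_ideal K' \<bb> \<and> ideal_ext L \<bb> = ideal_prod \<Phi> (\<lambda>\<phi>. ideal_ext L (\<phi> ` \<aa>))"

lemma reflex_norm_ideal_The: "reflex_norm_ideal L K \<Phi> \<aa> = (THE \<bb>. is_reflex_norm_ideal \<aa> \<bb>)"
  by (simp add: reflex_norm_ideal_def is_reflex_norm_ideal_def)

lemma is_reflex_norm_ideal_scale:
  assumes "\<aa> \<subseteq> K" "\<alpha> \<in> int_ring K" "\<beta> \<in> int_ring K" "\<alpha> \<noteq> 0" "\<beta> \<noteq> 0"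
    and "is_reflex_norm_ideal \<aa> \<bb>"
  shows "is_reflex_norm_ideal ((\<lambda>x. \<alpha> / \<beta> * x) ` \<aa>) ((\<lambda>x. reflex_norm (\<alpha> / \<beta>) * x) ` \<bb>)"
proof -
  define \<nu> where "\<nu> = \<alpha> / \<beta>"
  have K: "\<alpha> \<in> K" "\<beta> \<in> K" using assms int_ring_subset by auto
  then have nu: "\<nu> \<in> K" "\<nu> \<noteq> 0" using assms(4,5) subfieldD(6)[OF K_subfield] by (auto simp: \<nu>_def)
  have "reflex_norm \<beta> * reflex_norm \<nu> = reflex_norm \<alpha>"
    using K reflex_norm_divide[OF K] reflex_norm_nonzero[OF K(2) assms(5)] by (simp add: \<nu>_def)
  then have "\<exists>e\<in>int_ring K'. e \<noteq> 0 \<and> e * reflex_norm \<nu> \<in> int_ring K'"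
    using reflex_norm_algebraic_int[OF assms(2)] reflex_norm_algebraic_int[OF assms(3)]
      reflex_norm_nonzero[OF K(2) assms(5)] by (intro bexI[of _ "reflex_norm \<beta>"]) auto
  then have 1: "frac_ideal K' ((\<lambda>x. reflex_norm \<nu> * x) ` \<bb>)"
    using assms(6) nu reflex_norm_nonzero reflex_norm_reflex_field
    by (intro frac_ideal_scale reflex_subfield) (auto simp: is_reflex_norm_ideal_def)
  have "\<phi> ` ((\<lambda>x. \<nu> * x) ` \<aa>) = (\<lambda>x. \<phi> \<nu> * x) ` (\<phi> ` \<aa>)" if "\<phi> \<in> \<Phi>" for \<phi>
    unfolding image_image using assms(1) nu(1)
    by (intro image_cong refl) (simp add: field_embedding.mult[OF type_field_embedding[OF that]] subsetD)
  then have "ideal_ext L (\<phi> ` ((\<lambda>x. \<nu> * x) ` \<aa>)) = (\<lambda>x. \<phi> \<nu> * x) ` ideal_ext L (\<phi> ` \<aa>)" if "\<phi> \<in> \<Phi>" for \<phi>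
    using that by (simp only: ideal_ext_scale)
  then have "ideal_prod \<Phi> (\<lambda>\<phi>. ideal_ext L (\<phi> ` ((\<lambda>x. \<nu> * x) ` \<aa>))) =
      ideal_prod \<Phi> (\<lambda>\<phi>. (\<lambda>x. \<phi> \<nu> * x) ` ideal_ext L (\<phi> ` \<aa>))"
    \<comment> \<open>The two families agree on \<Phi> only, and \<open>ideal_prod\<close> reads no
      other values.\<close>
    unfolding ideal_prod_def by (intro arg_cong[of _ _ int_complex.span] Collect_cong ex_cong1) auto
  also have "\<dots> = (\<lambda>x. reflex_norm \<nu> * x) ` ideal_prod \<Phi> (\<lambda>\<phi>. ideal_ext L (\<phi> ` \<aa>))"
    unfolding reflex_norm_def by (rule ideal_prod_scale[OF finite_type])
  also have "\<dots> = ideal_ext L ((\<lambda>x. reflex_norm \<nu> * x) ` \<bb>)"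
    using assms(6) by (simp only: is_reflex_norm_ideal_def ideal_ext_scale)
  finally show ?thesis using 1 by (simp only: is_reflex_norm_ideal_def \<nu>_def)
qed

lemma is_reflex_norm_ideal_integral:
  assumes "is_reflex_norm_ideal \<aa> \<bb>" "\<aa> \<subseteq> int_ring K"
  shows "\<bb> \<subseteq> int_ring K'"
proof -
  note subL = int_ring_subspace[OF L_subfield]
  have "ideal_ext L (\<phi> ` \<aa>) \<subseteq> int_ring L" if "\<phi> \<in> \<Phi>" for \<phi>
    unfolding ideal_ext_def using assms(2) type_algebraic_int[OF that] int_ring_closed(5)[OF L_subfield]
    by (intro ideal_mult_subset subL) blast
  then have "(\<Prod>\<phi>\<in>\<Phi>. x \<phi>) \<in> int_ring L" if "\<forall>\<phi>\<in>\<Phi>. x \<phi> \<in> ideal_ext L (\<phi> ` \<aa>)" for x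
    using that subfield_prod[OF L_subfield, of \<Phi> x]
    by (auto simp: int_ring_def intro!: algebraic_int_prod)
  then have "ideal_ext L \<bb> \<subseteq> int_ring L"
    using assms(1) unfolding is_reflex_norm_ideal_def ideal_prod_def
    by (simp only:) (intro int_complex.span_minimal subL, auto)
  moreover have "\<bb> \<subseteq> ideal_ext L \<bb>" by (rule ideal_ext_superset[OF L_subfield])
  moreover have "\<bb> \<subseteq> K'" using assms(1) frac_ideal_subset by (simp add: is_reflex_norm_ideal_def)
  ultimately show ?thesis unfolding int_ring_def by blast
qed

end

section \<open>The lattice and the polarization attached to an ideal\<close>

locale siegel_data = cm_reflex +
  fixes \<psi> :: "'g::finite \<Rightarrow> complex \<Rightarrow> complex" and \<xi> :: complex and \<ff>\<^sub>0 :: "complex set"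
  assumes psi: "bij_betw \<psi> UNIV (reflex_type L K \<Phi>)"
    and C1: "principally_polarizable (Psi \<psi> ` int_ring K')"
    and P2: "riemann_form (Psi \<psi> ` int_ring K') (E_form \<psi> \<xi>)"
    and f0: "integral_ideal (type_fixed_field L K \<Phi>) \<ff>\<^sub>0"
begin

lemma psi_reflex_type: "\<psi> j \<in> reflex_type L K \<Phi>"
  using psi by (auto simp: bij_betw_def)

lemma psi_field_embedding: "field_embedding K' (\<psi> j)"
proof
  show "complex_subfield K'" by (rule reflex_subfield)
  obtain \<tau> where t: "\<tau> \<in> carrier G" "\<psi> j = restrict \<tau> K'" using reflex_type_lift[OF psi_reflex_type] .
  interpret field_embedding L \<tau> using Gal_field_embedding[OF t(1)] .
  show "\<psi> j \<in> embeddings K'"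
    unfolding t(2) using reflex_field_L
    by (intro restrict_embedding[of K' L] reflex_subfield add mult) auto
qed

lemma Psi_inject: "x \<in> K' \<Longrightarrow> y \<in> K' \<Longrightarrow> Psi \<psi> x = Psi \<psi> y \<longleftrightarrow> x = y"
  using field_embedding.inj[OF psi_field_embedding] by (auto simp: Psi_def vec_eq_iff inj_on_def)

lemma Psi_combination:
  assumes "\<And>j. j \<in> A \<Longrightarrow> y j \<in> K'"
  shows "Psi \<psi> (\<Sum>j\<in>A. of_int (r j) * y j) = (\<Sum>j\<in>A. of_int (r j) *s Psi \<psi> (y j))"
  using assms subfield_of_int[OF reflex_subfield] subfieldD(5)[OF reflex_subfield]
  by (simp add: Psi_def vec_eq_iff field_embedding.sum[OF psi_field_embedding]
      field_embedding.mult[OF psi_field_embedding] field_embedding.of_int[OF psi_field_embedding])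

lemma combination_reflex_field:
  "(\<And>j. j \<in> A \<Longrightarrow> y j \<in> K') \<Longrightarrow> (\<Sum>j\<in>A. of_int (r j) * y j) \<in> K'"
  by (intro subfield_sum subfieldD(5)[OF reflex_subfield]
      subfield_of_int reflex_subfield)

lemma Z_basis_Psi:
  fixes y :: "'i::finite \<Rightarrow> complex"
  assumes "Z_basis (Psi \<psi> ` \<Lambda>) (\<lambda>j. Psi \<psi> (y j))" "\<Lambda> \<subseteq> K'" "\<And>j. y j \<in> \<Lambda>" "x \<in> \<Lambda>"
  shows "\<exists>!r::'i \<Rightarrow> int. x = (\<Sum>j\<in>UNIV. of_int (r j) * y j)"
proof -
  have yK: "y j \<in> K'" for j using assms(2,3) by blast
  have "\<exists>!r::'i \<Rightarrow> int. Psi \<psi> x = (\<Sum>j\<in>UNIV. of_int (r j) *s Psi \<psi> (y j))"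
    using assms(1,4) by (auto simp: Z_basis_def)
  moreover have "Psi \<psi> x = (\<Sum>j\<in>UNIV. of_int (r j) *s Psi \<psi> (y j)) \<longleftrightarrow>
      x = (\<Sum>j\<in>UNIV. of_int (r j) * y j)" for r :: "'i \<Rightarrow> int"
  proof -
    have "Psi \<psi> x = (\<Sum>j\<in>UNIV. of_int (r j) *s Psi \<psi> (y j)) \<longleftrightarrow>
        Psi \<psi> x = Psi \<psi> (\<Sum>j\<in>UNIV. of_int (r j) * y j)"
      using Psi_combination[of UNIV y r] yK by simp
    also have "\<dots> \<longleftrightarrow> x = (\<Sum>j\<in>UNIV. of_int (r j) * y j)"
      using assms(2,4) combination_reflex_field[of UNIV y r] yK by (intro Psi_inject) auto
    finally show ?thesis .
  qed
  ultimately show ?thesis by simp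
qed

text \<open>The symplectic basis of the principal polarization is pulled back along \<Psi>. It
  replaces the usual argument by discriminants, and its index type fixes the rank as 2g.\<close>

lemma integral_basis:
  obtains y :: "'g + 'g \<Rightarrow> complex" where "free_lattice (int_ring K') y"
proof -
  obtain b :: "'g + 'g \<Rightarrow> complex ^ 'g" where b: "Z_basis (Psi \<psi> ` int_ring K') b"
    using C1 by (auto simp: principally_polarizable_def symplectic_basis_def)
  then have "\<forall>j. \<exists>y\<in>int_ring K'. b j = Psi \<psi> y" unfolding Z_basis_def by blast
  then obtain y where y: "\<And>j. y j \<in> int_ring K'" "\<And>j. b j = Psi \<psi> (y j)" by metis
  have "b = (\<lambda>j. Psi \<psi> (y j))" using y(2) by blast
  then have "free_lattice (int_ring K') y"
    using b y(1) int_ring_subspace[OF reflex_subfield]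
    by (intro free_lattice.intro Z_basis_Psi[of "int_ring K'"]) (simp_all add: int_ring_subset)
  then show ?thesis using that by blast
qed

lemma ideal_invertible:
  assumes "frac_ideal K' I"
  shows "1 \<in> ideal_mult I (ideal_inv K' I)"
proof -
  obtain y :: "'g + 'g \<Rightarrow> complex" where "free_lattice (int_ring K') y" using integral_basis .
  then interpret free_lattice "int_ring K'" y .
  have "int_ring K' = int_complex.span (range y)"
  proof (intro equalityI subsetI)
    fix x assume "x \<in> int_ring K'"
    then obtain r :: "'g + 'g \<Rightarrow> int" where "x = (\<Sum>i\<in>UNIV. of_int (r i) * y i)" using basis by blast
    then show "x \<in> int_complex.span (range y)"
      by (simp only:) (intro int_complex.span_sum int_complex.span_scale int_complex.span_base rangeI)
  next
    have "int_complex.span (range y) \<subseteq> int_ring K'"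
      using basis_mem subspace by (intro int_complex.span_minimal) auto
    then show "x \<in> int_ring K'" if "x \<in> int_complex.span (range y)" for x using that by (rule subsetD)
  qed
  then show ?thesis
    using R.ideal_invertible[of "range y" I] assms unfolding reflex_field_fixed by simp
qed

lemma is_reflex_norm_ideal_unique:
  assumes "is_reflex_norm_ideal \<aa> \<bb>" "is_reflex_norm_ideal \<aa> \<bb>'"
  shows "\<bb> = \<bb>'"
  using assms ideal_ext_inject[OF reflex_subfield reflex_field_L L_subfield ideal_invertible]
  by (simp add: is_reflex_norm_ideal_def)

lemma reflex_norm_ideal_eq: "is_reflex_norm_ideal \<aa> \<bb> \<Longrightarrow> reflex_norm_ideal L K \<Phi> \<aa> = \<bb>"
  unfolding reflex_norm_ideal_The by (rule the_equality) (assumption, rule is_reflex_norm_ideal_unique)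

section \<open>Congruences modulo the conductor\<close>

abbreviation "\<ff>' \<equiv> ideal_ext K' \<ff>\<^sub>0"

lemma f0_subset: "\<ff>\<^sub>0 \<subseteq> int_ring (type_fixed_field L K \<Phi>)" "\<ff>\<^sub>0 \<subseteq> int_ring K'"
proof -
  show "\<ff>\<^sub>0 \<subseteq> int_ring (type_fixed_field L K \<Phi>)" using f0 by (simp add: integral_ideal_def)
  then show "\<ff>\<^sub>0 \<subseteq> int_ring K'" using type_fixed_field_reflex_field by (auto simp: int_ring_def)
qed

lemma f'_subset: "\<ff>' \<subseteq> int_ring K'"
  unfolding ideal_ext_def using f0_subset(2) int_ring_closed(5)[OF reflex_subfield]
  by (intro ideal_mult_subset int_ring_subspace reflex_subfield) blast

lemma f'_subspace: "int_complex.subspace \<ff>'"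
  unfolding ideal_ext_def by (rule ideal_mult_subspace)

lemma f'_frac_ideal: "frac_ideal K' \<ff>'"
proof -
  have "\<ff>\<^sub>0 \<noteq> {0}" "0 \<in> \<ff>\<^sub>0" using f0 by (auto simp: integral_ideal_def frac_ideal_def)
  then have "\<ff>' \<noteq> {0}" using ideal_ext_superset[OF reflex_subfield] by blast
  moreover have "\<ff>' \<subseteq> K'" using f'_subset int_ring_subset by blast
  ultimately show ?thesis
    unfolding frac_ideal_def
    using int_complex.subspace_add[OF f'_subspace] int_complex.subspace_0[OF f'_subspace]
      ideal_ext_closed[OF reflex_subfield] int_ring_closed(2)[OF reflex_subfield] f'_subset
    by (intro conjI ballI bexI[of _ 1]) auto
qed

abbreviation "\<ff>L \<equiv> ideal_ext L \<ff>'"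

lemma fL_subspace: "int_complex.subspace \<ff>L"
  unfolding ideal_ext_def by (rule ideal_mult_subspace)

lemma fL_closed: "a \<in> int_ring L \<Longrightarrow> z \<in> \<ff>L \<Longrightarrow> a * z \<in> \<ff>L"
  by (rule ideal_ext_closed[OF L_subfield])

text \<open>A lift \<sigma> of \<phi> fixes \<open>type_fixed_field L K \<Phi>\<close> pointwise,
  hence every element of \<open>\<ff>\<^sub>0\<close>. A generator \<open>x * y\<close> with
  \<open>x\<close> in \<open>\<ff>\<^sub>0\<close> is therefore sent to an integral multiple of the
  same \<open>x\<close>.\<close>

lemma type_conductor:
  assumes "\<phi> \<in> \<Phi>" "w \<in> ideal_ext K \<ff>\<^sub>0" "w \<in> K"
  shows "\<phi> w \<in> \<ff>L"
proof -
  obtain \<sigma> where s: "\<sigma> \<in> type_lifts L K \<Phi>" "\<And>x. x \<in> K \<Longrightarrow> \<phi> x = \<sigma> x" using type_lift[OF assms(1)] by metis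
  interpret field_embedding L \<sigma> using Gal_field_embedding[OF type_lifts_Gal[OF s(1)]] .
  have gen: "x * y \<in> L \<and> \<sigma> (x * y) \<in> \<ff>L" if "x \<in> \<ff>\<^sub>0" "y \<in> int_ring K" for x y
  proof -
    have x: "x \<in> type_fixed_field L K \<Phi>" using f0_subset(1) that(1) int_ring_subset by blast
    have y: "y \<in> K" "y \<in> L" using that(2) int_ring_subset K_L by auto
    have "\<sigma> (x * y) = \<phi> y * x"
      using type_fixed_field_lifts[OF x s(1)] y s(2) by (simp add: mult)
    moreover have "x \<in> \<ff>L"
      using that(1) ideal_ext_superset[OF reflex_subfield] ideal_ext_superset[OF L_subfield] by blast
    ultimately have "\<sigma> (x * y) \<in> \<ff>L" using fL_closed[OF type_algebraic_int[OF assms(1) that(2)]] by simp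
    then show ?thesis using type_fixed_field_lifts(2)[OF x s(1)] y subfieldD(5)[OF L_subfield] by blast
  qed
  have "w \<in> L \<and> \<sigma> w \<in> \<ff>L"
    using assms(2) unfolding ideal_ext_def[of K] ideal_mult_def[of \<ff>\<^sub>0 "int_ring K"]
  proof (induction rule: int_complex.span_induct_alt)
    case base
    show ?case using subfieldD(1)[OF L_subfield] int_complex.subspace_0[OF fL_subspace] by simp
  next
    case (step c z v)
    then have z: "z \<in> L" "\<sigma> z \<in> \<ff>L" using gen by auto
    have cz: "of_int c * z \<in> L" "\<sigma> (of_int c * z) = of_int c * \<sigma> z"
      using z subfield_of_int[OF L_subfield] subfieldD(5)[OF L_subfield] by (simp_all add: mult of_int)
    have "of_int c * \<sigma> z + \<sigma> v \<in> \<ff>L"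
      using step.IH z by (intro int_complex.subspace_add[OF fL_subspace] int_complex.subspace_scale[OF fL_subspace]) auto
    then show ?case using step.IH cz subfieldD(3)[OF L_subfield] by (simp add: add)
  qed
  then show ?thesis using s(2)[OF assms(3)] by simp
qed

lemma prod_cong_conductor:
  assumes "finite A" "\<And>i. i \<in> A \<Longrightarrow> u i \<in> int_ring L" "\<And>i. i \<in> A \<Longrightarrow> v i \<in> int_ring L"
    and "\<And>i. i \<in> A \<Longrightarrow> u i - v i \<in> \<ff>L"
  shows "(\<Prod>i\<in>A. u i) - (\<Prod>i\<in>A. v i) \<in> \<ff>L"
  using assms
proof (induction A rule: finite_induct)
  case empty
  show ?case using int_complex.subspace_0[OF fL_subspace] by simp
next
  case (insert i A)
  have "(\<Prod>i\<in>A. v i) \<in> int_ring L"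
    using insert.prems(2) subfield_prod[OF L_subfield, of A v]
    by (auto simp: int_ring_def intro!: algebraic_int_prod)
  moreover have "u i \<in> int_ring L" "u i - v i \<in> \<ff>L" "(\<Prod>i\<in>A. u i) - (\<Prod>i\<in>A. v i) \<in> \<ff>L"
    using insert by auto
  ultimately have "u i * ((\<Prod>i\<in>A. u i) - (\<Prod>i\<in>A. v i)) + (\<Prod>i\<in>A. v i) * (u i - v i) \<in> \<ff>L"
    by (intro int_complex.subspace_add[OF fL_subspace] fL_closed)
  also have "u i * ((\<Prod>i\<in>A. u i) - (\<Prod>i\<in>A. v i)) + (\<Prod>i\<in>A. v i) * (u i - v i) =
      (\<Prod>i\<in>insert i A. u i) - (\<Prod>i\<in>insert i A. v i)"
    using insert.hyps by (simp add: algebra_simps)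
  finally show ?case .
qed

text \<open>The factors, one for each member of the type, are congruent in L, and so are their
  products. Both products lie in the reflex field, and contraction of the invertible ideal
  \<open>\<ff>'\<close> brings the congruence back there.\<close>

lemma reflex_norm_cong:
  assumes "x \<in> int_ring K" "y \<in> int_ring K" "x - y \<in> ideal_ext K \<ff>\<^sub>0"
  shows "reflex_norm x - reflex_norm y \<in> \<ff>'"
proof (rule ideal_ext_contract[OF reflex_subfield reflex_field_L L_subfield f'_frac_ideal
      ideal_invertible[OF f'_frac_ideal]])
  have "x \<in> K" "y \<in> K" using assms int_ring_subset by auto
  then have xy: "x \<in> K" "y \<in> K" "x - y \<in> K" using subfieldD(4)[OF K_subfield] by auto
  show "reflex_norm x - reflex_norm y \<in> K'"
    using xy reflex_norm_reflex_field subfieldD(4)[OF reflex_subfield] by blast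
  have "\<phi> x - \<phi> y \<in> \<ff>L" if "\<phi> \<in> \<Phi>" for \<phi>
    using type_conductor[OF that assms(3) xy(3)] xy by (simp add: field_embedding.diff[OF type_field_embedding[OF that]])
  then show "reflex_norm x - reflex_norm y \<in> \<ff>L"
    unfolding reflex_norm_def using assms type_algebraic_int by (intro prod_cong_conductor finite_type)
qed

text \<open>The ideal \<open>(\<phi>(\<nu>) - 1) \<phi>(\<cc>)\<close> is integral, and it is contained in \<open>\<ff>'\<close> because the denominator of
  \<open>\<phi>(\<nu>)\<close> is invertible modulo \<open>\<ff>'\<close>.\<close>

lemma reflex_norm_minus_one:
  assumes c: "\<cc> \<subseteq> int_ring K" "(\<lambda>x. \<alpha> / \<beta> * x) ` \<cc> \<subseteq> int_ring K"
    and b: "is_reflex_norm_ideal \<cc> \<bb>"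
    and ab: "\<alpha> \<in> int_ring K" "\<beta> \<in> int_ring K" "\<alpha> \<noteq> 0" "\<beta> \<noteq> 0" "\<alpha> - \<beta> \<in> ideal_ext K \<ff>\<^sub>0"
    and u: "u \<in> int_ring K" "\<beta> * u - 1 \<in> ideal_ext K \<ff>\<^sub>0"
  shows "reflex_norm (\<alpha> / \<beta>) - 1 \<in> ideal_mult \<ff>' (ideal_inv K' \<bb>)"
proof -
  define A B U where "A = reflex_norm \<alpha>" and "B = reflex_norm \<beta>" and "U = reflex_norm u"
  note subK' = reflex_subfield
  have K: "\<alpha> \<in> K" "\<beta> \<in> K" "u \<in> K" using ab u int_ring_subset by auto
  have int: "A \<in> int_ring K'" "B \<in> int_ring K'" "U \<in> int_ring K'"
    using reflex_norm_algebraic_int ab u by (auto simp: A_def B_def U_def)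
  have B0: "B \<noteq> 0" using reflex_norm_nonzero[OF K(2) ab(4)] by (simp add: B_def)
  have lam: "reflex_norm (\<alpha> / \<beta>) = A / B" using reflex_norm_divide[OF K(1,2)] by (simp add: A_def B_def)
  have AB: "A - B \<in> \<ff>'" unfolding A_def B_def using ab by (intro reflex_norm_cong)
  have BU: "B * U - 1 \<in> \<ff>'"
    using reflex_norm_cong[OF _ _ u(2)] ab u int_ring_closed(2,5)[OF K_subfield] K
    by (simp add: B_def U_def reflex_norm_mult reflex_norm_one)
  have frac: "frac_ideal K' \<bb>" using b by (simp add: is_reflex_norm_ideal_def)
  have b_int: "\<bb> \<subseteq> int_ring K'" using is_reflex_norm_ideal_integral[OF b c(1)] .
  have "c \<in> K" if "c \<in> \<cc>" for c using c(1) that int_ring_subset by blast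
  then have "is_reflex_norm_ideal ((\<lambda>x. \<alpha> / \<beta> * x) ` \<cc>) ((\<lambda>x. A / B * x) ` \<bb>)"
    unfolding lam[symmetric] using ab b by (intro is_reflex_norm_ideal_scale) auto
  \<comment> \<open>Integrality of the scaled ideal enters here: together with that of
    \<open>\<bb>\<close> it makes \<open>(A / B - 1) * x\<close> integral for all \<open>x\<close>
    in \<open>\<bb>\<close>.\<close>
  then have lb_int: "(\<lambda>x. A / B * x) ` \<bb> \<subseteq> int_ring K'"
    using c(2) by (rule is_reflex_norm_ideal_integral)
  have key: "(A / B - 1) * x \<in> \<ff>'" if x: "x \<in> \<bb>" for x
  proof -
    define z where "z = (A / B - 1) * x"
    have xi: "x \<in> int_ring K'" using b_int x by blast
    have "A / B * x \<in> int_ring K'" using lb_int x by blast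
    then have z: "z \<in> int_ring K'"
      using int_ring_closed(4)[OF subK' _ xi] by (simp add: z_def algebra_simps)
    have "x * (A - B) \<in> \<ff>'" using xi AB by (rule ideal_ext_closed[OF subK'])
    moreover have "x * (A - B) = B * z" using B0 by (simp add: z_def field_simps)
    ultimately have "B * z \<in> \<ff>'" by simp
    \<comment> \<open>\<open>U\<close> inverts \<open>B\<close> modulo \<open>\<ff>'\<close>, so
      \<open>B * z\<close> in \<open>\<ff>'\<close> forces \<open>z\<close> itself into it.\<close>
    then have "U * (B * z) - z * (B * U - 1) \<in> \<ff>'"
      using ideal_ext_closed[OF subK' int(3)] ideal_ext_closed[OF subK' z BU]
      by (intro int_complex.subspace_diff[OF f'_subspace])
    moreover have "U * (B * z) - z * (B * U - 1) = z" by (simp add: algebra_simps)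
    ultimately show ?thesis by (simp add: z_def)
  qed
  \<comment> \<open>Multiplication by the inverse of \<open>\<bb>\<close>, with \<open>1\<close>
    written in the product of the two ideals.\<close>
  have "(A / B - 1) * 1 \<in> ideal_mult \<ff>' (ideal_inv K' \<bb>)"
  proof (rule mult_ideal_mult[OF _ ideal_mult_subspace ideal_invertible[OF frac]])
    fix x y assume "x \<in> \<bb>" "y \<in> ideal_inv K' \<bb>"
    then have "((A / B - 1) * x) * y \<in> ideal_mult \<ff>' (ideal_inv K' \<bb>)" using key by (intro ideal_multI)
    then show "(A / B - 1) * (x * y) \<in> ideal_mult \<ff>' (ideal_inv K' \<bb>)" by (simp only: mult.assoc)
  qed
  then show ?thesis by (simp add: lam)
qed

section \<open>Scaling of norms and of Siegel values\<close>

lemma card_reflex_type: "card (reflex_type L K \<Phi>) = CARD('g)"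
  using bij_betw_same_card[OF psi] by simp

text \<open>The lattice has rank 2g, so \<open>gen_index_scale_conjugation\<close> determines the
  square of the norm with exponent 2g. Norms are nonnegative, so the root can be taken, which leaves
  exponent g.\<close>

lemma abs_norm_scale:
  assumes "frac_ideal K' I" "frac_ideal K' ((\<lambda>x. c * x) ` int_ring K')"
    and "0 < p" "0 < q" "c * cnj c = of_nat p / of_nat q"
  shows "abs_norm K' ((\<lambda>x. c * x) ` I) = (real p / real q) ^ CARD('g) * abs_norm K' I"
proof -
  obtain y :: "'g + 'g \<Rightarrow> complex" where y: "free_lattice (int_ring K') y" using integral_basis .
  then interpret free_lattice "int_ring K'" y .
  have com: "commensurable J" if "frac_ideal K' J" for J
    using R.frac_ideal_commensurable[of y J] y that unfolding reflex_field_fixed by simp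
  have "cnj x \<in> int_ring K'" if "x \<in> int_ring K'" for x
    using that reflex_field_cnj by (simp add: int_ring_def)
  then have "cnj ` int_ring K' = int_ring K'" by (auto simp: image_iff) (metis complex_cnj_cnj)
  from gen_index_scale_conjugation[OF this assms(3-5) com[OF assms(2)] com[OF assms(1)]]
  have "(abs_norm K' ((\<lambda>x. c * x) ` I))\<^sup>2 = ((real p / real q) ^ CARD('g) * abs_norm K' I)\<^sup>2"
    by (simp add: abs_norm_eq_gen_index power_mult_distrib power_add power2_eq_square)
  then show ?thesis
    by (rule power2_eq_imp_eq) (auto simp: abs_norm_def)
qed

lemma siegel_mult_scale:
  assumes "0 < p" "0 < q"
    and "abs_norm K' (ideal_mult (ideal_inv K' \<ff>') (reflex_norm_ideal L K \<Phi> \<cc>')) =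
      (real p / real q) ^ CARD('g) * abs_norm K' (ideal_mult (ideal_inv K' \<ff>') (reflex_norm_ideal L K \<Phi> \<cc>))"
  shows "siegel_mult L K \<Phi> \<ff>\<^sub>0 \<cc>' = real p / real q * siegel_mult L K \<Phi> \<ff>\<^sub>0 \<cc>"
  unfolding siegel_mult_def assms(3) card_reflex_type using assms(1,2)
  by (simp add: real_root_mult real_root_power_cancel)

text \<open>One inclusion is enough, since swapping \<alpha> and \<beta> exchanges the roles of the
  two ideals. Given data for \<open>\<cc>\<close>, the witnesses for the scaled ideal are the basis
  \<open>b''\<close>, its preimage \<open>y'\<close> and the coordinates \<open>r'\<close>.\<close>

lemma siegel_values_subset:
  assumes c: "\<cc> \<subseteq> int_ring K" "(\<lambda>x. \<alpha> / \<beta> * x) ` \<cc> \<subseteq> int_ring K"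
    and b: "is_reflex_norm_ideal \<cc> \<bb>"
    and ab: "\<alpha> \<in> int_ring K" "\<beta> \<in> int_ring K" "\<alpha> \<noteq> 0" "\<beta> \<noteq> 0" "\<alpha> - \<beta> \<in> ideal_ext K \<ff>\<^sub>0"
    and u: "u \<in> int_ring K" "\<beta> * u - 1 \<in> ideal_ext K \<ff>\<^sub>0"
  shows "siegel_values \<psi> \<xi> L K \<Phi> \<ff>\<^sub>0 \<cc> \<subseteq> siegel_values \<psi> \<xi> L K \<Phi> \<ff>\<^sub>0 ((\<lambda>x. \<alpha> / \<beta> * x) ` \<cc>)"
proof
  define \<cc>' where "\<cc>' = (\<lambda>x. \<alpha> / \<beta> * x) ` \<cc>"
  define \<nu> where "\<nu> = \<alpha> / \<beta>"
  define \<mu> where "\<mu> = reflex_norm \<nu>"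
  note subK' = reflex_subfield
  have K: "\<alpha> \<in> K" "\<beta> \<in> K" using ab int_ring_subset by auto
  then have nu: "\<nu> \<in> K" "\<nu> \<noteq> 0" using ab subfieldD(6)[OF K_subfield] by (auto simp: \<nu>_def)
  have lam: "\<mu> \<in> K'" "\<mu> \<noteq> 0"
    using reflex_norm_reflex_field reflex_norm_nonzero nu by (auto simp: \<mu>_def)
  obtain p q :: nat where pq: "0 < p" "0 < q" "\<mu> * cnj \<mu> = of_nat p / of_nat q"
    using reflex_norm_mult_cnj_pos[OF nu] unfolding \<mu>_def .
  have cK: "\<cc> \<subseteq> K" using c(1) int_ring_subset by blast
  have b': "is_reflex_norm_ideal \<cc>' ((\<lambda>x. \<mu> * x) ` \<bb>)"
    unfolding \<cc>'_def \<mu>_def \<nu>_def using cK ab b by (intro is_reflex_norm_ideal_scale)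
  have frac: "frac_ideal K' \<bb>" using b by (simp add: is_reflex_norm_ideal_def)
  define \<ll> where "\<ll> = ideal_mult \<ff>' (ideal_inv K' \<bb>)"
  define m where "m = siegel_mult L K \<Phi> \<ff>\<^sub>0 \<cc>"
  define N where "N = smallest_pos_int (ideal_ext K \<ff>\<^sub>0)"
  have lat: "siegel_lattice L K \<Phi> \<ff>\<^sub>0 \<cc> = \<ll>"
    by (simp add: siegel_lattice_def reflex_norm_ideal_eq[OF b] \<ll>_def)
  have lat': "siegel_lattice L K \<Phi> \<ff>\<^sub>0 \<cc>' = (\<lambda>x. inverse \<mu> * x) ` \<ll>"
    by (simp only: siegel_lattice_def reflex_norm_ideal_eq[OF b'] ideal_inv_scale[OF subK' lam]
      ideal_mult_scale_right \<ll>_def)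
  have mult': "siegel_mult L K \<Phi> \<ff>\<^sub>0 \<cc>' = real p / real q * m"
    unfolding m_def
  proof (rule siegel_mult_scale[OF pq(1,2)])
    have "\<exists>e\<in>int_ring K'. e \<noteq> 0 \<and> e * \<mu> \<in> int_ring K'"
    proof (rule bexI[of _ "reflex_norm \<beta>"])
      have "reflex_norm \<beta> * \<mu> = reflex_norm \<alpha>"
        using reflex_norm_divide[OF K] reflex_norm_nonzero[OF K(2) ab(4)] by (simp add: \<mu>_def \<nu>_def)
      then show "reflex_norm \<beta> \<noteq> 0 \<and> reflex_norm \<beta> * \<mu> \<in> int_ring K'"
        using reflex_norm_algebraic_int[OF ab(1)] reflex_norm_nonzero[OF K(2) ab(4)] by simp
    qed (rule reflex_norm_algebraic_int[OF ab(2)])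
    then have "frac_ideal K' ((\<lambda>x. \<mu> * x) ` int_ring K')"
      using lam by (intro frac_ideal_scale frac_ideal_int_ring subK')
    then show "abs_norm K' (ideal_mult (ideal_inv K' \<ff>') (reflex_norm_ideal L K \<Phi> \<cc>')) =
      (real p / real q) ^ CARD('g) * abs_norm K' (ideal_mult (ideal_inv K' \<ff>') (reflex_norm_ideal L K \<Phi> \<cc>))"
      unfolding reflex_norm_ideal_eq[OF b] reflex_norm_ideal_eq[OF b'] ideal_mult_scale_right
      using pq frac by (intro abs_norm_scale frac_ideal_ideal_mult frac_ideal_ideal_inv subK' f'_frac_ideal)
  qed
  have lK: "\<ll> \<subseteq> K'"
    unfolding \<ll>_def using frac_ideal_subset[OF f'_frac_ideal] subfieldD(5)[OF subK']
    by (intro ideal_mult_subset subfield_subspace subK') (auto simp: ideal_inv_def)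
  have one: "\<mu> - 1 \<in> \<ll>"
    unfolding \<ll>_def \<mu>_def \<nu>_def by (rule reflex_norm_minus_one[OF c b ab u])
  define \<kappa> where "\<kappa> j = inverse (\<psi> j \<mu>)" for j
  have psi0: "\<psi> j \<mu> \<noteq> 0" for j using field_embedding.nonzero[OF psi_field_embedding lam] .
  then have kap0: "\<kappa> j \<noteq> 0" for j by (simp add: \<kappa>_def)
  have kap: "\<kappa> j * cnj (\<kappa> j) = of_real (real q / real p)" for j
  proof -
    have "\<psi> j \<mu> * cnj (\<psi> j \<mu>) = of_nat p / of_nat q"
      using reflex_type_norm[OF psi_reflex_type nu(1)] pq(3) by (simp add: \<mu>_def)
    then have "inverse (\<psi> j \<mu> * cnj (\<psi> j \<mu>)) = of_nat q / of_nat p" by simp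
    then show ?thesis by (simp add: \<kappa>_def)
  qed
  have Psi_scale: "Psi \<psi> (inverse \<mu> * x) = diag_scale \<kappa> (Psi \<psi> x)" if "x \<in> K'" for x
    using field_embedding.divide[OF psi_field_embedding that lam(1)]
    by (simp add: Psi_def diag_scale_def \<kappa>_def vec_eq_iff field_simps)
  fix w assume "w \<in> siegel_values \<psi> \<xi> L K \<Phi> \<ff>\<^sub>0 \<cc>"
  then obtain b' y and r :: "'g + 'g \<Rightarrow> int" where
    sb: "symplectic_basis (Psi \<psi> ` \<ll>) (\<lambda>u v. of_real m * E_form \<psi> \<xi> u v) b'"
    and y: "\<And>j. y j \<in> \<ll>" "\<And>j. b' j = Psi \<psi> (y j)"
    and N: "of_nat N = (\<Sum>j\<in>UNIV. of_int (r j) * y j)"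
    and w: "w = Theta_value N (\<chi> i. of_int (r (Inl i)) / of_nat N) (\<chi> i. of_int (r (Inr i)) / of_nat N) (cm_point b')"
    unfolding siegel_values_def Let_def lat m_def[symmetric] N_def[symmetric] by blast
  have zb: "Z_basis (Psi \<psi> ` \<ll>) b'" and sym: "\<And>i j. of_real m * E_form \<psi> \<xi> (b' i) (b' j) = symplectic_entry i j"
    using sb by (auto simp: symplectic_basis_def)
  have b'_eq: "b' = (\<lambda>j. Psi \<psi> (y j))" using y(2) by blast
  obtain t :: "'g + 'g \<Rightarrow> int" where t: "\<mu> - 1 = (\<Sum>j\<in>UNIV. of_int (t j) * y j)"
    using Z_basis_Psi[OF zb[unfolded b'_eq] lK y(1) one] by blast
  define b'' where "b'' j = diag_scale \<kappa> (b' j)" for j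
  define y' where "y' j = inverse \<mu> * y j" for j
  \<comment> \<open>With \<open>t\<close> the coordinates of \<mu> - 1 in \<open>y\<close>, the
    number \<mu> N = N + N (\<mu> - 1) has coordinates r + N t; dividing by \<mu> passes to the
    basis \<open>y'\<close>.\<close>
  define r' where "r' j = r j + int N * t j" for j
  have yK: "y j \<in> K'" for j using y(1) lK by blast
  have "Psi \<psi> ` ((\<lambda>x. inverse \<mu> * x) ` \<ll>) = diag_scale \<kappa> ` (Psi \<psi> ` \<ll>)"
    unfolding image_image using lK Psi_scale by (intro image_cong) auto
  then have zb': "Z_basis (Psi \<psi> ` ((\<lambda>x. inverse \<mu> * x) ` \<ll>)) b''"
    unfolding b''_def using Z_basis_diag_scale[OF zb kap0] by simp
  \<comment> \<open>The factor q / p produced by \<kappa> cancels the factor p / q by which the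
    multiplier of the polarization changes.\<close>
  have sym': "of_real (real p / real q * m) * E_form \<psi> \<xi> (b'' i) (b'' j) = symplectic_entry i j" for i j
    using sym[of i j] pq(1,2) by (simp add: b''_def E_form_diag_scale[of \<kappa>, OF kap] field_simps)
  have "symplectic_basis (Psi \<psi> ` siegel_lattice L K \<Phi> \<ff>\<^sub>0 \<cc>')
      (\<lambda>u v. of_real (siegel_mult L K \<Phi> \<ff>\<^sub>0 \<cc>') * E_form \<psi> \<xi> u v) b''"
    unfolding symplectic_basis_def lat' mult' using zb' sym' by blast
  moreover have "\<forall>j. y' j \<in> siegel_lattice L K \<Phi> \<ff>\<^sub>0 \<cc>' \<and> b'' j = Psi \<psi> (y' j)"
    unfolding lat' y'_def b''_def using y yK Psi_scale by auto
  moreover have "of_nat N = (\<Sum>j\<in>UNIV. of_int (r' j) * y' j)"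
  proof -
    have "(\<Sum>j\<in>UNIV. of_int (r' j) * y' j) =
        inverse \<mu> * ((\<Sum>j\<in>UNIV. of_int (r j) * y j) + of_nat N * (\<Sum>j\<in>UNIV. of_int (t j) * y j))"
      by (simp add: r'_def y'_def sum_distrib_left sum.distrib algebra_simps)
    also have "\<dots> = of_nat N" unfolding t[symmetric] N[symmetric] using lam(2) by (simp add: field_simps)
    finally show ?thesis by simp
  qed
  moreover have "w = Theta_value N (\<chi> i. of_int (r' (Inl i)) / of_nat N) (\<chi> i. of_int (r' (Inr i)) / of_nat N) (cm_point b'')"
  proof -
    have cm: "cm_point b'' = cm_point b'"
      unfolding b''_def using invertible_symplectic[OF P2 sym] kap0 by (intro cm_point_diag_scale)
    show ?thesis
    proof (cases "N = 0")
      \<comment> \<open>Division by zero makes both characteristics vanish, so the two values agree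
        trivially.\<close>
      case True
      then show ?thesis by (simp add: w cm)
    next
      case False
      have "(\<chi> i. of_int (r' (h i)) / of_nat N :: real ^ 'g) =
        (\<chi> i. of_int (r (h i)) / of_nat N) + (\<chi> i. of_int (t (h i)))" for h :: "'g \<Rightarrow> 'g + 'g"
        using False by (simp add: vec_eq_iff r'_def field_simps)
      \<comment> \<open>The numerators agree at every Z and not only at the CM-point, so the limits
        that define the meromorphic values coincide, also where the denominator vanishes.\<close>
      then have "Theta_num N (\<chi> i. of_int (r' (Inl i)) / of_nat N) (\<chi> i. of_int (r' (Inr i)) / of_nat N) Z =
        Theta_num N (\<chi> i. of_int (r (Inl i)) / of_nat N) (\<chi> i. of_int (r (Inr i)) / of_nat N) Z"
        for Z :: "complex ^ 'g ^ 'g"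
        using False by (simp only:) (intro Theta_num_shift, auto)
      then show ?thesis unfolding w cm Theta_value_def by presburger
    qed
  qed
  ultimately show "w \<in> siegel_values \<psi> \<xi> L K \<Phi> \<ff>\<^sub>0 ((\<lambda>x. \<alpha> / \<beta> * x) ` \<cc>)"
    unfolding siegel_values_def Let_def \<cc>'_def[symmetric] N_def[symmetric] by blast
qed

text \<open>Existence of the ideal \<open>\<phi>(\<cc>)\<close> is not needed: if it does not exist, then neither does \<open>\<phi>(\<nu>\<cc>)\<close>, and
  the two definite descriptions coincide because both of their predicates are constantly false.\<close>

lemma siegel_values_scale:
  assumes c: "\<cc> \<subseteq> int_ring K" "(\<lambda>x. \<alpha> / \<beta> * x) ` \<cc> \<subseteq> int_ring K"
    and ab: "\<alpha> \<in> int_ring K" "\<beta> \<in> int_ring K" "\<alpha> \<noteq> 0" "\<beta> \<noteq> 0" "\<alpha> - \<beta> \<in> ideal_ext K \<ff>\<^sub>0"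
    and u: "u \<in> int_ring K" "\<beta> * u - 1 \<in> ideal_ext K \<ff>\<^sub>0"
    and v: "v \<in> int_ring K" "\<alpha> * v - 1 \<in> ideal_ext K \<ff>\<^sub>0"
  shows "siegel_values \<psi> \<xi> L K \<Phi> \<ff>\<^sub>0 \<cc> = siegel_values \<psi> \<xi> L K \<Phi> \<ff>\<^sub>0 ((\<lambda>x. \<alpha> / \<beta> * x) ` \<cc>)"
proof -
  define \<cc>' where "\<cc>' = (\<lambda>x. \<alpha> / \<beta> * x) ` \<cc>"
  have image_inv: "(\<lambda>x. \<beta> / \<alpha> * x) ` \<cc>' = \<cc>" using ab(3,4) by (simp add: \<cc>'_def image_image)
  have cK: "\<cc> \<subseteq> K" "\<cc>' \<subseteq> K" using c int_ring_subset unfolding \<cc>'_def by blast+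
  have forth: "is_reflex_norm_ideal \<cc>' ((\<lambda>x. reflex_norm (\<alpha> / \<beta>) * x) ` \<bb>)"
    if "is_reflex_norm_ideal \<cc> \<bb>" for \<bb>
    unfolding \<cc>'_def using cK ab that by (intro is_reflex_norm_ideal_scale)
  have back_to: "is_reflex_norm_ideal \<cc> ((\<lambda>x. reflex_norm (\<beta> / \<alpha>) * x) ` \<bb>)"
    if "is_reflex_norm_ideal \<cc>' \<bb>" for \<bb>
    using is_reflex_norm_ideal_scale[OF cK(2) ab(2,1,4,3) that] unfolding image_inv .
  show ?thesis
  proof (cases "\<exists>\<bb>. is_reflex_norm_ideal \<cc> \<bb>")
    case True
    then obtain \<bb> where b: "is_reflex_norm_ideal \<cc> \<bb>" by blast
    have "\<beta> - \<alpha> \<in> ideal_ext K \<ff>\<^sub>0"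
      using int_complex.subspace_neg[of "ideal_ext K \<ff>\<^sub>0", OF _ ab(5)] ideal_mult_subspace
      by (simp add: ideal_ext_def)
    then have "siegel_values \<psi> \<xi> L K \<Phi> \<ff>\<^sub>0 \<cc>' \<subseteq> siegel_values \<psi> \<xi> L K \<Phi> \<ff>\<^sub>0 ((\<lambda>x. \<beta> / \<alpha> * x) ` \<cc>')"
      using c ab v forth[OF b] image_inv unfolding \<cc>'_def[symmetric] by (intro siegel_values_subset) auto
    moreover have "siegel_values \<psi> \<xi> L K \<Phi> \<ff>\<^sub>0 \<cc> \<subseteq> siegel_values \<psi> \<xi> L K \<Phi> \<ff>\<^sub>0 \<cc>'"
      unfolding \<cc>'_def by (rule siegel_values_subset[OF c b ab u])
    ultimately show ?thesis unfolding \<cc>'_def[symmetric] image_inv by blast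
  next
    case False
    then have "is_reflex_norm_ideal \<cc> = is_reflex_norm_ideal \<cc>'" using back_to by blast
    then have "reflex_norm_ideal L K \<Phi> \<cc> = reflex_norm_ideal L K \<Phi> \<cc>'"
      by (simp only: reflex_norm_ideal_The)
    then show ?thesis
      unfolding \<cc>'_def[symmetric] by (simp only: siegel_values_def siegel_lattice_def siegel_mult_def)
  qed
qed

end

section \<open>Ray classes\<close>

lemma ideal_mult_principal:
  assumes "complex_subfield F" "frac_ideal F I"
  shows "ideal_mult (principal F a) I = (\<lambda>x. a * x) ` I"
proof -
  have "ideal_mult (int_ring F) I = I"
  proof (intro equalityI subsetI)
    have "ideal_mult (int_ring F) I \<subseteq> I"
      using frac_ideal_mult[OF assms(2)] by (intro ideal_mult_subset frac_ideal_subspace[OF assms])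
    then show "x \<in> I" if "x \<in> ideal_mult (int_ring F) I" for x using that by (rule subsetD)
    show "x \<in> ideal_mult (int_ring F) I" if "x \<in> I" for x
      using ideal_multI[OF int_ring_closed(2)[OF assms(1)] that] by simp
  qed
  then show ?thesis by (simp only: principal_def ideal_mult_scale)
qed

lemma coprime_conductorD:
  assumes "complex_subfield F" "int_complex.subspace J" "ideal_sum (principal F a) J = int_ring F"
  shows "J \<subseteq> int_ring F" "\<exists>u\<in>int_ring F. a * u - 1 \<in> J"
proof -
  show "J \<subseteq> int_ring F"
  proof
    fix x assume "x \<in> J"
    moreover have "a * 0 \<in> principal F a" unfolding principal_def using int_ring_closed(1)[OF assms(1)] by blast
    ultimately have "a * 0 + x \<in> ideal_sum (principal F a) J" unfolding ideal_sum_def by blast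
    then show "x \<in> int_ring F" by (simp add: assms(3))
  qed
  have "1 \<in> ideal_sum (principal F a) J" using int_ring_closed(2)[OF assms(1)] by (simp add: assms(3))
  then obtain u x where ux: "u \<in> int_ring F" "x \<in> J" "1 = a * u + x" by (auto simp: ideal_sum_def principal_def)
  then have "a * u - 1 = - x" by (simp add: algebra_simps)
  then show "\<exists>u\<in>int_ring F. a * u - 1 \<in> J" using ux int_complex.subspace_neg[OF assms(2)] by (metis)
qed

lemma coprime_conductor_mult:
  assumes "complex_subfield F" "int_complex.subspace J" "\<And>a x. a \<in> int_ring F \<Longrightarrow> x \<in> J \<Longrightarrow> a * x \<in> J"
    and "a \<in> int_ring F" "\<exists>u\<in>int_ring F. a * u - 1 \<in> J" "\<exists>u\<in>int_ring F. b * u - 1 \<in> J"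
  shows "\<exists>u\<in>int_ring F. (a * b) * u - 1 \<in> J"
proof -
  obtain u v where uv: "u \<in> int_ring F" "a * u - 1 \<in> J" "v \<in> int_ring F" "b * v - 1 \<in> J" using assms by blast
  have "(a * u) * (b * v - 1) + (a * u - 1) \<in> J"
    using uv assms(4) int_ring_closed(5)[OF assms(1)]
    by (intro int_complex.subspace_add[OF assms(2)] assms(3)) auto
  also have "(a * u) * (b * v - 1) + (a * u - 1) = (a * b) * (u * v) - 1" by (simp add: algebra_simps)
  finally show ?thesis using uv int_ring_closed(5)[OF assms(1)] by blast
qed

text \<open>Both ideals are compared with one representative \<open>\<aa>\<close> of the coset
  \<open>C\<close>. It is prime to the conductor but possibly not integral, so the passage from
  \<open>\<cc>\<close> to \<open>\<cc>'\<close> is made in a single step by the quotient of the two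
  multipliers.\<close>

theorem proposition5p6:
  fixes K L K' \<ff>\<^sub>0 \<cc> \<cc>' :: "complex set"
    and \<Phi> :: "(complex \<Rightarrow> complex) set"
    and \<psi> :: "'g::finite \<Rightarrow> complex \<Rightarrow> complex"
    and \<xi> :: complex
    and C :: "complex set set"
  assumes "cm_field K" and "cm_type K \<Phi>"
    and "finite_galois_over_Q L" and "K \<subseteq> L"
    and "K' = reflex_field L K \<Phi>"
    and "bij_betw \<psi> UNIV (reflex_type L K \<Phi>)"
    and C1: "principally_polarizable (Psi \<psi> ` int_ring K')"
    and C2: "reflex_field L K' (reflex_type L K \<Phi>) = K"
    and "\<xi> \<in> K'"
    and P1: "\<forall>j. Re (\<psi> j \<xi>) = 0 \<and> Im (\<psi> j \<xi>) > 0"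
    and P2: "riemann_form (Psi \<psi> ` int_ring K') (E_form \<psi> \<xi>)"
    and P3: "ideal_inv K' (different K') = principal K' \<xi>"
    and "integral_ideal (type_fixed_field L K \<Phi>) \<ff>\<^sub>0"
    and "\<ff>\<^sub>0 \<noteq> int_ring (type_fixed_field L K \<Phi>)"
    and "C \<in> carrier (ray_class_group K (ideal_ext K \<ff>\<^sub>0))"
    and "\<cc> \<in> C" and "integral_ideal K \<cc>"
    and "\<cc>' \<in> C" and "integral_ideal K \<cc>'"
  shows "siegel_values \<psi> \<xi> L K \<Phi> \<ff>\<^sub>0 \<cc> = siegel_values \<psi> \<xi> L K \<Phi> \<ff>\<^sub>0 \<cc>'"
proof -
  interpret siegel_data L K \<Phi> \<psi> \<xi> \<ff>\<^sub>0
    using assms by unfold_locales simp_all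
  define \<ff> where "\<ff> = ideal_ext K \<ff>\<^sub>0"
  have f_sub: "int_complex.subspace \<ff>" unfolding \<ff>_def ideal_ext_def by (rule ideal_mult_subspace)
  have f_closed: "a * x \<in> \<ff>" if "a \<in> int_ring K" "x \<in> \<ff>" for a x
    using ideal_ext_closed[OF K_subfield] that by (simp add: \<ff>_def)
  note closed = int_ring_closed[OF K_subfield]
  obtain \<aa> where a: "prime_to K \<ff> \<aa>"
      "C = r_coset (ideals_prime_to K \<ff>) {principal K \<nu> | \<nu>. \<nu> \<in> K \<and> cong_one K \<ff> \<nu>} \<aa>"
    using assms(15) by (auto simp: ray_class_group_def FactGroup_def RCOSETS_def ideals_prime_to_def \<ff>_def)
  have frac: "frac_ideal K \<aa>" using a(1) by (simp add: prime_to_def)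
  have "\<exists>\<alpha>\<in>int_ring K. \<exists>\<beta>\<in>int_ring K. \<alpha> \<noteq> 0 \<and> \<beta> \<noteq> 0 \<and> \<alpha> - \<beta> \<in> \<ff> \<and> x = (\<lambda>z. \<alpha> / \<beta> * z) ` \<aa> \<and>
      (\<exists>u\<in>int_ring K. \<alpha> * u - 1 \<in> \<ff>) \<and> (\<exists>u\<in>int_ring K. \<beta> * u - 1 \<in> \<ff>)" if x: "x \<in> C" for x
  proof -
    obtain \<nu> where nu: "cong_one K \<ff> \<nu>" "x = ideal_mult (principal K \<nu>) \<aa>"
      using x unfolding a(2) by (auto simp: r_coset_def ideals_prime_to_def)
    obtain \<alpha> \<beta> where ab: "\<alpha> \<in> int_ring K" "\<beta> \<in> int_ring K" "\<alpha> \<noteq> 0" "\<beta> \<noteq> 0" "\<nu> = \<alpha> / \<beta>" "\<alpha> - \<beta> \<in> \<ff>"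
      "ideal_sum (principal K \<alpha>) \<ff> = int_ring K" "ideal_sum (principal K \<beta>) \<ff> = int_ring K"
      using nu(1) by (auto simp: cong_one_def)
    have "x = (\<lambda>z. \<alpha> / \<beta> * z) ` \<aa>" using nu(2) ab(5) ideal_mult_principal[OF K_subfield frac] by simp
    then show ?thesis
      using ab coprime_conductorD(2)[OF K_subfield f_sub ab(7)] coprime_conductorD(2)[OF K_subfield f_sub ab(8)]
      by blast
  qed
  from this[OF \<open>\<cc> \<in> C\<close>] this[OF \<open>\<cc>' \<in> C\<close>] obtain \<alpha>1 \<beta>1 \<alpha>2 \<beta>2 where
    1: "\<alpha>1 \<in> int_ring K" "\<beta>1 \<in> int_ring K" "\<alpha>1 \<noteq> 0" "\<beta>1 \<noteq> 0" "\<alpha>1 - \<beta>1 \<in> \<ff>" "\<cc> = (\<lambda>z. \<alpha>1 / \<beta>1 * z) ` \<aa>"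
      "\<exists>u\<in>int_ring K. \<alpha>1 * u - 1 \<in> \<ff>" "\<exists>u\<in>int_ring K. \<beta>1 * u - 1 \<in> \<ff>" and
    2: "\<alpha>2 \<in> int_ring K" "\<beta>2 \<in> int_ring K" "\<alpha>2 \<noteq> 0" "\<beta>2 \<noteq> 0" "\<alpha>2 - \<beta>2 \<in> \<ff>" "\<cc>' = (\<lambda>z. \<alpha>2 / \<beta>2 * z) ` \<aa>"
      "\<exists>u\<in>int_ring K. \<alpha>2 * u - 1 \<in> \<ff>" "\<exists>u\<in>int_ring K. \<beta>2 * u - 1 \<in> \<ff>"
    by blast
  \<comment> \<open>Cross multiplication of \<alpha>2 / \<beta>2 by the inverse of \<alpha>1 /
    \<beta>1; numerator and denominator remain integral and prime to the conductor.\<close>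
  define \<alpha> \<beta> where "\<alpha> = \<alpha>2 * \<beta>1" and "\<beta> = \<beta>2 * \<alpha>1"
  have c': "\<cc>' = (\<lambda>x. \<alpha> / \<beta> * x) ` \<cc>"
    unfolding 1(6) 2(6) image_image using 1(3,4) by (simp add: \<alpha>_def \<beta>_def)
  have "\<beta>1 * (\<alpha>2 - \<beta>2) - \<beta>2 * (\<alpha>1 - \<beta>1) \<in> \<ff>"
    using int_complex.subspace_diff[OF f_sub f_closed[OF 1(2) 2(5)] f_closed[OF 2(2) 1(5)]] .
  then have "\<alpha> - \<beta> \<in> \<ff>" by (simp add: \<alpha>_def \<beta>_def algebra_simps)
  moreover obtain u where "u \<in> int_ring K" "\<beta> * u - 1 \<in> \<ff>"
    using coprime_conductor_mult[OF K_subfield f_sub f_closed 2(2) 2(8) 1(7)] by (auto simp: \<beta>_def)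
  moreover obtain v where "v \<in> int_ring K" "\<alpha> * v - 1 \<in> \<ff>"
    using coprime_conductor_mult[OF K_subfield f_sub f_closed 2(1) 2(7) 1(8)] by (auto simp: \<alpha>_def)
  moreover have "\<alpha> \<in> int_ring K" "\<beta> \<in> int_ring K" "\<alpha> \<noteq> 0" "\<beta> \<noteq> 0"
    using 1 2 closed(5) by (auto simp: \<alpha>_def \<beta>_def)
  moreover have "\<cc> \<subseteq> int_ring K" "(\<lambda>x. \<alpha> / \<beta> * x) ` \<cc> \<subseteq> int_ring K"
    using assms(17,19) c' by (auto simp: integral_ideal_def)
  ultimately show ?thesis
    unfolding c' \<ff>_def by (intro siegel_values_scale)
qed

end
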